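(* Let $X=\ell^p(\mathbb{N}_0)$ ($1\le p<\infty$) or $X=c_0(\mathbb{N}_0)$. Let $h>0$, $n\in\mathbb{N}$, and let $f_1,\dots,f_n$ be holomorphic functions on $\overline{B(-1/h,1/h)}$ such that there exists some $\tilde z\in B(-1/h,1/h)$ with $\mathrm{res}_\lambda\left(G_h,\frac{\partial G_h}{\partial z}\right)(\tilde z)\ne0$, where $G_h(\lambda,z):=f_1(z)+\lambda f_2(z)+\dots+\lambda^{n-1}f_n(z)-\lambda^n$ on $\mathbb{C}\times\overline{B(-1/h,1/h)}$. Let $$A_h^+=\begin{pmatrix}0&I&0&\dots\\0&0&I&\dots\\ \vdots&\vdots&\vdots&\ddots\\ f_1(\Delta_h^+)&f_2(\Delta_h^+)&\dots&f_n(\Delta_h^+)\end{pmatrix}:X^n\to X^n.$$ Then the following assertions are equivalent: (i) $A_h^+$ generates a sub-chaotic semigroup $(e^{tA_h^+})_{t\ge0}$ on $X^n$ such that the projection family $(\pi(e^{tA_h^+}):X^n\to X)_{t\ge0}$ is Devaney chaotic. (ii) There are some $\lambda_0\in i\mathbb{R}$, $z_0\in B(-1/h,1/h)$ such that $G_h(\lambda_0,z_0)=0$ and $\mathrm{res}_\lambda\left(G_h,\frac{\partial G_h}{\partial z}\right)(z_0)\neq0$. (iii) Every autonomous discretization of $(e^{tA_h^+})_{t\ge0}$ is Devaney sub-chaotic on $X^n$. (iv) Some autonomous discretization of $(e^{tA_h^+})_{t\ge0}$ is Devaney sub-chaotic on $X^n$.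
   Context: $B(c,r)$ is the open disc in $\mathbb{C}$ with center $c$ and radius $r$. The forward difference operator on $X$ is $\Delta_h^+=\frac{B-I}{h}$, where $B$ is the backward shift $B(x_0,x_1,\dots)=(x_1,x_2,\dots)$; $\sigma(\Delta_h^+)=\overline{B(-1/h,1/h)}$. "Holomorphic on $\overline{B(-1/h,1/h)}$" means holomorphic on a neighborhood of it; $f_i(\Delta_h^+)$ is defined by the Riesz–Dunford functional calculus. Resultant: for fixed $z$, $G_h(\cdot,z)$ and $\frac{\partial G_h}{\partial z}(\cdot,z)$ are polynomials in $\lambda$ (of degree $n$ and of formal degree $n-1$); $\mathrm{res}_\lambda(G_h,\frac{\partial G_h}{\partial z})(z)$ is their resultant (determinant of the Sylvester matrix), which vanishes iff they have a common root (in particular it is $0$ if $\frac{\partial G_h}{\partial z}(\cdot,z)\equiv0$). An operator $T$ is Devaney chaotic if some orbit $\{T^kx:k\ge0\}$ is dense and its periodic points are dense. A $C_0$-semigroup $(T_t)$ is Devaney chaotic if $\{T_tx:t\ge0\}$ is dense for some $x$ and the set of $x$ with $T_tx=x$ for some $t>0$ is dense. An operator or semigroup is (Devaney) sub-chaotic, with respect to $Y$, if $Y\ne\{0\}$ is a closed invariant subspace on which its restriction is Devaney chaotic; sub-chaotic means for some such $Y$. With $\pi:X^n\to X$ the first coordinate projection, the projection family $(\pi\circ\mathcal{T}_t)_{t\ge0}$ of a $C_0$-semigroup $(\mathcal{T}_t)$ on $X^n$ is Devaney chaotic if $(\mathcal{T}_t)$ is sub-chaotic with respect to some closed invariant subspace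 $Y\ne\{0\}$ with $\overline{\pi(Y)}=X$. An autonomous discretization of $(\mathcal{T}_t)$ is the sequence of iterates of $\mathcal{T}_{t_0}$ for a fixed $t_0>0$; it is sub-chaotic if the operator $\mathcal{T}_{t_0}$ is. *)

theory Defs
  imports
    "HOL-Complex_Analysis.Complex_Analysis"
    "HOL-Library.Function_Algebras"
    "Subresultants.Resultant_Prelim"
begin

section \<open>Normed spaces of complex-valued functions\<close>

text \<open>
  All spaces below consist of functions into the complex numbers with the pointwise operations:
  \<open>\<ell>\<^sup>p\<close> and \<open>c\<^sub>0\<close> are sets of functions on \<^typ>\<open>nat\<close>, and \<open>X\<^sup>n\<close> is a set of functions on
  \<^typ>\<open>nat \<times> nat\<close> (component, position). Since \<open>p\<close> and \<open>n\<close> are variables, the spaces are not types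
  but carrier sets equipped with a norm. Maps between spaces are total HOL functions of which only
  the values on the carrier matter.
\<close>

record 'i fspace =
  vecs :: "('i \<Rightarrow> complex) set"
  vnorm :: "('i \<Rightarrow> complex) \<Rightarrow> real"

definition scl :: "complex \<Rightarrow> ('i \<Rightarrow> complex) \<Rightarrow> 'i \<Rightarrow> complex" where
  "scl c x = (\<lambda>i. c * x i)"

global_interpretation cvec: vector_space "scl :: complex \<Rightarrow> ('i \<Rightarrow> complex) \<Rightarrow> 'i \<Rightarrow> complex"
  by unfold_locales (auto simp: scl_def fun_eq_iff algebra_simps)

text \<open>
  The guard is needed because \<open>Metric_space\<close> requires nonnegativity for all arguments, whereas
  the norm of a non-member (for instance the supremum of an unbounded set) is unspecified.
\<close>

definition vdist :: "('i, 'b) fspace_scheme \<Rightarrow> ('i \<Rightarrow> complex) \<Rightarrow> ('i \<Rightarrow> complex) \<Rightarrow> real" where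
  "vdist V x y = (if x \<in> vecs V \<and> y \<in> vecs V then vnorm V (x - y) else 0)"

definition vtop :: "('i, 'b) fspace_scheme \<Rightarrow> ('i \<Rightarrow> complex) topology" where
  "vtop V = Metric_space.mtopology (vecs V) (vdist V)"

definition bounded_op ::
  "('i, 'b) fspace_scheme \<Rightarrow> (('i \<Rightarrow> complex) \<Rightarrow> ('i \<Rightarrow> complex)) \<Rightarrow> bool" where
  "bounded_op V T \<longleftrightarrow>
     (\<forall>x\<in>vecs V. T x \<in> vecs V) \<and>
     (\<forall>x\<in>vecs V. \<forall>y\<in>vecs V. T (x + y) = T x + T y) \<and>
     (\<forall>c. \<forall>x\<in>vecs V. T (scl c x) = scl c (T x)) \<and>
     (\<exists>C. \<forall>x\<in>vecs V. vnorm V (T x) \<le> C * vnorm V x)"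

definition topological_dual :: "('i, 'b) fspace_scheme \<Rightarrow> (('i \<Rightarrow> complex) \<Rightarrow> complex) set" where
  "topological_dual V = {\<phi>.
     (\<forall>x\<in>vecs V. \<forall>y\<in>vecs V. \<phi> (x + y) = \<phi> x + \<phi> y) \<and>
     (\<forall>c. \<forall>x\<in>vecs V. \<phi> (scl c x) = c * \<phi> x) \<and>
     (\<exists>C. \<forall>x\<in>vecs V. cmod (\<phi> x) \<le> C * vnorm V x)}"

definition lp_space :: "real \<Rightarrow> nat fspace" where
  "lp_space p =
     \<lparr> vecs = {x. summable (\<lambda>k. cmod (x k) powr p)},
       vnorm = (\<lambda>x. (\<Sum>k. cmod (x k) powr p) powr (1 / p)) \<rparr>"

definition c0_space :: "nat fspace" where
  "c0_space = \<lparr> vecs = {x. x \<longlonglongrightarrow> 0}, vnorm = (\<lambda>x. SUP k. cmod (x k)) \<rparr>"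

text \<open>
  An element \<open>x\<close> of \<open>X\<^sup>n\<close> has the components \<open>curry x 0, \<dots>, curry x (n - 1)\<close>; it is padded by zero
  so that equality in \<open>X\<^sup>n\<close> is equality of functions.
\<close>

definition power_space :: "nat fspace \<Rightarrow> nat \<Rightarrow> (nat \<times> nat) fspace" where
  "power_space X n =
     \<lparr> vecs = {x. (\<forall>i<n. curry x i \<in> vecs X) \<and> (\<forall>i\<ge>n. curry x i = 0)},
       vnorm = (\<lambda>x. \<Sum>i<n. vnorm X (curry x i)) \<rparr>"

definition proj0 :: "(nat \<times> nat \<Rightarrow> complex) \<Rightarrow> (nat \<Rightarrow> complex)" where
  "proj0 x = curry x 0"


section \<open>Riesz--Dunford functional calculus\<close>

definition op_spectrum ::
  "('i, 'b) fspace_scheme \<Rightarrow> (('i \<Rightarrow> complex) \<Rightarrow> ('i \<Rightarrow> complex)) \<Rightarrow> complex set" where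
  "op_spectrum V T = {z. \<not> (bij_betw (\<lambda>x. scl z x - T x) (vecs V) (vecs V) \<and>
     (\<exists>C. \<forall>x\<in>vecs V. vnorm V x \<le> C * vnorm V (scl z x - T x)))}"

definition op_resolvent ::
  "('i, 'b) fspace_scheme \<Rightarrow> (('i \<Rightarrow> complex) \<Rightarrow> ('i \<Rightarrow> complex)) \<Rightarrow> complex \<Rightarrow>
     ('i \<Rightarrow> complex) \<Rightarrow> ('i \<Rightarrow> complex)" where
  "op_resolvent V T z = inv_into (vecs V) (\<lambda>x. scl z x - T x)"

text \<open>A single closed path suffices here because all spectra considered are closed discs.\<close>

definition surrounds_within :: "(real \<Rightarrow> complex) \<Rightarrow> complex set \<Rightarrow> complex set \<Rightarrow> bool" where
  "surrounds_within \<gamma> K U \<longleftrightarrow>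
     valid_path \<gamma> \<and> pathfinish \<gamma> = pathstart \<gamma> \<and> path_image \<gamma> \<subseteq> U - K \<and>
     (\<forall>z\<in>K. winding_number \<gamma> z = 1) \<and> (\<forall>z. z \<notin> U \<longrightarrow> winding_number \<gamma> z = 0)"

text \<open>
  \<open>f(T) x = 1/(2\<pi>i) \<integral>\<^sub>\<gamma> f(z) (zI - T)\<^sup>-\<^sup>1 x dz\<close>. The vector-valued integral is the vector \<open>y\<close> such that
  every continuous linear functional maps \<open>y\<close> to the integral of the functional applied to the
  integrand. The value depends neither on \<open>U\<close> nor on \<open>\<gamma>\<close>.
\<close>

definition riesz_dunford ::
  "('i, 'b) fspace_scheme \<Rightarrow> (('i \<Rightarrow> complex) \<Rightarrow> ('i \<Rightarrow> complex)) \<Rightarrow> (complex \<Rightarrow> complex) \<Rightarrow>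
     ('i \<Rightarrow> complex) \<Rightarrow> ('i \<Rightarrow> complex)" where
  "riesz_dunford V T f x = (THE y. y \<in> vecs V \<and>
     (\<exists>U \<gamma>. open U \<and> op_spectrum V T \<subseteq> U \<and> f holomorphic_on U \<and>
        surrounds_within \<gamma> (op_spectrum V T) U \<and>
        (\<forall>\<phi>\<in>topological_dual V.
           ((\<lambda>z. f z * \<phi> (op_resolvent V T z x)) has_contour_integral 2 * pi * \<i> * \<phi> y) \<gamma>)))"


section \<open>Semigroups\<close>

definition C0_semigroup ::
  "('i, 'b) fspace_scheme \<Rightarrow> (real \<Rightarrow> ('i \<Rightarrow> complex) \<Rightarrow> ('i \<Rightarrow> complex)) \<Rightarrow> bool" where
  "C0_semigroup V T \<longleftrightarrow>
     (\<forall>t\<ge>0. bounded_op V (T t)) \<and>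
     (\<forall>x\<in>vecs V. T 0 x = x) \<and>
     (\<forall>s\<ge>0. \<forall>t\<ge>0. \<forall>x\<in>vecs V. T (s + t) x = T s (T t x)) \<and>
     (\<forall>x\<in>vecs V. limitin (vtop V) (\<lambda>t. T t x) x (at_right 0))"

text \<open>\<open>A\<close> is an everywhere defined operator, so its domain as a generator is the whole space.\<close>

definition generates ::
  "('i, 'b) fspace_scheme \<Rightarrow> (('i \<Rightarrow> complex) \<Rightarrow> ('i \<Rightarrow> complex)) \<Rightarrow>
     (real \<Rightarrow> ('i \<Rightarrow> complex) \<Rightarrow> ('i \<Rightarrow> complex)) \<Rightarrow> bool" where
  "generates V A T \<longleftrightarrow> C0_semigroup V T \<and>
     (\<forall>x\<in>vecs V. limitin (vtop V) (\<lambda>t. scl (1 / of_real t) (T t x - x)) (A x) (at_right 0))"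

text \<open>\<open>op_exp V A t\<close> is \<open>e\<^sup>t\<^sup>A = \<Sum>\<^sub>k t\<^sup>k A\<^sup>k / k!\<close>.\<close>

definition op_exp ::
  "('i, 'b) fspace_scheme \<Rightarrow> (('i \<Rightarrow> complex) \<Rightarrow> ('i \<Rightarrow> complex)) \<Rightarrow> real \<Rightarrow>
     ('i \<Rightarrow> complex) \<Rightarrow> ('i \<Rightarrow> complex)" where
  "op_exp V A t x = (THE y.
     limitin (vtop V) (\<lambda>N. \<Sum>k<N. scl (of_real (t ^ k / fact k)) ((A ^^ k) x)) y sequentially)"


section \<open>Devaney chaos and sub-chaos\<close>

definition dense_in :: "('i, 'b) fspace_scheme \<Rightarrow> ('i \<Rightarrow> complex) set \<Rightarrow> bool" where
  "dense_in V S \<longleftrightarrow> vtop V closure_of S = vecs V"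

definition closed_subspace :: "('i, 'b) fspace_scheme \<Rightarrow> ('i \<Rightarrow> complex) set \<Rightarrow> bool" where
  "closed_subspace V Y \<longleftrightarrow> Y \<subseteq> vecs V \<and> cvec.subspace Y \<and> closedin (vtop V) Y"

definition devaney_chaotic_op ::
  "('i, 'b) fspace_scheme \<Rightarrow> (('i \<Rightarrow> complex) \<Rightarrow> ('i \<Rightarrow> complex)) \<Rightarrow> bool" where
  "devaney_chaotic_op V T \<longleftrightarrow>
     (\<exists>x\<in>vecs V. dense_in V {(T ^^ k) x |k. True}) \<and>
     dense_in V {x \<in> vecs V. \<exists>k\<ge>1. (T ^^ k) x = x}"

definition devaney_chaotic_sg ::
  "('i, 'b) fspace_scheme \<Rightarrow> (real \<Rightarrow> ('i \<Rightarrow> complex) \<Rightarrow> ('i \<Rightarrow> complex)) \<Rightarrow> bool" where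
  "devaney_chaotic_sg V T \<longleftrightarrow>
     (\<exists>x\<in>vecs V. dense_in V {T t x |t. t \<ge> 0}) \<and>
     dense_in V {x \<in> vecs V. \<exists>t>0. T t x = x}"

definition subchaotic_op_wrt ::
  "('i, 'b) fspace_scheme \<Rightarrow> (('i \<Rightarrow> complex) \<Rightarrow> ('i \<Rightarrow> complex)) \<Rightarrow> ('i \<Rightarrow> complex) set \<Rightarrow> bool" where
  "subchaotic_op_wrt V T Y \<longleftrightarrow> closed_subspace V Y \<and> Y \<noteq> {0} \<and> (\<forall>y\<in>Y. T y \<in> Y) \<and>
     devaney_chaotic_op (V\<lparr>vecs := Y\<rparr>) T"

definition subchaotic_sg_wrt ::
  "('i, 'b) fspace_scheme \<Rightarrow> (real \<Rightarrow> ('i \<Rightarrow> complex) \<Rightarrow> ('i \<Rightarrow> complex)) \<Rightarrow>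
     ('i \<Rightarrow> complex) set \<Rightarrow> bool" where
  "subchaotic_sg_wrt V T Y \<longleftrightarrow> closed_subspace V Y \<and> Y \<noteq> {0} \<and> (\<forall>t\<ge>0. \<forall>y\<in>Y. T t y \<in> Y) \<and>
     devaney_chaotic_sg (V\<lparr>vecs := Y\<rparr>) T"

definition subchaotic_op ::
  "('i, 'b) fspace_scheme \<Rightarrow> (('i \<Rightarrow> complex) \<Rightarrow> ('i \<Rightarrow> complex)) \<Rightarrow> bool" where
  "subchaotic_op V T \<longleftrightarrow> (\<exists>Y. subchaotic_op_wrt V T Y)"

definition subchaotic_sg ::
  "('i, 'b) fspace_scheme \<Rightarrow> (real \<Rightarrow> ('i \<Rightarrow> complex) \<Rightarrow> ('i \<Rightarrow> complex)) \<Rightarrow> bool" where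
  "subchaotic_sg V T \<longleftrightarrow> (\<exists>Y. subchaotic_sg_wrt V T Y)"

definition chaotic_projection ::
  "nat fspace \<Rightarrow> nat \<Rightarrow> (real \<Rightarrow> (nat \<times> nat \<Rightarrow> complex) \<Rightarrow> (nat \<times> nat \<Rightarrow> complex)) \<Rightarrow> bool" where
  "chaotic_projection X n T \<longleftrightarrow>
     (\<exists>Y. subchaotic_sg_wrt (power_space X n) T Y \<and> dense_in X (proj0 ` Y))"

text \<open>An autonomous discretization is the sequence of iterates of \<open>T t\<^sub>0\<close>; we represent it by \<open>T t\<^sub>0\<close>.\<close>

definition autonomous_discretizations ::
  "(real \<Rightarrow> ('i \<Rightarrow> complex) \<Rightarrow> ('i \<Rightarrow> complex)) \<Rightarrow> (('i \<Rightarrow> complex) \<Rightarrow> ('i \<Rightarrow> complex)) set" where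
  "autonomous_discretizations T = {T t0 |t0. t0 > 0}"


section \<open>The difference operator, the companion operator and the characteristic function\<close>

definition forward_diff :: "real \<Rightarrow> (nat \<Rightarrow> complex) \<Rightarrow> (nat \<Rightarrow> complex)" where
  "forward_diff h x = (\<lambda>k. (x (Suc k) - x k) / of_real h)"

text \<open>The functions are \<open>f 1, \<dots>, f n\<close>, whereas the rows are numbered from \<open>0\<close> to \<open>n - 1\<close>.\<close>

definition companion_op ::
  "nat fspace \<Rightarrow> real \<Rightarrow> nat \<Rightarrow> (nat \<Rightarrow> complex \<Rightarrow> complex) \<Rightarrow>
     (nat \<times> nat \<Rightarrow> complex) \<Rightarrow> (nat \<times> nat \<Rightarrow> complex)" where
  "companion_op X h n f x = (\<lambda>(i, k).
     if Suc i < n then x (Suc i, k)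
     else if Suc i = n then (\<Sum>j<n. riesz_dunford X (forward_diff h) (f (Suc j)) (curry x j)) k
     else 0)"

definition G :: "nat \<Rightarrow> (nat \<Rightarrow> complex \<Rightarrow> complex) \<Rightarrow> complex \<Rightarrow> complex \<Rightarrow> complex" where
  "G n f l z = (\<Sum>i=1..n. l ^ (i - 1) * f i z) - l ^ n"

definition G_poly :: "nat \<Rightarrow> (nat \<Rightarrow> complex \<Rightarrow> complex) \<Rightarrow> complex \<Rightarrow> complex poly" where
  "G_poly n f z = (\<Sum>i=1..n. monom (f i z) (i - 1)) - monom 1 n"

definition dG_poly :: "nat \<Rightarrow> (nat \<Rightarrow> complex \<Rightarrow> complex) \<Rightarrow> complex \<Rightarrow> complex poly" where
  "dG_poly n f z = (\<Sum>i=1..n. monom (deriv (f i) z) (i - 1))"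

lemma poly_G_poly: "poly (G_poly n f z) l = G n f l z"
  by (simp add: G_poly_def G_def poly_sum poly_monom mult.commute)

lemma poly_dG_poly:
  assumes "\<And>i. i \<in> {1..n} \<Longrightarrow> f i field_differentiable at z"
  shows "poly (dG_poly n f z) l = deriv (G n f l) z"
proof -
  have "((\<lambda>w. (\<Sum>i=1..n. l ^ (i - 1) * f i w) - l ^ n) has_field_derivative
      (\<Sum>i=1..n. l ^ (i - 1) * deriv (f i) z) - 0) (at z)"
    by (intro DERIV_diff DERIV_sum DERIV_cmult DERIV_const)
      (use assms in \<open>auto simp: DERIV_deriv_iff_field_differentiable\<close>)
  then have "(G n f l has_field_derivative poly (dG_poly n f z) l) (at z)"
    by (simp add: dG_poly_def G_def[abs_def] poly_sum poly_monom mult.commute)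
  then show ?thesis
    by (simp add: DERIV_imp_deriv)
qed

text \<open>
  The Sylvester matrix is formed with the formal degrees \<open>n\<close> and \<open>n - 1\<close>, because the degree of
  \<open>dG_poly n f z\<close> may drop for particular \<open>z\<close>.
\<close>

definition G_res :: "nat \<Rightarrow> (nat \<Rightarrow> complex \<Rightarrow> complex) \<Rightarrow> complex \<Rightarrow> complex" where
  "G_res n f z = resultant_sub n (n - 1) (G_poly n f z) (dG_poly n f z)"

end

theory Submission
  imports Defs
begin

text \<open>
  With \<open>w = 1 + h z\<close> the operator \<open>f(\<Delta>)\<close> is a power series in the backward shift \<open>B\<close>, so all
  functional calculi involved are power series in a bounded operator, and the geometric sequence
  \<open>(w\<^sup>k)\<close> is an eigenvector of \<open>\<Delta>\<close> for every \<open>z\<close> in the open disc.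

  (ii) implies (i) and (iii): as the resultant does not vanish at \<open>z\<^sub>0\<close>, the equation \<open>G(\<lambda>, z) = 0\<close> has a
  holomorphic solution \<open>z(\<lambda>)\<close> near \<open>\<lambda>\<^sub>0\<close>, which yields a holomorphic field of eigenvectors of the
  companion operator with eigenvalues \<open>\<lambda>\<close>. By the identity theorem the eigenvectors with \<open>Re \<lambda> < 0\<close>, with
  \<open>Re \<lambda> > 0\<close>, and with \<open>\<lambda>\<close> a rational multiple of \<open>2\<pi>i/t\<close> each span a dense subspace of the closed span \<open>Y\<close>
  of the field. This gives chaos on \<open>Y\<close> by a Baire argument (Godefroy--Shapiro). Since \<open>z(\<lambda>)\<close> is not constant,
  the first components of the field contain enough geometric sequences to span \<open>X\<close>.

  (i) or (iv) implies (ii): periodic vectors are finite sums of eigenvectors with imaginary eigenvalues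
  \<open>\<mu>\<close>, and each such \<open>\<mu>\<close> satisfies \<open>G(\<mu>, z) = 0\<close> for some \<open>z\<close> in the open disc. If the resultant vanished
  at all these \<open>z\<close>, only finitely many \<open>\<mu>\<close> would be possible, and all orbits in the closure of the periodic
  vectors would be bounded.
\<close>

text \<open>The zeros of the resultant are counted in the closed disc: in the open disc alone they
  could accumulate at the boundary, and holomorphy beyond the boundary makes their number finite.
  Each such zero z contributes at most n values \<mu>, because G(., z) has leading coefficient -1.
  The boundary circle belongs to the spectrum of \<Delta> but carries no eigenvectors, since all
  sequences in X tend to 0; this is why the points z found for eigenvalues lie in the open disc. The
  spaces are handled through their coordinates. The field of eigenvectors is holomorphic in each
  coordinate and dominated by one fixed geometric profile; scalar Cauchy estimates are linear in the
  bound, so they turn into norm estimates. The closed span Y depends neither on t nor on the set of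
  eigenvalues that generates it, as long as this set accumulates at the given imaginary point. Hence
  one Y serves the semigroup and all its discretizations.\<close>

lemma sum_fun_apply: "(\<Sum>k\<in>A. u k) i = (\<Sum>k\<in>A. u k i)"
  for u :: "'a \<Rightarrow> 'i \<Rightarrow> complex"
  by (induction A rule: infinite_finite_induct) auto

lemma scl_apply [simp]: "scl c x i = c * x i"
  by (simp add: scl_def)

text \<open>The bound on \<open>a\<close> splits as \<open>M ^ m * M ^ l\<close>, so the product of
  two absolutely convergent series majorizes the double family, which may therefore be regrouped
  along the diagonals \<open>m + l = n\<close>. In the application \<open>a k\<close> is a
  coordinate of the k-th iterate of an operator, and the identity says that the calculus is
  multiplicative.\<close>

lemma double_series:
  fixes F G a :: "nat \<Rightarrow> complex" and M C :: real
  assumes F: "summable (\<lambda>m. norm (F m) * M ^ m)" and G: "summable (\<lambda>m. norm (G m) * M ^ m)"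
    and a: "\<And>k. norm (a k) \<le> C * M ^ k" and M: "M \<ge> 0"
  shows "(\<Sum>m. F m * (\<Sum>l. G l * a (m + l))) = (\<Sum>n. (\<Sum>k\<le>n. F k * G (n - k)) * a n)"
proof -
  define g where "g = (\<lambda>(m, l). F m * (G l * a (m + l)))"
  define B where "B = (\<lambda>(m, l). (norm (F m) * M ^ m) * (C * (norm (G l) * M ^ l)))"
  have C: "C \<ge> 0"
    using a[of 0] by (simp add: order_trans[OF norm_ge_zero])
  have FG: "(\<lambda>m. norm (F m) * M ^ m) summable_on UNIV" "(\<lambda>m. norm (G m) * M ^ m) summable_on UNIV"
    using F G M by (auto intro!: norm_summable_imp_summable_on)
  have "B summable_on UNIV \<times> UNIV"
  proof (rule summable_on_SigmaI)
    show "((\<lambda>y. B (x, y)) has_sum (norm (F x) * M ^ x) * (C * infsum (\<lambda>l. norm (G l) * M ^ l) UNIV)) UNIV"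
      for x unfolding B_def prod.case
      by (intro has_sum_cmult_right has_sum_infsum FG)
    show "(\<lambda>x. (norm (F x) * M ^ x) * (C * infsum (\<lambda>l. norm (G l) * M ^ l) UNIV)) summable_on UNIV"
      by (intro summable_on_cmult_left FG)
    show "B (x, y) \<ge> 0" for x y
      using M C by (simp add: B_def)
  qed
  moreover have "norm (g p) \<le> B p" for p
  proof -
    obtain m l where p: "p = (m, l)" by fastforce
    have "norm (g p) \<le> norm (F m) * (norm (G l) * (C * M ^ (m + l)))"
      unfolding p g_def prod.case norm_mult by (intro mult_left_mono a) auto
    then show ?thesis
      by (simp add: p B_def power_add mult_ac)
  qed
  ultimately have "(\<lambda>p. norm (g p)) summable_on UNIV \<times> UNIV"
    using Infinite_Sum.abs_summable_on_comparison_test'[of B "UNIV \<times> UNIV" g] by blast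
  then have gs: "g summable_on UNIV \<times> UNIV"
    by (rule abs_summable_summable)
  have in1: "(\<lambda>l. norm (G l * a (m + l))) summable_on UNIV" for m
  proof (rule Infinite_Sum.abs_summable_on_comparison_test')
    show "(\<lambda>l. C * M ^ m * (norm (G l) * M ^ l)) summable_on UNIV"
      by (intro summable_on_cmult_right FG)
    show "norm (G l * a (m + l)) \<le> C * M ^ m * (norm (G l) * M ^ l)" for l
      using mult_left_mono[OF a[of "m + l"], of "norm (G l)"]
      by (simp add: norm_mult power_add mult_ac)
  qed
  have sum_nat: "(\<Sum>l. u l) = infsum u UNIV" if "u summable_on (UNIV :: nat set)" for u :: "nat \<Rightarrow> complex"
    using has_sum_imp_sums[OF has_sum_infsum[OF that]] by (simp add: sums_iff)
  have inner: "(\<Sum>l. G l * a (m + l)) = infsum (\<lambda>l. G l * a (m + l)) UNIV" for m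
    by (rule sum_nat[OF abs_summable_summable[OF in1]])
  have eq1: "F m * (\<Sum>l. G l * a (m + l)) = infsum (\<lambda>l. F m * (G l * a (m + l))) UNIV" for m
    unfolding inner by (rule infsum_cmult_right[symmetric]) (use abs_summable_summable[OF in1] in auto)
  have gs': "(\<lambda>(m,l). F m * (G l * a (m + l))) summable_on Sigma UNIV (\<lambda>_. UNIV)"
    using gs by (simp add: g_def)
  have s1: "(\<lambda>m. F m * (\<Sum>l. G l * a (m + l))) summable_on UNIV"
    unfolding eq1 by (rule summable_on_Sigma_banach[OF gs'])
  have v1: "infsum (\<lambda>m. F m * (\<Sum>l. G l * a (m + l))) UNIV = infsum g (UNIV \<times> UNIV)"
    unfolding eq1 g_def by (rule infsum_Sigma'_banach[OF gs'])
  have bij: "bij_betw (\<lambda>(n, k). (k, n - k)) (Sigma UNIV (\<lambda>n. {..n})) (UNIV \<times> (UNIV :: nat set))"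
    by (rule bij_betwI[where g = "\<lambda>(m, l). (m + l, m)"]) auto
  define q where "q = (\<lambda>n k. F k * (G (n - k) * a n))"
  have q: "(\<lambda>x. g ((\<lambda>(n, k). (k, n - k)) x)) x = (\<lambda>(n,k). q n k) x" if "x \<in> Sigma UNIV (\<lambda>n. {..n})" for x
    using that by (auto simp: g_def q_def)
  have qs: "(\<lambda>(n,k). q n k) summable_on Sigma UNIV (\<lambda>n. {..n})"
    by (rule iffD1[OF summable_on_cong[OF q] iffD2[OF summable_on_reindex_bij_betw[OF bij, of g] gs]])
  have v2: "infsum (\<lambda>(n,k). q n k) (Sigma UNIV (\<lambda>n. {..n})) = infsum g (UNIV \<times> UNIV)"
    unfolding infsum_reindex_bij_betw[OF bij, of g, symmetric] by (rule infsum_cong[OF q, symmetric])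
  have eq2: "(\<Sum>k\<le>n. F k * G (n - k)) * a n = infsum (q n) {..n}" for n
    by (simp add: q_def sum_distrib_right mult.assoc)
  have s2: "(\<lambda>n. (\<Sum>k\<le>n. F k * G (n - k)) * a n) summable_on UNIV"
    unfolding eq2 by (rule summable_on_Sigma_banach[OF qs])
  have v3: "infsum (\<lambda>n. (\<Sum>k\<le>n. F k * G (n - k)) * a n) UNIV = infsum g (UNIV \<times> UNIV)"
    unfolding eq2 using infsum_Sigma'_banach[OF qs] v2 by simp
  show "(\<Sum>m. F m * (\<Sum>l. G l * a (m + l))) = (\<Sum>n. (\<Sum>k\<le>n. F k * G (n - k)) * a n)"
    using sum_nat[OF s1] sum_nat[OF s2] v1 v3 by simp
qed


section \<open>Banach spaces of functions\<close>

text \<open>The bound \<open>coord_le\<close> supplies nonnegativity and definiteness of the norm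
  and makes norm limits coordinatewise limits, so that identities between limits can be checked one
  coordinate at a time.\<close>

locale bfspace =
  fixes V :: "'i fspace"
  assumes zero_mem [simp, intro]: "0 \<in> vecs V"
    and add_mem [intro]: "x \<in> vecs V \<Longrightarrow> y \<in> vecs V \<Longrightarrow> x + y \<in> vecs V"
    and scl_mem [intro]: "x \<in> vecs V \<Longrightarrow> scl c x \<in> vecs V"
    and norm_triangle: "x \<in> vecs V \<Longrightarrow> y \<in> vecs V \<Longrightarrow> vnorm V (x + y) \<le> vnorm V x + vnorm V y"
    and norm_scl: "x \<in> vecs V \<Longrightarrow> vnorm V (scl c x) = norm c * vnorm V x"
    and coord_le: "x \<in> vecs V \<Longrightarrow> norm (x i) \<le> vnorm V x"
    and complete: "(\<And>m. \<sigma> m \<in> vecs V) \<Longrightarrow>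
      (\<And>e. e > 0 \<Longrightarrow> \<exists>N. \<forall>m\<ge>N. \<forall>n\<ge>N. vnorm V (\<sigma> m - \<sigma> n) < e) \<Longrightarrow>
      \<exists>x\<in>vecs V. (\<lambda>m. vnorm V (\<sigma> m - x)) \<longlonglongrightarrow> 0"
begin

lemma norm_nonneg: "x \<in> vecs V \<Longrightarrow> vnorm V x \<ge> 0"
  using coord_le[of x undefined] norm_ge_zero order_trans by blast

lemma norm_zero [simp]: "vnorm V 0 = 0"
  using norm_scl[OF zero_mem, of 0] by simp

lemma uminus_eq_scl: "- x = scl (-1) x" for x :: "'i \<Rightarrow> complex"
  by (simp add: fun_eq_iff)

lemma diff_mem [intro]: "x \<in> vecs V \<Longrightarrow> y \<in> vecs V \<Longrightarrow> x - y \<in> vecs V"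
  using add_mem[of x "scl (-1) y"] scl_mem[of y "-1"] by (simp add: uminus_eq_scl[symmetric])

lemma norm_diff_commute: "x \<in> vecs V \<Longrightarrow> y \<in> vecs V \<Longrightarrow> vnorm V (x - y) = vnorm V (y - x)"
  using norm_scl[OF diff_mem, of x y "-1"] by (simp add: uminus_eq_scl[symmetric])

lemma norm_eq_0: "x \<in> vecs V \<Longrightarrow> vnorm V x = 0 \<longleftrightarrow> x = 0"
  using coord_le[of x] norm_zero by (metis ext norm_le_zero_iff zero_fun_apply)

lemma norm_diff_triangle:
  "x \<in> vecs V \<Longrightarrow> y \<in> vecs V \<Longrightarrow> z \<in> vecs V \<Longrightarrow> vnorm V (x - z) \<le> vnorm V (x - y) + vnorm V (y - z)"
  using norm_triangle[of "x - y" "y - z"] by auto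

lemma sum_mem: "(\<And>k. k \<in> A \<Longrightarrow> u k \<in> vecs V) \<Longrightarrow> sum u A \<in> vecs V"
  by (induction A rule: infinite_finite_induct) auto

lemma norm_sum_le: "(\<And>k. k \<in> A \<Longrightarrow> u k \<in> vecs V) \<Longrightarrow> vnorm V (sum u A) \<le> (\<Sum>k\<in>A. vnorm V (u k))"
proof (induction A rule: infinite_finite_induct)
  case (insert a A)
  have mem: "u a \<in> vecs V" "sum u A \<in> vecs V"
    using insert.prems by (auto intro: sum_mem)
  have eq: "sum u (insert a A) = u a + sum u A"
    by (rule sum.insert) (rule insert.hyps)+
  have "vnorm V (sum u A) \<le> (\<Sum>k\<in>A. vnorm V (u k))"
    using insert.prems by (intro insert.IH) blast
  then show ?case
    unfolding eq sum.insert[OF insert.hyps] using norm_triangle[OF mem] by linarith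
qed auto

section \<open>Metric, density and closed subspaces\<close>

lemma vtop_metric: "Metric_space (vecs V) (vdist V)"
proof
  show "0 \<le> vdist V x y" for x y
    by (auto simp: vdist_def intro: norm_nonneg)
  show "vdist V x y = vdist V y x" for x y
    by (auto simp: vdist_def norm_diff_commute)
  show "vdist V x y = 0 \<longleftrightarrow> x = y" if "x \<in> vecs V" "y \<in> vecs V" for x y
    using norm_eq_0[of "x - y"] diff_mem[of x y] that by (auto simp: vdist_def)
  show "vdist V x z \<le> vdist V x y + vdist V y z"
    if "x \<in> vecs V" "y \<in> vecs V" "z \<in> vecs V" for x y z
    using norm_diff_triangle that by (simp add: vdist_def)
qed

sublocale MS: Metric_space "vecs V" "vdist V"
  by (rule vtop_metric)

lemma limitin_iff:
  "limitin (vtop V) f l F \<longleftrightarrow>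
     l \<in> vecs V \<and> (\<forall>\<^sub>F x in F. f x \<in> vecs V) \<and> ((\<lambda>x. vnorm V (f x - l)) \<longlongrightarrow> 0) F"
proof -
  have "((\<lambda>x. vdist V (f x) l) \<longlongrightarrow> 0) F \<longleftrightarrow> ((\<lambda>x. vnorm V (f x - l)) \<longlongrightarrow> 0) F"
    if "l \<in> vecs V" "\<forall>\<^sub>F x in F. f x \<in> vecs V"
    by (rule tendsto_cong, rule eventually_mono[OF that(2)]) (use that in \<open>auto simp: vdist_def\<close>)
  then show ?thesis
    by (auto simp: vtop_def MS.limitin_metric_dist_null)
qed

lemma closedin_iff:
  assumes "Z \<subseteq> vecs V"
  shows "closedin (vtop V) Z \<longleftrightarrow> (\<forall>x\<in>vecs V. (\<forall>e>0. \<exists>y\<in>Z. vnorm V (x - y) < e) \<longrightarrow> x \<in> Z)"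
proof -
  have "closedin (vtop V) Z \<longleftrightarrow> vtop V closure_of Z \<subseteq> Z"
    using assms closure_of_subset_eq[of Z "vtop V"] by (auto simp: vtop_def)
  moreover have "vtop V closure_of Z = {x \<in> vecs V. \<forall>e>0. \<exists>y\<in>Z. vnorm V (x - y) < e}"
    unfolding vtop_def MS.metric_closure_of using assms
    by (auto simp: MS.in_mball vdist_def subset_iff) 
  ultimately show ?thesis by auto
qed

lemma dense_in_iff:
  "dense_in V S \<longleftrightarrow> (\<forall>x\<in>vecs V. \<forall>e>0. \<exists>y\<in>S. y \<in> vecs V \<and> vnorm V (x - y) < e)"
  unfolding dense_in_def vtop_def MS.metric_closure_of
  by (auto simp: MS.in_mball vdist_def set_eq_iff)

text \<open>Completeness survives because the subspace is closed. Chaos is a statement about the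
  restriction to \<open>Y\<close>, so the Baire argument has to run in this smaller space.\<close>

lemma restrict_bfspace:
  assumes "closed_subspace V Y"
  shows "bfspace (V\<lparr>vecs := Y\<rparr>)"
proof -
  have Y: "Y \<subseteq> vecs V" "cvec.subspace Y" "closedin (vtop V) Y"
    using assms by (auto simp: closed_subspace_def)
  show ?thesis
  proof
    show "0 \<in> vecs (V\<lparr>vecs := Y\<rparr>)" using Y cvec.subspace_0 by auto
    show "x + y \<in> vecs (V\<lparr>vecs := Y\<rparr>)" if "x \<in> vecs (V\<lparr>vecs := Y\<rparr>)" "y \<in> vecs (V\<lparr>vecs := Y\<rparr>)" for x y
      using Y that cvec.subspace_add by auto
    show "scl c x \<in> vecs (V\<lparr>vecs := Y\<rparr>)" if "x \<in> vecs (V\<lparr>vecs := Y\<rparr>)" for x c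
      using Y that cvec.subspace_scale by auto
    fix \<sigma> :: "nat \<Rightarrow> 'i \<Rightarrow> complex" assume s: "\<And>m. \<sigma> m \<in> vecs (V\<lparr>vecs := Y\<rparr>)"
      and c: "\<And>e. e > 0 \<Longrightarrow> \<exists>N. \<forall>m\<ge>N. \<forall>n\<ge>N. vnorm (V\<lparr>vecs := Y\<rparr>) (\<sigma> m - \<sigma> n) < e"
    have sV: "\<sigma> m \<in> vecs V" for m using s Y by auto
    obtain x where x: "x \<in> vecs V" "(\<lambda>m. vnorm V (\<sigma> m - x)) \<longlonglongrightarrow> 0"
      using complete[of \<sigma>] sV c by auto
    have "x \<in> Y"
    proof -
      have "\<exists>y\<in>Y. vnorm V (x - y) < e" if "e > 0" for e
      proof -
        have "\<forall>\<^sub>F m in sequentially. vnorm V (\<sigma> m - x) < e"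
          by (rule order_tendstoD(2)[OF x(2) that])
        then obtain m where "vnorm V (\<sigma> m - x) < e"
          by (auto simp: eventually_sequentially)
        then show ?thesis
          using s[of m] sV[of m] x(1) norm_diff_commute by auto
      qed
      then show ?thesis using Y x closedin_iff by blast
    qed
    then show "\<exists>x\<in>vecs (V\<lparr>vecs := Y\<rparr>). (\<lambda>m. vnorm (V\<lparr>vecs := Y\<rparr>) (\<sigma> m - x)) \<longlonglongrightarrow> 0"
      using x by auto
  qed (use Y in \<open>auto simp: norm_triangle norm_scl coord_le subset_iff\<close>)
qed

lemma closed_subspaceD:
  assumes "closed_subspace V Y"
  shows "Y \<subseteq> vecs V" "0 \<in> Y" "\<And>x y. x \<in> Y \<Longrightarrow> y \<in> Y \<Longrightarrow> x + y \<in> Y"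
    "\<And>c x. x \<in> Y \<Longrightarrow> scl c x \<in> Y" "\<And>x y. x \<in> Y \<Longrightarrow> y \<in> Y \<Longrightarrow> x - y \<in> Y"
    "\<And>x. x \<in> vecs V \<Longrightarrow> (\<And>e. e > 0 \<Longrightarrow> \<exists>y\<in>Y. vnorm V (x - y) < e) \<Longrightarrow> x \<in> Y"
  using assms closedin_iff[of Y]
  by (auto simp: closed_subspace_def cvec.subspace_0 cvec.subspace_add cvec.subspace_scale
      cvec.subspace_diff)

lemma closed_subspace_closure:
  assumes E: "E \<subseteq> vecs V" "cvec.subspace E"
  defines "Y \<equiv> {x \<in> vecs V. \<forall>e>0. \<exists>y\<in>E. vnorm V (x - y) < e}"
  shows "closed_subspace V Y" "E \<subseteq> Y"
proof -
  show EY: "E \<subseteq> Y"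
    using E by (auto simp: Y_def intro!: bexI)
  have "cvec.subspace Y"
  proof (rule cvec.subspaceI)
    show "0 \<in> Y" using EY cvec.subspace_0[OF E(2)] by auto
    show "x + y \<in> Y" if xy: "x \<in> Y" "y \<in> Y" for x y
      unfolding Y_def
    proof (safe)
      show "x + y \<in> vecs V" using xy by (auto simp: Y_def)
      fix e :: real assume "e > 0"
      then obtain x' y' where *: "x' \<in> E" "y' \<in> E" "vnorm V (x - x') < e/2" "vnorm V (y - y') < e/2"
        using xy half_gt_zero[of e] unfolding Y_def by blast
      have "vnorm V ((x + y) - (x' + y')) \<le> vnorm V (x - x') + vnorm V (y - y')"
        using norm_triangle[of "x - x'" "y - y'"] xy * E by (auto simp: Y_def algebra_simps)
      then show "\<exists>z\<in>E. vnorm V ((x + y) - z) < e"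
        using * E cvec.subspace_add by (intro bexI[of _ "x' + y'"]) auto
    qed
    show "scl c x \<in> Y" if x: "x \<in> Y" for c x
      unfolding Y_def
    proof (safe)
      show "scl c x \<in> vecs V" using x by (auto simp: Y_def)
      fix e :: real assume "e > 0"
      then have "e / (norm c + 1) > 0" by (simp add: add_nonneg_pos)
      then obtain x' where *: "x' \<in> E" "vnorm V (x - x') < e / (norm c + 1)"
        using x unfolding Y_def by blast
      have xx: "x - x' \<in> vecs V" using x * E by (auto simp: Y_def)
      have "vnorm V (scl c x - scl c x') = norm c * vnorm V (x - x')"
        using norm_scl[OF xx, of c] by (simp add: cvec.scale_right_diff_distrib)
      also have "\<dots> \<le> (norm c + 1) * vnorm V (x - x')"
        using norm_nonneg[OF xx] by (intro mult_right_mono) auto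
      also have "\<dots> < e"
        using * by (simp add: pos_less_divide_eq add_nonneg_pos mult.commute)
      finally show "\<exists>z\<in>E. vnorm V (scl c x - z) < e"
        using * E cvec.subspace_scale by blast
    qed
  qed
  moreover have "closedin (vtop V) Y"
  proof (subst closedin_iff)
    show "\<forall>x\<in>vecs V. (\<forall>e>0. \<exists>y\<in>Y. vnorm V (x - y) < e) \<longrightarrow> x \<in> Y"
    proof (intro ballI impI)
      fix x assume x: "x \<in> vecs V" "\<forall>e>0. \<exists>y\<in>Y. vnorm V (x - y) < e"
      show "x \<in> Y" unfolding Y_def
      proof (safe)
        show "x \<in> vecs V" by fact
        fix e :: real assume "e > 0"
        then have "e / 2 > 0" by simp
        then obtain y where y: "y \<in> Y" "vnorm V (x - y) < e/2" using x by blast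
        then obtain z where z: "z \<in> E" "vnorm V (y - z) < e/2"
          using \<open>e / 2 > 0\<close> unfolding Y_def by blast
        have "vnorm V (x - z) < e"
          using norm_diff_triangle[of x y z] x y z E by (auto simp: Y_def)
        then show "\<exists>z\<in>E. vnorm V (x - z) < e" using z by blast
      qed
    qed
  qed (auto simp: Y_def)
  ultimately show "closed_subspace V Y"
    by (auto simp: closed_subspace_def Y_def)
qed

text \<open>Completeness gives some limit of the partial sums, and \<open>coord_le\<close>
  identifies it with the coordinatewise sum \<open>s\<close>. Vectors can therefore be defined by
  scalar series.\<close>

lemma series:
  assumes u: "\<And>m. u m \<in> vecs V" and su: "summable (\<lambda>m. vnorm V (u m))"
  defines "s \<equiv> (\<lambda>i. \<Sum>m. u m i)"
  shows series_mem: "s \<in> vecs V" and norm_series_le: "vnorm V s \<le> (\<Sum>m. vnorm V (u m))"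
    and series_lim: "(\<lambda>N. vnorm V ((\<Sum>m<N. u m) - s)) \<longlonglongrightarrow> 0"
    and series_coord: "\<And>i. (\<lambda>m. u m i) sums s i"
proof -
  define S where "S N = (\<Sum>m<N. u m)" for N
  have S: "S N \<in> vecs V" for N unfolding S_def by (rule sum_mem) (rule u)
  have d: "vnorm V (S m - S n) < e"
    if "\<forall>m\<ge>N. \<forall>n. norm (sum (\<lambda>m. vnorm V (u m)) {m..<n}) < e" "m \<ge> N" "n \<ge> N" "n \<le> m" for m n N e
  proof -
    have "S m - S n = sum u {n..<m}"
      unfolding S_def using sum_diff_nat_ivl[of 0 n m u] that by (simp add: lessThan_atLeast0)
    then have "vnorm V (S m - S n) \<le> (\<Sum>k\<in>{n..<m}. vnorm V (u k))"
      by (simp only:) (rule norm_sum_le, rule u)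
    also have "\<dots> < e"
      using that by (auto simp: abs_less_iff)
    finally show ?thesis .
  qed
  have "\<exists>N. \<forall>m\<ge>N. \<forall>n\<ge>N. vnorm V (S m - S n) < e" if e: "e > 0" for e
  proof -
    obtain N where N: "\<forall>m\<ge>N. \<forall>n. norm (sum (\<lambda>m. vnorm V (u m)) {m..<n}) < e"
      using su e unfolding summable_Cauchy by blast
    have "vnorm V (S m - S n) < e" if "m \<ge> N" "n \<ge> N" for m n
      using d[OF N, of m n] d[OF N, of n m] that norm_diff_commute[OF S S, of m n]
      by (cases "n \<le> m") auto
    then show ?thesis by blast
  qed
  then obtain x where x: "x \<in> vecs V" "(\<lambda>m. vnorm V (S m - x)) \<longlonglongrightarrow> 0"
    using complete[of S] S by blast
  have sums: "(\<lambda>m. u m i) sums x i" for i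
  proof -
    have "(\<lambda>N. S N i - x i) \<longlonglongrightarrow> 0"
      by (rule Lim_null_comparison[OF _ x(2)], rule always_eventually)
        (use coord_le[OF diff_mem[OF S x(1)], of _ i] in auto)
    then have "(\<lambda>N. S N i) \<longlonglongrightarrow> x i"
      by (rule LIM_zero_cancel)
    then show ?thesis
      by (simp add: sums_def S_def sum_fun_apply)
  qed
  then have sx: "s = x" by (auto simp: s_def fun_eq_iff sums_iff)
  show "s \<in> vecs V" "(\<lambda>N. vnorm V ((\<Sum>m<N. u m) - s)) \<longlonglongrightarrow> 0"
    using x by (auto simp: sx S_def)
  show "(\<lambda>m. u m i) sums s i" for i using sums sx by simp
  show "vnorm V s \<le> (\<Sum>m. vnorm V (u m))"
  proof (rule LIMSEQ_le_const)
    show "(\<lambda>N. vnorm V (S N - x) + (\<Sum>m. vnorm V (u m))) \<longlonglongrightarrow> (\<Sum>m. vnorm V (u m))"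
      using tendsto_add[OF x(2) tendsto_const] by simp
    have "vnorm V s \<le> vnorm V (S N - x) + (\<Sum>m. vnorm V (u m))" for N
    proof -
      have "vnorm V s \<le> vnorm V (x - S N) + vnorm V (S N)"
        using norm_triangle[of "x - S N" "S N"] x S by (auto simp: sx)
      moreover have "vnorm V (S N) \<le> (\<Sum>m<N. vnorm V (u m))"
        unfolding S_def by (rule norm_sum_le) (rule u)
      moreover have "\<dots> \<le> (\<Sum>m. vnorm V (u m))"
        by (rule sum_le_suminf[OF su]) (auto intro: norm_nonneg u)
      ultimately show ?thesis
        using norm_diff_commute[OF x(1) S] by simp
    qed
    then show "\<exists>N. \<forall>n\<ge>N. vnorm V s \<le> vnorm V (S n - x) + (\<Sum>m. vnorm V (u m))" by blast
  qed
qed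

end

section \<open>The power series calculus of a bounded operator\<close>

text \<open>F(T)x as a coordinatewise sum. The formula is total; it is a norm limit once the radius
  of convergence exceeds a bound of \<open>T\<close>.\<close>

definition fcalc :: "complex fps \<Rightarrow> (('i \<Rightarrow> complex) \<Rightarrow> ('i \<Rightarrow> complex)) \<Rightarrow> ('i \<Rightarrow> complex) \<Rightarrow> 'i \<Rightarrow> complex" where
  "fcalc F T x = (\<lambda>i. \<Sum>m. fps_nth F m * (T ^^ m) x i)"

text \<open>\<open>M\<close> is any bound of the operator, not necessarily its norm. It is a
  parameter because it delimits the calculus: a series is applied to \<open>T\<close> when its
  radius of convergence exceeds \<open>M\<close>. For the shift, \<open>M\<close> is 1.\<close>

locale bop = bfspace V for V :: "'i fspace" +
  fixes T :: "('i \<Rightarrow> complex) \<Rightarrow> ('i \<Rightarrow> complex)" and M :: real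
  assumes op_mem: "x \<in> vecs V \<Longrightarrow> T x \<in> vecs V"
    and op_add: "x \<in> vecs V \<Longrightarrow> y \<in> vecs V \<Longrightarrow> T (x + y) = T x + T y"
    and op_scl: "x \<in> vecs V \<Longrightarrow> T (scl c x) = scl c (T x)"
    and op_bound: "x \<in> vecs V \<Longrightarrow> vnorm V (T x) \<le> M * vnorm V x"
    and M_nonneg: "M \<ge> 0"
begin

lemma bounded_op: "bounded_op V T"
  using op_mem op_add op_scl op_bound unfolding bounded_op_def by blast

lemma op_zero: "T 0 = 0"
  using op_scl[OF zero_mem, of 0] by simp

lemma op_diff: "x \<in> vecs V \<Longrightarrow> y \<in> vecs V \<Longrightarrow> T (x - y) = T x - T y"
  using op_add[of x "scl (-1) y"] op_scl[of y "-1"] scl_mem[of y "-1"]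
  by (simp add: uminus_eq_scl[symmetric])

lemma op_sum: "(\<And>k. k \<in> A \<Longrightarrow> u k \<in> vecs V) \<Longrightarrow> T (sum u A) = (\<Sum>k\<in>A. T (u k))"
  by (induction A rule: infinite_finite_induct) (auto simp: op_zero op_add sum_mem)

lemma bop_power: "bop V (T ^^ m) (M ^ m)"
proof (induction m)
  case 0
  show ?case by unfold_locales auto
next
  case (Suc m)
  interpret P: bop V "T ^^ m" "M ^ m" by fact
  show ?case
  proof
    fix x assume x: "x \<in> vecs V"
    have "vnorm V ((T ^^ Suc m) x) \<le> M * (M ^ m * vnorm V x)"
      using op_bound[OF P.op_mem[OF x]] mult_left_mono[OF P.op_bound[OF x] M_nonneg] by simp
    then show "vnorm V ((T ^^ Suc m) x) \<le> M ^ Suc m * vnorm V x" by (simp add: mult.assoc)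
    show "(T ^^ Suc m) x \<in> vecs V" using op_mem[OF P.op_mem[OF x]] by simp
    show "(T ^^ Suc m) (scl c x) = scl c ((T ^^ Suc m) x)" for c
      unfolding funpow.simps comp_def P.op_scl[OF x] by (rule op_scl[OF P.op_mem[OF x]])
    fix y assume y: "y \<in> vecs V"
    show "(T ^^ Suc m) (x + y) = (T ^^ Suc m) x + (T ^^ Suc m) y"
      unfolding funpow.simps comp_def P.op_add[OF x y] by (rule op_add[OF P.op_mem[OF x] P.op_mem[OF y]])
  qed (simp add: M_nonneg)
qed

lemma pow_mem: "x \<in> vecs V \<Longrightarrow> (T ^^ m) x \<in> vecs V"
  by (rule bop.op_mem[OF bop_power])

lemma pow_bound: "x \<in> vecs V \<Longrightarrow> vnorm V ((T ^^ m) x) \<le> M ^ m * vnorm V x"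
  by (rule bop.op_bound[OF bop_power])

lemma pow_coord: "x \<in> vecs V \<Longrightarrow> norm ((T ^^ m) x i) \<le> vnorm V x * M ^ m"
  using coord_le[OF pow_mem, of x m i] pow_bound[of x m] by (simp add: mult.commute)

lemma op_limit:
  assumes "\<And>n. s n \<in> vecs V" "x \<in> vecs V" "(\<lambda>n. vnorm V (s n - x)) \<longlonglongrightarrow> 0"
  shows "(\<lambda>n. vnorm V (T (s n) - T x)) \<longlonglongrightarrow> 0"
proof (rule Lim_null_comparison)
  show "\<forall>\<^sub>F n in sequentially. norm (vnorm V (T (s n) - T x)) \<le> M * vnorm V (s n - x)"
  proof (rule always_eventually, rule allI)
    fix n
    have "s n - x \<in> vecs V" using assms by auto
    then show "norm (vnorm V (T (s n) - T x)) \<le> M * vnorm V (s n - x)"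
      using op_bound[of "s n - x"] op_diff[of "s n" x] assms norm_nonneg[OF op_mem[of "s n - x"]] by simp
  qed
  show "(\<lambda>n. M * vnorm V (s n - x)) \<longlonglongrightarrow> 0"
    using tendsto_mult_right_zero[OF assms(3)] .
qed

lemma op_series:
  assumes u: "\<And>m. u m \<in> vecs V" and su: "summable (\<lambda>m. vnorm V (u m))"
  shows "(\<lambda>m. T (u m) i) sums T (\<lambda>i. \<Sum>m. u m i) i"
proof -
  let ?s = "\<lambda>i. \<Sum>m. u m i"
  have mem: "(\<Sum>m<N. u m) \<in> vecs V" for N by (rule sum_mem) (rule u)
  have lim: "(\<lambda>N. vnorm V (T (\<Sum>m<N. u m) - T ?s)) \<longlonglongrightarrow> 0"
    by (rule op_limit[OF mem series_mem[OF u su] series_lim[OF u su]])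
  have "(\<lambda>N. T (\<Sum>m<N. u m) i - T ?s i) \<longlonglongrightarrow> 0"
    by (rule Lim_null_comparison[OF _ lim], rule always_eventually)
      (use coord_le[OF diff_mem[OF op_mem[OF mem] op_mem[OF series_mem[OF u su]]], of _ i] in auto)
  then have "(\<lambda>N. T (\<Sum>m<N. u m) i) \<longlonglongrightarrow> T ?s i" by (rule LIM_zero_cancel)
  moreover have "T (\<Sum>m<N. u m) i = (\<Sum>m<N. T (u m) i)" for N
    by (subst op_sum) (auto simp: u sum_fun_apply)
  ultimately show ?thesis by (simp add: sums_def)
qed

lemma coeff_summable:
  fixes F :: "complex fps"
  assumes "fps_conv_radius F > ereal M"
  shows "summable (\<lambda>m. norm (fps_nth F m) * M ^ m)"
  using norm_summable_fps[of "of_real M :: complex" F] assms M_nonneg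
  by (simp add: norm_mult norm_power)

lemma fcalc:
  assumes F: "fps_conv_radius F > ereal M" and x: "x \<in> vecs V"
  shows fcalc_mem: "fcalc F T x \<in> vecs V"
    and fcalc_bound: "vnorm V (fcalc F T x) \<le> (\<Sum>m. norm (fps_nth F m) * M ^ m) * vnorm V x"
    and fcalc_lim: "(\<lambda>N. vnorm V ((\<Sum>m<N. scl (fps_nth F m) ((T ^^ m) x)) - fcalc F T x)) \<longlonglongrightarrow> 0"
    and fcalc_sums: "(\<lambda>m. fps_nth F m * (T ^^ m) x i) sums fcalc F T x i"
    and fcalc_norm_summable: "summable (\<lambda>m. vnorm V (scl (fps_nth F m) ((T ^^ m) x)))"
proof -
  define u where "u m = scl (fps_nth F m) ((T ^^ m) x)" for m
  have u: "u m \<in> vecs V" for m using pow_mem[OF x] by (auto simp: u_def)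
  have ub: "vnorm V (u m) \<le> norm (fps_nth F m) * M ^ m * vnorm V x" for m
    using mult_left_mono[OF pow_bound[OF x, of m], of "norm (fps_nth F m)"]
    by (simp add: u_def norm_scl pow_mem[OF x] mult.assoc)
  have s': "summable (\<lambda>m. norm (fps_nth F m) * M ^ m * vnorm V x)"
    by (rule summable_mult2[OF coeff_summable[OF F]])
  have su: "summable (\<lambda>m. vnorm V (u m))"
    by (rule summable_comparison_test'[OF s', of 0]) (use ub norm_nonneg[OF u] in auto)
  have eq: "fcalc F T x = (\<lambda>i. \<Sum>m. u m i)"
    by (simp add: fcalc_def u_def)
  show "fcalc F T x \<in> vecs V" unfolding eq by (rule series_mem[OF u su])
  show "(\<lambda>N. vnorm V ((\<Sum>m<N. scl (fps_nth F m) ((T ^^ m) x)) - fcalc F T x)) \<longlonglongrightarrow> 0"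
    using series_lim[OF u su] unfolding eq u_def .
  show "(\<lambda>m. fps_nth F m * (T ^^ m) x i) sums fcalc F T x i"
    using series_coord[OF u su, of i] unfolding eq by (simp add: u_def)
  show "summable (\<lambda>m. vnorm V (scl (fps_nth F m) ((T ^^ m) x)))"
    using su by (simp add: u_def)
  have "vnorm V (fcalc F T x) \<le> (\<Sum>m. vnorm V (u m))"
    unfolding eq by (rule norm_series_le[OF u su])
  also have "\<dots> \<le> (\<Sum>m. norm (fps_nth F m) * M ^ m * vnorm V x)"
    by (rule suminf_le[OF ub su s'])
  also have "\<dots> = (\<Sum>m. norm (fps_nth F m) * M ^ m) * vnorm V x"
    by (rule suminf_mult2[symmetric, OF coeff_summable[OF F]])
  finally show "vnorm V (fcalc F T x) \<le> (\<Sum>m. norm (fps_nth F m) * M ^ m) * vnorm V x" .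
qed

lemma bop_fcalc:
  assumes F: "fps_conv_radius F > ereal M"
  shows "bop V (fcalc F T) (\<Sum>m. norm (fps_nth F m) * M ^ m)"
proof
  show "fcalc F T x \<in> vecs V" if "x \<in> vecs V" for x by (rule fcalc_mem[OF F that])
  show "fcalc F T (x + y) = fcalc F T x + fcalc F T y" if xy: "x \<in> vecs V" "y \<in> vecs V" for x y
  proof
    fix i
    have "(\<lambda>m. fps_nth F m * (T ^^ m) (x + y) i) sums (fcalc F T x + fcalc F T y) i"
      using sums_add[OF fcalc_sums[OF F xy(1), of i] fcalc_sums[OF F xy(2), of i]]
      by (simp add: bop.op_add[OF bop_power xy] algebra_simps)
    then show "fcalc F T (x + y) i = (fcalc F T x + fcalc F T y) i"
      by (simp add: fcalc_def sums_iff)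
  qed
  show "fcalc F T (scl c x) = scl c (fcalc F T x)" if x: "x \<in> vecs V" for c x
  proof
    fix i
    have "(\<lambda>m. fps_nth F m * (T ^^ m) (scl c x) i) sums (scl c (fcalc F T x)) i"
      using sums_mult[OF fcalc_sums[OF F x, of i], of c]
      by (simp add: bop.op_scl[OF bop_power x] algebra_simps)
    then show "fcalc F T (scl c x) i = (scl c (fcalc F T x)) i"
      by (simp add: fcalc_def sums_iff)
  qed
  show "vnorm V (fcalc F T x) \<le> (\<Sum>m. norm (fps_nth F m) * M ^ m) * vnorm V x" if "x \<in> vecs V" for x
    by (rule fcalc_bound[OF F that])
  show "0 \<le> (\<Sum>m. norm (fps_nth F m) * M ^ m)"
    by (rule suminf_nonneg[OF coeff_summable[OF F]]) (simp add: M_nonneg)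
qed

text \<open>In each coordinate this is a Cauchy product: \<open>T ^^ m\<close> passes into the
  series for \<open>H\<close> by continuity, and the coordinates of \<open>(T ^^ k) x\<close> grow
  at most like \<open>M ^ k\<close>, as the rearrangement of the double series requires.\<close>

lemma fcalc_mult:
  assumes F: "fps_conv_radius F > ereal M" and H: "fps_conv_radius H > ereal M" and x: "x \<in> vecs V"
  shows "fcalc (F * H) T x = fcalc F T (fcalc H T x)"
proof
  fix i
  define u where "u m = scl (fps_nth H m) ((T ^^ m) x)" for m
  have u: "u m \<in> vecs V" for m using pow_mem[OF x] by (auto simp: u_def)
  have su: "summable (\<lambda>m. vnorm V (u m))"
    using fcalc_norm_summable[OF H x] by (simp add: u_def)
  have "(T ^^ m) (fcalc H T x) i = (\<Sum>l. fps_nth H l * (T ^^ (m + l)) x i)" for m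
  proof -
    have "fcalc H T x = (\<lambda>i. \<Sum>m. u m i)" by (simp add: fcalc_def u_def)
    then have "(\<lambda>l. (T ^^ m) (u l) i) sums (T ^^ m) (fcalc H T x) i"
      using bop.op_series[OF bop_power u su, of m i] by simp
    moreover have "(T ^^ m) (u l) i = fps_nth H l * (T ^^ (m + l)) x i" for l
      by (simp add: u_def bop.op_scl[OF bop_power pow_mem[OF x]] funpow_add)
    ultimately show ?thesis by (simp add: sums_iff)
  qed
  then have "fcalc F T (fcalc H T x) i
      = (\<Sum>m. fps_nth F m * (\<Sum>l. fps_nth H l * (T ^^ (m + l)) x i))"
    by (simp add: fcalc_def)
  also have "\<dots> = (\<Sum>n. (\<Sum>k\<le>n. fps_nth F k * fps_nth H (n - k)) * (T ^^ n) x i)"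
    by (rule double_series[OF coeff_summable[OF F] coeff_summable[OF H] pow_coord[OF x] M_nonneg])
  also have "\<dots> = fcalc (F * H) T x i"
    by (simp add: fcalc_def fps_mult_nth atLeast0AtMost)
  finally show "fcalc (F * H) T x i = fcalc F T (fcalc H T x) i" by simp
qed

lemma fcalc_add:
  assumes F: "fps_conv_radius F > ereal M" and H: "fps_conv_radius H > ereal M" and x: "x \<in> vecs V"
  shows "fcalc (F + H) T x = fcalc F T x + fcalc H T x"
  using sums_add[OF fcalc_sums[OF F x] fcalc_sums[OF H x]]
  by (auto simp: fcalc_def fun_eq_iff sums_iff algebra_simps)

lemma fcalc_diff:
  assumes F: "fps_conv_radius F > ereal M" and H: "fps_conv_radius H > ereal M" and x: "x \<in> vecs V"
  shows "fcalc (F - H) T x = fcalc F T x - fcalc H T x"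
  using sums_diff[OF fcalc_sums[OF F x] fcalc_sums[OF H x]]
  by (auto simp: fcalc_def fun_eq_iff sums_iff algebra_simps)

end

lemma fcalc_const: "fcalc (fps_const c) T x = scl c x"
proof
  fix i
  have "(\<lambda>m. fps_nth (fps_const c) m * (T ^^ m) x i) sums (\<Sum>m\<in>{0}. fps_nth (fps_const c) m * (T ^^ m) x i)"
    by (rule sums_finite) auto
  then show "fcalc (fps_const c) T x i = scl c x i" by (simp add: fcalc_def sums_iff)
qed

lemma fcalc_X: "fcalc fps_X T x = T x"
proof
  fix i
  have "(\<lambda>m. fps_nth fps_X m * (T ^^ m) x i) sums (\<Sum>m\<in>{1}. fps_nth fps_X m * (T ^^ m) x i)"
    by (rule sums_finite) auto
  then show "fcalc fps_X T x i = T x i" by (simp add: fcalc_def sums_iff)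
qed

lemma fcalc_1: "fcalc 1 T x = x"
  using fcalc_const[of 1 T x] by simp

lemma fcalc_0: "fcalc 0 T x = 0"
  by (simp add: fcalc_def zero_fun_def)

lemma (in bop) pow_eigen: "v \<in> vecs V \<Longrightarrow> T v = scl \<mu> v \<Longrightarrow> (T ^^ m) v = scl (\<mu> ^ m) v"
  by (induction m) (auto simp: op_scl cvec.scale_scale mult.commute)

lemma (in bop) fcalc_eigen:
  assumes v: "v \<in> vecs V" "T v = scl \<mu> v" and F: "norm \<mu> < fps_conv_radius F"
  shows "fcalc F T v = scl (eval_fps F \<mu>) v"
proof
  fix i
  have "(\<lambda>m. fps_nth F m * \<mu> ^ m * v i) sums (eval_fps F \<mu> * v i)"
    by (rule sums_mult2[OF sums_eval_fps[OF F]])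
  then show "fcalc F T v i = scl (eval_fps F \<mu>) v i"
    by (simp add: fcalc_def pow_eigen[OF v] sums_iff mult.assoc)
qed

lemmas vec_apply = plus_fun_apply zero_fun_apply minus_apply uminus_apply scl_apply

text \<open>As simp rules these equations also rewrite unapplied vectors to \<open>\<lambda>\<close>-terms.\<close>

declare vec_apply [simp del]


section \<open>Holomorphic functions\<close>

text \<open>Cauchy's inequality on a smaller circle of radius \<open>\<rho>\<close>, as
  \<open>f\<close> is only given on the open disc. The result is linear in \<open>S\<close>: for a
  family of functions with bounds \<open>s i\<close> the same factor serves every index.\<close>

lemma taylor_coeff_bound:
  assumes f: "f holomorphic_on ball a r" and b: "\<And>z. z \<in> ball a r \<Longrightarrow> norm (f z) \<le> S"
    and \<rho>: "0 < \<rho>" "\<rho> < r"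
  shows "norm ((deriv ^^ j) f a / fact j) \<le> S / \<rho> ^ j"
proof -
  have "norm ((deriv ^^ j) f a) \<le> fact j * S / \<rho> ^ j"
  proof (rule Cauchy_inequality)
    show "f holomorphic_on ball a \<rho>" using f \<rho> by (auto intro: holomorphic_on_subset)
    show "continuous_on (cball a \<rho>) f"
      using f \<rho> by (intro holomorphic_on_imp_continuous_on) (auto intro: holomorphic_on_subset)
  qed (use \<rho> b in \<open>auto simp: dist_norm\<close>)
  then have "norm ((deriv ^^ j) f a) / fact j \<le> (fact j * S / \<rho> ^ j) / fact j"
    by (rule divide_right_mono) simp
  then show ?thesis by (simp add: norm_divide)
qed

lemma taylor_tail_bound:
  assumes f: "f holomorphic_on ball a r" and b: "\<And>z. z \<in> ball a r \<Longrightarrow> norm (f z) \<le> S"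
    and \<rho>: "0 < \<rho>" "\<rho> < r" and z: "norm (z - a) < \<rho>"
  shows "norm (f z - (\<Sum>j<N. (deriv ^^ j) f a / fact j * (z - a) ^ j))
    \<le> S * (norm (z - a) / \<rho>) ^ N / (1 - norm (z - a) / \<rho>)"
proof -
  define q where "q = norm (z - a) / \<rho>"
  have q: "0 \<le> q" "q < 1" using z \<rho> by (auto simp: q_def)
  define u where "u j = (deriv ^^ j) f a / fact j * (z - a) ^ j" for j
  have "u sums f z"
    unfolding u_def using z \<rho> by (intro holomorphic_power_series[OF f]) (auto simp: dist_norm norm_minus_commute)
  then have 1: "(\<lambda>j. u (j + N)) sums (f z - sum u {..<N})"
    by (rule sums_split_initial_segment)
  have 2: "(\<lambda>j. S * q ^ (j + N)) sums (S * q ^ N * (1 / (1 - q)))"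
    using sums_mult[OF geometric_sums[of q], of "S * q ^ N"] q by (simp add: power_add mult_ac)
  have "norm (u j) \<le> S * q ^ j" for j
  proof -
    have "norm (u j) = norm ((deriv ^^ j) f a / fact j) * norm (z - a) ^ j"
      by (simp add: u_def norm_mult norm_power norm_divide)
    also have "\<dots> \<le> S / \<rho> ^ j * norm (z - a) ^ j"
      by (intro mult_right_mono taylor_coeff_bound[OF f b \<rho>]) auto
    finally show ?thesis by (simp add: q_def power_divide)
  qed
  then have "norm (f z - sum u {..<N}) \<le> S * q ^ N * (1 / (1 - q))"
    by (intro norm_sums_le[OF 1 2])
  then show ?thesis by (simp add: u_def q_def)
qed

text \<open>The zero is removed with its full order. The quotient, completed at \<open>c\<close> by
  the local factor, is holomorphic on the whole disc of convergence, so its expansion at 0 converges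
  at least as far as \<open>F\<close>; equality of the values near 0 then gives equality of the
  power series.\<close>

lemma fps_split_zero:
  fixes F :: "complex fps"
  assumes F: "F \<noteq> 0" and c: "norm c < fps_conv_radius F" "eval_fps F c = 0"
  obtains n H where "F = (fps_X - fps_const c) ^ n * H" "fps_conv_radius H \<ge> fps_conv_radius F" "eval_fps H c \<noteq> 0"
proof -
  define U where "U = eball (0::complex) (fps_conv_radius F)"
  have pos: "fps_conv_radius F > 0"
    using c by (metis le_less_trans norm_ge_zero ereal_less_eq(5))
  have U: "open U" "connected U" "c \<in> U" "0 \<in> U" using c pos by (auto simp: U_def zero_ereal_def)
  have hol: "eval_fps F holomorphic_on U" unfolding U_def by (intro holomorphic_intros) auto
  have "\<not> eval_fps F constant_on U"
  proof
    assume "eval_fps F constant_on U"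
    then have z: "eval_fps F z = 0" if "z \<in> U" for z
      using c U that unfolding constant_on_def by metis
    have "eventually (\<lambda>z. z \<in> U) (nhds 0)" using U by (intro eventually_nhds_in_open)
    then have "eventually (\<lambda>z. eval_fps F z = eval_fps 0 z) (nhds 0)"
      by eventually_elim (simp add: z)
    then show False using eval_fps_eqD[of F 0] pos F by simp
  qed
  then obtain g r n where *: "0 < n"  "0 < r"  "ball c r \<subseteq> U" "g holomorphic_on ball c r"
    "\<And>w. w \<in> ball c r \<Longrightarrow> eval_fps F w = (w - c) ^ n * g w" "\<And>w. w \<in> ball c r \<Longrightarrow> g w \<noteq> 0"
    using holomorphic_factor_zero_nonconstant[OF hol U(1,2,3) c(2)] by metis
  define f where "f w = (if w = c then g c else eval_fps F w / (w - c) ^ n)" for w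
  have "f holomorphic_on (U - {c}) \<union> ball c r"
  proof (rule holomorphic_on_Un)
    have "(\<lambda>w. eval_fps F w / (w - c) ^ n) holomorphic_on U - {c}"
      by (intro holomorphic_intros holomorphic_on_subset[OF hol]) (auto simp: U_def)
    then show "f holomorphic_on U - {c}"
      by (rule holomorphic_transform) (auto simp: f_def)
    show "f holomorphic_on ball c r"
      by (rule holomorphic_transform[OF *(4)]) (auto simp: f_def *(5))
  qed (use U in auto)
  then have f: "f holomorphic_on eball 0 (fps_conv_radius F)"
    by (rule holomorphic_on_subset) (use *(2) U_def in auto)
  define H where "H = fps_expansion f 0"
  have H: "fps_conv_radius H \<ge> fps_conv_radius F" unfolding H_def by (rule conv_radius_fps_expansion[OF f])
  have ev: "eval_fps H z = f z" if "z \<in> U" for z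
    using eval_fps_expansion'[OF f, of z] that by (simp add: H_def U_def)
  have cr: "fps_conv_radius (fps_X - fps_const c) = \<infinity>"
    using fps_conv_radius_diff[of "fps_X :: complex fps" "fps_const c"] by simp
  have crn: "fps_conv_radius ((fps_X - fps_const c) ^ n) = \<infinity>"
    using fps_conv_radius_power[of "fps_X - fps_const c" n] cr by simp
  have evx: "eval_fps ((fps_X - fps_const c) ^ n) z = (z - c) ^ n" for z
    by (simp add: eval_fps_power eval_fps_diff cr)
  have "F = (fps_X - fps_const c) ^ n * H"
  proof (rule eval_fps_eqD)
    show "0 < fps_conv_radius F" by fact
    have "min (fps_conv_radius ((fps_X - fps_const c) ^ n)) (fps_conv_radius H) > 0"
      using H pos crn by (simp add: less_le_trans)
    then show "0 < fps_conv_radius ((fps_X - fps_const c) ^ n * H)"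
      using fps_conv_radius_mult by (rule less_le_trans)
    have "eventually (\<lambda>z. z \<in> U) (nhds 0)" using U by (intro eventually_nhds_in_open)
    then show "eventually (\<lambda>z. eval_fps F z = eval_fps ((fps_X - fps_const c) ^ n * H) z) (nhds 0)"
    proof eventually_elim
      case (elim z)
      then have "ereal (norm z) < fps_conv_radius F" by (simp add: U_def)
      then have "eval_fps ((fps_X - fps_const c) ^ n * H) z = (z - c) ^ n * f z"
        using H crn elim by (subst eval_fps_mult) (auto simp: evx ev)
      also have "\<dots> = eval_fps F z"
        using *(1) c by (cases "z = c") (auto simp: f_def)
      finally show ?case by simp
    qed
  qed
  moreover have "eval_fps H c \<noteq> 0"
    using U *(2) *(6)[of c] by (simp add: ev f_def)
  ultimately show ?thesis using H that by blast
qed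

text \<open>Induction on the number of zeros in the closed disc, which is finite by compactness. One
  step removes a zero with its multiplicity, so \<open>cs\<close> lists each zero as often as its
  order and the cofactor has no zeros left in the disc.\<close>

lemma fps_factor_zeros:
  fixes F :: "complex fps"
  assumes "F \<noteq> 0" "fps_conv_radius F > ereal R"
  shows "\<exists>cs H. F = prod_list (map (\<lambda>c. fps_X - fps_const c) cs) * H \<and> fps_conv_radius H > ereal R \<and>
    (\<forall>z. norm z \<le> R \<longrightarrow> eval_fps H z \<noteq> 0) \<and> (\<forall>c\<in>set cs. norm c \<le> R \<and> eval_fps F c = 0)"
proof -
  define Z where "Z F = {z\<in>cball 0 R. eval_fps F z = 0}" for F :: "complex fps"
  have fin: "finite (Z F)" if F: "F \<noteq> 0" "fps_conv_radius F > ereal R" for F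
  proof (cases "Z F = {}")
    case False
    then have R: "R \<ge> 0" by (auto simp: Z_def intro: order_trans[OF norm_ge_zero])
    define U where "U = eball (0::complex) (fps_conv_radius F)"
    have RF: "0 < fps_conv_radius F" using F R by (metis ereal_less_eq(5) le_less_trans)
    have U: "open U" "connected U" "0 \<in> U" "cball 0 R \<subseteq> U"
      using F RF by (auto simp: U_def zero_ereal_def le_less_trans[OF _ F(2)])
    have hol: "eval_fps F holomorphic_on U" unfolding U_def by (intro holomorphic_intros) auto
    have "\<not> eval_fps F constant_on U"
    proof
      assume "eval_fps F constant_on U"
      moreover obtain c where "c \<in> Z F" using False by blast
      ultimately have z: "eval_fps F z = 0" if "z \<in> U" for z
        using U that unfolding constant_on_def Z_def by (metis (mono_tags, lifting) mem_Collect_eq subsetD)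
      have "eventually (\<lambda>z. z \<in> U) (nhds 0)" using U by (intro eventually_nhds_in_open)
      then have "eventually (\<lambda>z. eval_fps F z = eval_fps 0 z) (nhds 0)"
        by eventually_elim (simp add: z)
      then show False using eval_fps_eqD[of F 0] RF F by simp
    qed
    then show ?thesis
      unfolding Z_def using U by (intro holomorphic_compact_finite_zeros[OF hol U(1,2)]) auto
  qed auto
  have "F \<noteq> 0 \<Longrightarrow> fps_conv_radius F > ereal R \<Longrightarrow>
    \<exists>cs H. F = prod_list (map (\<lambda>c. fps_X - fps_const c) cs) * H \<and> fps_conv_radius H > ereal R \<and>
    Z H = {} \<and> set cs \<subseteq> Z F" for F
  proof (induction "card (Z F)" arbitrary: F rule: less_induct)
    case less
    show ?case
    proof (cases "Z F = {}")
      case True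
      then show ?thesis using less.prems by (intro exI[of _ "[]"] exI[of _ F]) auto
    next
      case False
      then obtain c where c: "c \<in> Z F" by blast
      then have cF: "ereal (norm c) < fps_conv_radius F" "eval_fps F c = 0"
        using less.prems le_less_trans[of "ereal (norm c)" "ereal R"] by (auto simp: Z_def)
      obtain n H where H: "F = (fps_X - fps_const c) ^ n * H" "fps_conv_radius H \<ge> fps_conv_radius F"
        "eval_fps H c \<noteq> 0"
        using fps_split_zero[OF less.prems(1) cF] by blast
      have cr: "fps_conv_radius (fps_X - fps_const c) = \<infinity>"
        using fps_conv_radius_diff[of "fps_X :: complex fps" "fps_const c"] by simp
      have crn: "fps_conv_radius ((fps_X - fps_const c) ^ n) = \<infinity>"
        using fps_conv_radius_power[of "fps_X - fps_const c" n] cr by simp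
      have HR: "fps_conv_radius H > ereal R" using H(2) less.prems(2) by simp
      have ev: "eval_fps F z = (z - c) ^ n * eval_fps H z" if "norm z \<le> R" for z
      proof -
        have "ereal (norm z) < fps_conv_radius H" using that HR le_less_trans[of "ereal (norm z)" "ereal R"] by simp
        then show ?thesis
          using crn unfolding H(1) by (simp add: eval_fps_mult eval_fps_power eval_fps_diff cr)
      qed
      have sub: "Z H \<subseteq> Z F" "c \<notin> Z H" using ev H(3) by (auto simp: Z_def)
      then have "card (Z H) < card (Z F)"
        using fin[OF less.prems] c by (intro psubset_card_mono) auto
      moreover have "H \<noteq> 0" using H less.prems by auto
      ultimately obtain cs H' where *: "H = prod_list (map (\<lambda>c. fps_X - fps_const c) cs) * H'"
        "fps_conv_radius H' > ereal R" "Z H' = {}" "set cs \<subseteq> Z H"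
        using less.hyps HR by blast
      have "F = prod_list (map (\<lambda>c. fps_X - fps_const c) (replicate n c @ cs)) * H'"
        using H(1) *(1) by (simp add: prod_list_replicate mult.assoc)
      moreover have "set (replicate n c @ cs) \<subseteq> Z F"
        using *(4) sub c by auto
      ultimately show ?thesis using * by blast
    qed
  qed
  from this[OF assms] show ?thesis unfolding Z_def by (fastforce simp: subset_iff)
qed

text \<open>Writing f(z) as \<open>f c + (z - c) * dq f z\<close> lowers the exponent by one, since
  the term with the constant \<open>f c\<close> has a primitive away from \<open>c\<close>.
  Iteration leaves Cauchy's formula for \<open>(dq ^^ j) f\<close>. General closed paths have to be
  covered because the definition of the functional calculus admits them.\<close>

lemma has_contour_integral_div_power:
  assumes f: "f holomorphic_on U" and U: "open U" and c: "c \<in> U"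
    and \<gamma>: "valid_path \<gamma>" "pathfinish \<gamma> = pathstart \<gamma>" "path_image \<gamma> \<subseteq> U - {c}"
    and w: "\<And>z. z \<notin> U \<Longrightarrow> winding_number \<gamma> z = 0"
  shows "((\<lambda>z. f z / (z - c) ^ Suc j) has_contour_integral
    2 * pi * \<i> * winding_number \<gamma> c * ((deriv ^^ j) f c / fact j)) \<gamma>"
proof -
  define dq where "dq g = (\<lambda>z. if z = c then deriv g c else (g z - g c) / (z - c))" for g
  have dq: "((\<lambda>z. f z / (z - c) ^ Suc j) has_contour_integral
    2 * pi * \<i> * winding_number \<gamma> c * (dq ^^ j) f c) \<gamma>"
    if "f holomorphic_on U" "valid_path \<gamma>" "pathfinish \<gamma> = pathstart \<gamma>" "path_image \<gamma> \<subseteq> U - {c}"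
      "\<And>z. z \<notin> U \<Longrightarrow> winding_number \<gamma> z = 0" for f \<gamma>
    using that(1)
  proof (induction j arbitrary: f)
    case 0
    then show ?case using Cauchy_integral_formula_global[OF U 0 c that(2,4,3,5)] by simp
  next
    case (Suc j)
    have 1: "((\<lambda>z. dq f z / (z - c) ^ Suc j) has_contour_integral
        2 * pi * \<i> * winding_number \<gamma> c * (dq ^^ j) (dq f) c) \<gamma>"
      unfolding dq_def by (rule Suc.IH[unfolded dq_def]) (rule pole_lemma_open[OF Suc.prems U])
    have 2: "((\<lambda>z. f c / (z - c) ^ Suc (Suc j)) has_contour_integral 0) \<gamma>"
    proof (rule Cauchy_theorem_primitive[where S = "U - {c}"])
      fix z assume z: "z \<in> U - {c}"
      define w where "w = z - c"
      have w: "w \<noteq> 0" using z by (simp add: w_def)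
      have "((\<lambda>z. (z - c) ^ Suc j) has_field_derivative of_nat (Suc j) * w ^ j) (at z within U - {c})"
        by (auto intro!: derivative_eq_intros simp: w_def) (cases j; simp add: algebra_simps)
      moreover have "(z - c) ^ Suc j \<noteq> 0" using z by simp
      ultimately have "((\<lambda>z. inverse ((z - c) ^ Suc j)) has_field_derivative
          - (inverse ((z - c) ^ Suc j) * (of_nat (Suc j) * w ^ j) * inverse ((z - c) ^ Suc j)))
          (at z within U - {c})"
        by (rule DERIV_inverse')
      from DERIV_cmult[OF this, of "- f c / of_nat (Suc j)"]
      have "((\<lambda>z. - f c / of_nat (Suc j) * inverse ((z - c) ^ Suc j)) has_field_derivative
          - f c / of_nat (Suc j) * (- (inverse (w ^ Suc j) * (of_nat (Suc j) * w ^ j) * inverse (w ^ Suc j))))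
          (at z within U - {c})"
        by (simp only: w_def)
      also have "- f c / of_nat (Suc j) * (- (inverse (w ^ Suc j) * (of_nat (Suc j) * w ^ j) * inverse (w ^ Suc j)))
          = f c / w ^ Suc (Suc j)"
        using w by (simp add: divide_simps del: of_nat_Suc)
      finally show "((\<lambda>z. - f c / of_nat (Suc j) * inverse ((z - c) ^ Suc j)) has_field_derivative
          f c / (z - c) ^ Suc (Suc j)) (at z within U - {c})"
        by (simp add: w_def)
    qed (use that in auto)
    have "((\<lambda>z. dq f z / (z - c) ^ Suc j + f c / (z - c) ^ Suc (Suc j)) has_contour_integral
        2 * pi * \<i> * winding_number \<gamma> c * (dq ^^ j) (dq f) c) \<gamma>"
      using has_contour_integral_add[OF 1 2] by simp
    then have "((\<lambda>z. f z / (z - c) ^ Suc (Suc j)) has_contour_integral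
        2 * pi * \<i> * winding_number \<gamma> c * (dq ^^ j) (dq f) c) \<gamma>"
    proof (rule has_contour_integral_eq)
      fix z assume "z \<in> path_image \<gamma>"
      then have "z \<noteq> c" using that by auto
      then show "dq f z / (z - c) ^ Suc j + f c / (z - c) ^ Suc (Suc j) = f z / (z - c) ^ Suc (Suc j)"
        by (simp add: dq_def divide_simps)
    qed
    then show ?case by (simp add: funpow_swap1)
  qed
  obtain r where r: "r > 0" "cball c r \<subseteq> U" using U c open_contains_cball by blast
  \<comment> \<open>The number \<open>(dq ^^ j) f c\<close> does not depend on the path, so it can
    be computed on a small circle by the usual formula for derivatives.\<close>
  have "(deriv ^^ j) f c / fact j = (dq ^^ j) f c"
  proof -
    have "((\<lambda>z. f z / (z - c) ^ Suc j) has_contour_integral (2 * pi * \<i>) / fact j * (deriv ^^ j) f c)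
        (circlepath c r)"
    proof (rule Cauchy_has_contour_integral_higher_derivative_circlepath)
      show "continuous_on (cball c r) f"
        using f r holomorphic_on_imp_continuous_on continuous_on_subset by blast
      show "f holomorphic_on ball c r"
        using f r ball_subset_cball holomorphic_on_subset by (meson order_trans)
    qed (use r in auto)
    moreover have "((\<lambda>z. f z / (z - c) ^ Suc j) has_contour_integral
        2 * pi * \<i> * winding_number (circlepath c r) c * (dq ^^ j) f c) (circlepath c r)"
    proof (rule dq[OF f])
      show "path_image (circlepath c r) \<subseteq> U - {c}" using r by (auto simp: path_image_circlepath)
      show "winding_number (circlepath c r) z = 0" if "z \<notin> U" for z
        by (rule winding_number_zero_outside[of _ "cball c r"]) (use r that in \<open>auto simp: path_image_circlepath\<close>)
    qed auto
    ultimately have "(2 * pi * \<i>) / fact j * (deriv ^^ j) f c = 2 * pi * \<i> * (dq ^^ j) f c"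
      using has_contour_integral_unique r by (fastforce simp: winding_number_circlepath_centre)
    then show ?thesis by (simp add: field_simps)
  qed
  then show ?thesis using dq[OF f \<gamma> w] by simp
qed

text \<open>Newton's method with the derivative frozen at its value \<open>c\<close> in the base
  point. The map \<open>K l\<close> contracts with factor 1/2 uniformly in \<open>l\<close>, so its
  iterates, which are holomorphic in \<open>l\<close>, converge uniformly and the limit is
  holomorphic. The assumption \<open>comp\<close> plays the part of joint holomorphy of
  \<open>\<Gamma>\<close>.\<close>

lemma implicit_branch:
  fixes \<Gamma> \<Gamma>' :: "complex \<Rightarrow> complex \<Rightarrow> complex"
  assumes S: "open S" "w0 \<in> S" and z: "\<Gamma> l0 w0 = 0"
    and der: "\<And>l w. w \<in> S \<Longrightarrow> (\<Gamma> l has_field_derivative \<Gamma>' l w) (at w)"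
    and cont': "continuous_on (UNIV \<times> S) (\<lambda>(l, w). \<Gamma>' l w)" and nz: "\<Gamma>' l0 w0 \<noteq> 0"
    and cont: "continuous_on UNIV (\<lambda>l. \<Gamma> l w0)"
    and comp: "\<And>u L. u holomorphic_on L \<Longrightarrow> u ` L \<subseteq> S \<Longrightarrow> (\<lambda>l. \<Gamma> l (u l)) holomorphic_on L"
  shows "\<exists>\<delta>>0. \<exists>u. u holomorphic_on ball l0 \<delta> \<and> u l0 = w0 \<and>
    (\<forall>l\<in>ball l0 \<delta>. u l \<in> S \<and> \<Gamma> l (u l) = 0)"
proof -
  define c where "c = \<Gamma>' l0 w0"
  have c: "norm c > 0" using nz by (simp add: c_def)
  have "continuous (at (l0, w0)) (\<lambda>(l, w). \<Gamma>' l w)"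
    using cont' S by (simp add: continuous_on_eq_continuous_at open_Times)
  then obtain d where d: "d > 0" "\<And>p. dist p (l0, w0) < d \<Longrightarrow> dist ((\<lambda>(l, w). \<Gamma>' l w) p) c < norm c / 2"
    using c half_gt_zero[OF c] unfolding continuous_at_eps_delta c_def prod.case by blast
  obtain e0 where e0: "e0 > 0" "cball w0 e0 \<subseteq> S" using S open_contains_cball by blast
  \<comment> \<open>With a third of \<open>d\<close>, two distances of at most
    \<open>\<epsilon>\<close> add up to less than \<open>d\<close>.\<close>
  define \<epsilon> where "\<epsilon> = min e0 (d / 3)"
  have \<epsilon>: "\<epsilon> > 0" "cball w0 \<epsilon> \<subseteq> S" using e0 d by (auto simp: \<epsilon>_def)
  have D: "norm (\<Gamma>' l w - c) \<le> norm c / 2" if "norm (l - l0) \<le> \<epsilon>" "norm (w - w0) \<le> \<epsilon>" for l w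
  proof -
    have "dist (l, w) (l0, w0) \<le> dist l l0 + dist w w0"
      by (simp add: dist_Pair_Pair sqrt_sum_squares_le_sum)
    also have "\<dots> < d" using that d(1) by (auto simp: dist_norm \<epsilon>_def)
    finally show ?thesis using d(2)[of "(l, w)"] by (simp add: dist_norm)
  qed
  have "continuous (at l0) (\<lambda>l. \<Gamma> l w0)" using cont by (simp add: continuous_on_eq_continuous_at)
  \<comment> \<open>With this tolerance \<open>K l\<close> moves the centre by at most
    \<open>\<epsilon> / 2\<close>; together with the contraction factor 1/2 this makes the closed
    disc invariant.\<close>
  moreover have "norm c * \<epsilon> / 2 > 0" using c \<epsilon> by simp
  ultimately obtain d' where d': "d' > 0" "\<And>l. dist l l0 < d' \<Longrightarrow> dist (\<Gamma> l w0) (\<Gamma> l0 w0) < norm c * \<epsilon> / 2"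
    unfolding continuous_at_eps_delta by meson
  define \<delta> where "\<delta> = min d' \<epsilon>"
  have \<delta>: "\<delta> > 0" using d' \<epsilon> by (simp add: \<delta>_def)
  define K where "K l w = w - \<Gamma> l w / c" for l w
  have lip: "norm (K l w - K l w') \<le> 1/2 * norm (w - w')"
    if "l \<in> ball l0 \<delta>" "w \<in> cball w0 \<epsilon>" "w' \<in> cball w0 \<epsilon>" for l w w'
  proof (rule field_differentiable_bound[OF convex_cball _ _ that(2,3)])
    fix v assume v: "v \<in> cball w0 \<epsilon>"
    then have "v \<in> S" using \<epsilon> by auto
    then have "(\<Gamma> l has_field_derivative \<Gamma>' l v) (at v within cball w0 \<epsilon>)"
      by (intro has_field_derivative_at_within[OF der])
    then show "(K l has_field_derivative 1 - \<Gamma>' l v / c) (at v within cball w0 \<epsilon>)"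
      unfolding K_def by (intro DERIV_diff DERIV_ident DERIV_cdivide)
    have "norm (\<Gamma>' l v - c) \<le> norm c / 2"
      using v that by (intro D) (auto simp: dist_norm norm_minus_commute \<delta>_def)
    moreover have "1 - \<Gamma>' l v / c = - (\<Gamma>' l v - c) / c" using c by (auto simp: field_simps)
    ultimately show "norm (1 - \<Gamma>' l v / c) \<le> 1 / 2"
      using c by (simp add: norm_divide norm_minus_commute field_simps)
  qed
  have K0: "norm (K l w0 - w0) \<le> \<epsilon> / 2" if "l \<in> ball l0 \<delta>" for l
    using d'(2)[of l] that z c by (simp add: K_def norm_divide dist_norm norm_minus_commute \<delta>_def field_simps)
  have Kin: "K l w \<in> cball w0 \<epsilon>" if l: "l \<in> ball l0 \<delta>" and w: "w \<in> cball w0 \<epsilon>" for l w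
  proof -
    have "norm (K l w - w0) \<le> norm (K l w - K l w0) + norm (K l w0 - w0)"
      using norm_triangle_ineq[of "K l w - K l w0" "K l w0 - w0"] by simp
    also have "\<dots> \<le> 1/2 * norm (w - w0) + \<epsilon> / 2"
      using lip[OF l w, of w0] K0[OF l] \<epsilon> by (intro add_mono) auto
    also have "\<dots> \<le> \<epsilon>" using w by (simp add: dist_norm norm_minus_commute)
    finally show ?thesis by (simp add: dist_norm norm_minus_commute)
  qed
  define u where "u j l = ((K l) ^^ j) w0" for j l
  have u0: "u 0 l = w0" and uS: "u (Suc j) l = K l (u j l)" for j l by (auto simp: u_def)
  have uin: "u j l \<in> cball w0 \<epsilon>" if "l \<in> ball l0 \<delta>" for j l
    by (induction j) (use \<epsilon> Kin that in \<open>auto simp: u0 uS\<close>)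
  have hol: "u j holomorphic_on ball l0 \<delta>" for j
  proof (induction j)
    case 0
    have "u 0 = (\<lambda>l. w0)" by (auto simp: u0)
    then show ?case by simp
  next
    case (Suc j)
    have "u (Suc j) = (\<lambda>l. u j l - \<Gamma> l (u j l) / c)" by (auto simp: uS K_def)
    moreover have "(\<lambda>l. \<Gamma> l (u j l)) holomorphic_on ball l0 \<delta>"
      by (rule comp[OF Suc]) (use uin \<epsilon> in blast)
    ultimately show ?case
      using c by (auto intro!: holomorphic_intros Suc)
  qed
  define v where "v j l = u (Suc j) l - u j l" for j l
  have vb: "norm (v j l) \<le> \<epsilon> / 2 * (1/2) ^ j" if l: "l \<in> ball l0 \<delta>" for j l
  proof (induction j)
    case 0 then show ?case using K0[OF l] by (simp add: v_def u0 uS)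
  next
    case (Suc j)
    have "norm (v (Suc j) l) \<le> 1/2 * norm (v j l)"
      unfolding v_def uS[of "Suc j"] uS[of j]
      using lip[OF l uin[OF l, of "Suc j"] uin[OF l, of j]] by (simp add: uS)
    also have "\<dots> \<le> 1/2 * (\<epsilon> / 2 * (1/2) ^ j)" by (rule mult_left_mono[OF Suc]) simp
    finally show ?case by simp
  qed
  define U where "U l = (\<Sum>j. v j l) + w0" for l
  have sumv: "(\<Sum>j<N. v j l) = u N l - w0" for N l
    using sum_lessThan_telescope[of "\<lambda>j. u j l" N] by (simp add: v_def u0)
  have sm: "summable (\<lambda>j. \<epsilon> / 2 * (1/2) ^ j)" by (intro summable_mult summable_geometric) simp
  have "uniform_limit (ball l0 \<delta>) (\<lambda>N l. \<Sum>j<N. v j l) (\<lambda>l. \<Sum>j. v j l) sequentially"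
    by (rule Weierstrass_m_test[OF vb sm])
  then have ul: "uniform_limit (ball l0 \<delta>) (\<lambda>N l. u N l - w0 + w0) U sequentially"
    unfolding U_def sumv by (intro uniform_limit_intros)
  then have ul: "uniform_limit (ball l0 \<delta>) u U sequentially" by simp
  have lim: "(\<lambda>N. u N l) \<longlonglongrightarrow> U l" if "l \<in> ball l0 \<delta>" for l
    using tendsto_uniform_limitI[OF ul that] .
  have Uin: "U l \<in> cball w0 \<epsilon>" if "l \<in> ball l0 \<delta>" for l
    using closed_sequentially[OF closed_cball uin[OF that] lim[OF that]] .
  have U0: "\<Gamma> l (U l) = 0" if l: "l \<in> ball l0 \<delta>" for l
  proof -
    have "(\<lambda>N. K l (u N l) - K l (U l)) \<longlonglongrightarrow> 0"
    proof (rule Lim_null_comparison)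
      show "\<forall>\<^sub>F N in sequentially. norm (K l (u N l) - K l (U l)) \<le> 1/2 * norm (u N l - U l)"
        using lip[OF l uin[OF l] Uin[OF l]] by simp
      show "(\<lambda>N. 1/2 * norm (u N l - U l)) \<longlonglongrightarrow> 0"
        using tendsto_mult_right_zero[OF tendsto_norm_zero[OF LIM_zero[OF lim[OF l]]]] .
    qed
    then have "(\<lambda>N. u (Suc N) l) \<longlonglongrightarrow> K l (U l)"
      unfolding uS by (rule LIM_zero_cancel)
    moreover have "(\<lambda>N. u (Suc N) l) \<longlonglongrightarrow> U l" by (rule LIMSEQ_Suc[OF lim[OF l]])
    ultimately have "K l (U l) = U l" by (rule LIMSEQ_unique)
    then show ?thesis using c by (simp add: K_def)
  qed
  have "U holomorphic_on ball l0 \<delta>"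
  proof (rule holomorphic_uniform_sequence[OF open_ball hol])
    fix x assume "x \<in> ball l0 \<delta>"
    then obtain e where e: "e > 0" "cball x e \<subseteq> ball l0 \<delta>" using open_contains_cball open_ball by metis
    then show "\<exists>d>0. cball x d \<subseteq> ball l0 \<delta> \<and> uniform_limit (cball x d) u U sequentially"
      using uniform_limit_on_subset[OF ul] by blast
  qed
  moreover have "U l0 = w0"
  proof -
    have "u j l0 = w0" for j by (induction j) (auto simp: u0 uS K_def z)
    then have "(\<lambda>N. u N l0) \<longlonglongrightarrow> w0" by simp
    then show ?thesis using lim[of l0] \<delta> LIMSEQ_unique by auto
  qed
  ultimately show ?thesis
    using \<delta> U0 Uin \<epsilon> by (intro exI[of _ \<delta>] conjI exI[of _ U]) auto
qed

text \<open>The vector of descending powers of \<open>x\<close>, ending in 1, lies in the kernel of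
  the Sylvester matrix: each row yields a power of \<open>x\<close> times the value of
  \<open>p\<close> or of \<open>q\<close> at \<open>x\<close>. The argument works with upper bounds
  for the degrees, as formal degrees require.\<close>

lemma resultant_sub_common_root:
  fixes p q :: "complex poly"
  assumes "degree p \<le> m" "degree q \<le> n" "m + n > 0" and px: "poly p x = 0" and qx: "poly q x = 0"
  shows "resultant_sub m n p q = 0"
proof -
  define N where "N = m + n"
  let ?A = "sylvester_mat_sub m n p q"
  define v where "v = vec N (\<lambda>j. x ^ (N - 1 - j))"
  have A: "?A \<in> carrier_mat N N" unfolding N_def by (rule sylvester_mat_sub_carrier)
  have vc: "v \<in> carrier_vec N" by (simp add: v_def)
  have Npos: "N > 0" using assms by (simp add: N_def)
  have pe: "(\<Sum>k\<le>d. coeff r k * x ^ k) = poly r x" if "degree r \<le> d" for r :: "complex poly" and d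
    using that by (simp add: poly_altdef) (intro sum.mono_neutral_right; auto simp: coeff_eq_0)
  have "?A *\<^sub>v v = 0\<^sub>v N"
  proof (rule eq_vecI)
    fix i assume "i < dim_vec (0\<^sub>v N :: complex vec)"
    then have i: "i < N" by simp
    have "(?A *\<^sub>v v) $ i = (\<Sum>j<N. ?A $$ (i, j) * x ^ (N - 1 - j))"
      using i A by (simp add: scalar_prod_def v_def lessThan_atLeast0 N_def)
    also have "\<dots> = 0"
    proof (cases "i < n")
      case True
      have "(\<Sum>j<N. ?A $$ (i, j) * x ^ (N - 1 - j)) =
          (\<Sum>j\<in>{i..i+m}. coeff p (m + i - j) * x ^ (N - 1 - j))"
        using True i by (intro sum.mono_neutral_cong_right) (auto simp: sylvester_mat_sub_index N_def)
      also have "\<dots> = (\<Sum>k\<le>m. x ^ (n - 1 - i) * (coeff p k * x ^ k))"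
      proof (rule sum.reindex_bij_witness[of _ "\<lambda>k. m + i - k" "\<lambda>j. m + i - j"])
        fix j assume j: "j \<in> {i..i + m}"
        then have "N - 1 - j = (n - 1 - i) + (m + i - j)" using True by (auto simp: N_def)
        then show "x ^ (n - 1 - i) * (coeff p (m + i - j) * x ^ (m + i - j)) =
            coeff p (m + i - j) * x ^ (N - 1 - j)"
          by (simp only: power_add mult_ac)
      qed auto
      also have "\<dots> = 0"
        unfolding sum_distrib_left[symmetric] pe[OF assms(1)] px by simp
      finally show ?thesis .
    next
      case False
      have "(\<Sum>j<N. ?A $$ (i, j) * x ^ (N - 1 - j)) =
          (\<Sum>j\<in>{i-n..i}. coeff q (i - j) * x ^ (N - 1 - j))"
        using False i by (intro sum.mono_neutral_cong_right) (auto simp: sylvester_mat_sub_index N_def)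
      also have "\<dots> = (\<Sum>k\<le>n. x ^ (N - 1 - i) * (coeff q k * x ^ k))"
      proof (rule sum.reindex_bij_witness[of _ "\<lambda>k. i - k" "\<lambda>j. i - j"])
        fix j assume j: "j \<in> {i - n..i}"
        then have "N - 1 - j = (N - 1 - i) + (i - j)" using False i by auto
        then show "x ^ (N - 1 - i) * (coeff q (i - j) * x ^ (i - j)) =
            coeff q (i - j) * x ^ (N - 1 - j)"
          by (simp only: power_add mult_ac)
      qed (use False in auto)
      also have "\<dots> = 0"
        unfolding sum_distrib_left[symmetric] pe[OF assms(2)] qx by simp
      finally show ?thesis .
    qed
    finally show "(?A *\<^sub>v v) $ i = 0\<^sub>v N $ i" using i by simp
  qed (use A in auto)
  moreover have "v \<noteq> 0\<^sub>v N"
  proof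
    assume "v = 0\<^sub>v N"
    then have "v $ (N - 1) = 0" using Npos by simp
    then show False using Npos by (simp add: v_def)
  qed
  ultimately show ?thesis
    unfolding resultant_sub_def using det_0_iff_vec_prod_zero_field[OF A] vc by blast
qed


section \<open>The exponential of a bounded operator\<close>

text \<open>Operators given by a description, such as \<open>op_exp\<close>, are identified with a
  power series on the carrier only.\<close>

lemma bop_cong:
  assumes "bop V S K" "\<And>x. x \<in> vecs V \<Longrightarrow> S' x = S x"
  shows "bop V S' K"
proof -
  interpret bop V S K by fact
  show ?thesis
    by unfold_locales (simp_all add: assms(2) op_mem op_add op_scl op_bound M_nonneg add_mem scl_mem)
qed

lemma (in bfspace) norm_uminus [simp]: "x \<in> vecs V \<Longrightarrow> vnorm V (- x) = vnorm V x"
  using norm_scl[of x "-1"] by simp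

context bop begin

lemma exp_radius: "fps_conv_radius (fps_exp (c :: complex)) > ereal M"
  by simp

text \<open>Limits are unique, so the description in \<open>op_exp\<close> picks the value of the
  power series, whose radius is infinite. The semigroup law is then inherited from the exponential
  series.\<close>

lemma op_exp_eq:
  assumes x: "x \<in> vecs V"
  shows "op_exp V T t x = fcalc (fps_exp (of_real t)) T x"
  unfolding op_exp_def
proof (rule the_equality)
  have eq: "scl (of_real (t ^ k / fact k)) ((T ^^ k) x) = scl (fps_nth (fps_exp (of_real t)) k) ((T ^^ k) x)" for k
    by simp
  have mem: "(\<Sum>k<N. scl (fps_nth (fps_exp (of_real t)) k) ((T ^^ k) x)) \<in> vecs V" for N
    by (intro sum_mem scl_mem pow_mem x)
  show lim: "limitin (vtop V) (\<lambda>N. \<Sum>k<N. scl (of_real (t ^ k / fact k)) ((T ^^ k) x))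
      (fcalc (fps_exp (of_real t)) T x) sequentially"
    unfolding limitin_iff eq
    using fcalc_mem[OF exp_radius x] fcalc_lim[OF exp_radius x] mem by auto
  show "y = fcalc (fps_exp (of_real t)) T x"
    if "limitin (vtop V) (\<lambda>N. \<Sum>k<N. scl (of_real (t ^ k / fact k)) ((T ^^ k) x)) y sequentially" for y
    using MS.limitin_metric_unique[OF that[unfolded vtop_def] lim[unfolded vtop_def]] by simp
qed

lemma bop_op_exp: "bop V (op_exp V T t) (\<Sum>m. norm (fps_nth (fps_exp (of_real t :: complex)) m) * M ^ m)"
  by (rule bop_cong[OF bop_fcalc[OF exp_radius]]) (rule op_exp_eq)

lemma op_exp_mem: "x \<in> vecs V \<Longrightarrow> op_exp V T t x \<in> vecs V"
  by (rule bop.op_mem[OF bop_op_exp])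

lemma op_exp_0: "x \<in> vecs V \<Longrightarrow> op_exp V T 0 x = x"
  by (simp add: op_exp_eq fcalc_1)

lemma op_exp_add: "x \<in> vecs V \<Longrightarrow> op_exp V T (s + t) x = op_exp V T s (op_exp V T t x)"
  using fcalc_mult[OF exp_radius exp_radius, of x "of_real s" "of_real t"]
  by (simp add: op_exp_eq fcalc_mem[OF exp_radius] fps_exp_add_mult)

lemma op_exp_pow: "x \<in> vecs V \<Longrightarrow> (op_exp V T t ^^ k) x = op_exp V T (of_nat k * t) x"
proof (induction k)
  case (Suc k)
  then show ?case using op_exp_add[of x t "of_nat k * t"] by (simp add: algebra_simps)
qed (simp add: op_exp_0)

lemma op_exp_eigen: "v \<in> vecs V \<Longrightarrow> T v = scl \<mu> v \<Longrightarrow> op_exp V T t v = scl (exp (of_real t * \<mu>)) v"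
  using fcalc_eigen[of v \<mu> "fps_exp (of_real t)"] by (simp add: op_exp_eq)

text \<open>The exponential series without its first one or two terms is bounded through its
  coefficients; for \<open>t \<ge> 0\<close> the absolute values lead to the same truncated series
  at the number \<open>t * M\<close>.\<close>

lemma op_exp_near_0:
  assumes x: "x \<in> vecs V" and t: "t \<ge> 0"
  shows "vnorm V (op_exp V T t x - x) \<le> (exp (t * M) - 1) * vnorm V x"
    and "vnorm V (op_exp V T t x - x - scl (of_real t) (T x)) \<le> (exp (t * M) - 1 - t * M) * vnorm V x"
proof -
  have e: "(\<lambda>m. (t * M) ^ m / fact m) sums exp (t * M)"
    using exp_converges[of "t * M"] by (simp add: divide_inverse mult.commute)
  let ?F = "fps_exp (of_real t :: complex) - 1"
  let ?H = "?F - fps_const (of_real t) * fps_X"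
  have cF: "fps_conv_radius ?F > ereal M"
    using fps_conv_radius_diff[of "fps_exp (of_real t :: complex)" 1] by simp
  have cX: "fps_conv_radius (fps_const (of_real t :: complex) * fps_X) > ereal M"
    using fps_conv_radius_mult[of "fps_const (of_real t :: complex)" fps_X] by simp
  have c1: "fps_conv_radius (1 :: complex fps) > ereal M" by simp
  have cH: "fps_conv_radius ?H > ereal M"
    using fps_conv_radius_diff[of ?F "fps_const (of_real t) * fps_X"] cF cX by (meson min_less_iff_conj less_le_trans)
  have e1: "(\<lambda>m. (t * M) ^ m / fact m - (if m = 0 then 1 else 0)) sums (exp (t * M) - 1)"
    by (rule sums_diff[OF e sums_single[of 0 "\<lambda>_. 1"]])
  have e2: "(\<lambda>m. (t * M) ^ m / fact m - (if m = 0 then 1 else 0) - (if m = 1 then t * M else 0))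
      sums (exp (t * M) - 1 - t * M)"
    by (rule sums_diff[OF e1 sums_single[of 1 "\<lambda>_. t * M"]])
  have F: "norm (fps_nth ?F m) * M ^ m = (t * M) ^ m / fact m - (if m = 0 then 1 else 0)" for m
    using t by (simp add: norm_divide norm_power power_mult_distrib)
  have H: "norm (fps_nth ?H m) * M ^ m
      = (t * M) ^ m / fact m - (if m = 0 then 1 else 0) - (if m = 1 then t * M else 0)" for m
    using t by (auto simp: norm_divide norm_power power_mult_distrib fps_X_def)
  have eqF: "op_exp V T t x - x = fcalc ?F T x"
    by (simp add: fcalc_diff[OF exp_radius c1 x] op_exp_eq[OF x] fcalc_1)
  have cc: "fps_conv_radius (fps_const (of_real t :: complex)) > ereal M"
    "fps_conv_radius (fps_X :: complex fps) > ereal M" by simp_all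
  have eqH: "op_exp V T t x - x - scl (of_real t) (T x) = fcalc ?H T x"
    by (simp add: fcalc_diff[OF cF cX x] eqF fcalc_mult[OF cc x] fcalc_const fcalc_X)
  show "vnorm V (op_exp V T t x - x) \<le> (exp (t * M) - 1) * vnorm V x"
    using fcalc_bound[OF cF x] e1 unfolding eqF F by (simp add: sums_iff)
  show "vnorm V (op_exp V T t x - x - scl (of_real t) (T x)) \<le> (exp (t * M) - 1 - t * M) * vnorm V x"
    using fcalc_bound[OF cH x] e2 unfolding eqH H by (simp add: sums_iff)
qed

lemma generates_op_exp: "generates V T (op_exp V T)"
  unfolding generates_def C0_semigroup_def
proof (intro conjI allI impI ballI)
  show "Defs.bounded_op V (op_exp V T t)" for t by (rule bop.bounded_op[OF bop_op_exp])
  show "op_exp V T 0 x = x" if "x \<in> vecs V" for x by (rule op_exp_0[OF that])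
  show "op_exp V T (s + t) x = op_exp V T s (op_exp V T t x)" if "x \<in> vecs V" for s t x
    by (rule op_exp_add[OF that])
  fix x assume x: "x \<in> vecs V"
  have pos: "\<forall>\<^sub>F t in at_right (0::real). t > 0" by (simp add: eventually_at_right_less)
  have nn: "vnorm V y = norm (vnorm V y)" if "y \<in> vecs V" for y using norm_nonneg[OF that] by simp
  show "limitin (vtop V) (\<lambda>t. op_exp V T t x) x (at_right 0)"
    unfolding limitin_iff
  proof (intro conjI x always_eventually allI op_exp_mem)
    have "((\<lambda>t. (exp (t * M) - 1) * vnorm V x) \<longlongrightarrow> (exp (0 * M) - 1) * vnorm V x) (at_right 0)"
      by (intro tendsto_intros)
    then have "((\<lambda>t. (exp (t * M) - 1) * vnorm V x) \<longlongrightarrow> 0) (at_right 0)" by simp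
    then show "((\<lambda>t. vnorm V (op_exp V T t x - x)) \<longlongrightarrow> 0) (at_right 0)"
      by (rule Lim_null_comparison[rotated], intro eventually_mono[OF pos])
        (use op_exp_near_0(1)[OF x] nn[OF diff_mem[OF op_exp_mem[OF x] x]] in auto)
  qed
  show "limitin (vtop V) (\<lambda>t. scl (1 / of_real t) (op_exp V T t x - x)) (T x) (at_right 0)"
    unfolding limitin_iff
  proof (intro conjI op_mem x always_eventually allI scl_mem diff_mem op_exp_mem)
    \<comment> \<open>The second bound, divided by \<open>t\<close>, is the difference quotient of
      \<open>exp (t * M)\<close> at 0 minus its limit \<open>M\<close>, times the norm of
      \<open>x\<close>.\<close>
    have "((\<lambda>t. exp (t * M)) has_real_derivative M) (at 0)"
      by (auto intro!: derivative_eq_intros)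
    then have "((\<lambda>t. (exp (t * M) - 1) / t) \<longlongrightarrow> M) (at 0)" by (simp add: DERIV_def)
    then have "((\<lambda>t. (exp (t * M) - 1) / t) \<longlongrightarrow> M) (at_right 0)" by (rule tendsto_within_subset) simp
    then have "((\<lambda>t. ((exp (t * M) - 1) / t - M) * vnorm V x) \<longlongrightarrow> (M - M) * vnorm V x) (at_right 0)"
      by (intro tendsto_intros)
    then have l: "((\<lambda>t. ((exp (t * M) - 1) / t - M) * vnorm V x) \<longlongrightarrow> 0) (at_right 0)" by simp
    show "((\<lambda>t. vnorm V (scl (1 / of_real t) (op_exp V T t x - x) - T x)) \<longlongrightarrow> 0) (at_right 0)"
    proof (rule Lim_null_comparison[OF _ l], rule eventually_mono[OF pos])
      fix t :: real assume t: "t > 0"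
      have mem: "op_exp V T t x - x - scl (of_real t) (T x) \<in> vecs V"
        by (intro diff_mem op_exp_mem x scl_mem op_mem)
      have "scl (1 / of_real t) (op_exp V T t x - x) - T x
          = scl (1 / of_real t) (op_exp V T t x - x - scl (of_real t) (T x))"
        using t by (simp add: fun_eq_iff vec_apply field_simps)
      then have "vnorm V (scl (1 / of_real t) (op_exp V T t x - x) - T x)
          = 1 / t * vnorm V (op_exp V T t x - x - scl (of_real t) (T x))"
        using norm_scl[OF mem, of "1 / of_real t"] t by (simp add: norm_divide)
      also have "\<dots> \<le> 1 / t * ((exp (t * M) - 1 - t * M) * vnorm V x)"
        using op_exp_near_0(2)[OF x, of t] t by (intro mult_left_mono) auto
      also have "\<dots> = ((exp (t * M) - 1) / t - M) * vnorm V x"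
        using t by (simp add: field_simps)
      finally show "norm (vnorm V (scl (1 / of_real t) (op_exp V T t x - x) - T x))
          \<le> ((exp (t * M) - 1) / t - M) * vnorm V x"
        by (subst nn[symmetric]) (intro diff_mem scl_mem op_exp_mem x op_mem)
    qed
  qed
qed

end

section \<open>Transitivity and the identity theorem\<close>

lemma (in bfspace) mcomplete: "MS.mcomplete"
  unfolding MS.mcomplete_def
proof (intro allI impI)
  fix \<sigma> assume \<sigma>: "MS.MCauchy \<sigma>"
  then have mem: "\<sigma> m \<in> vecs V" for m unfolding MS.MCauchy_def by blast
  have "\<exists>N. \<forall>m\<ge>N. \<forall>n\<ge>N. vnorm V (\<sigma> m - \<sigma> n) < e" if "e > 0" for e
    using \<sigma> that mem unfolding MS.MCauchy_def by (simp add: vdist_def)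
  then obtain x where "x \<in> vecs V" "(\<lambda>m. vnorm V (\<sigma> m - x)) \<longlonglongrightarrow> 0"
    using complete mem by blast
  then show "\<exists>x. limitin MS.mtopology \<sigma> x sequentially"
    using limitin_iff[of \<sigma> x sequentially] mem by (auto simp: vtop_def)
qed

text \<open>By hypothesis the vectors with orbits tending to 0 are dense, and so are the vectors
  with preimages under the powers of \<open>T\<close> that tend to 0. Then the vectors whose orbit
  comes within \<open>1 / (n + 1)\<close> of a given \<open>c \<in> C\<close> form a dense open set;
  a vector in all these countably many sets has a dense orbit.\<close>

lemma (in bop) hypercyclic:
  assumes C: "countable C" "C \<subseteq> vecs V" "\<And>x e. x \<in> vecs V \<Longrightarrow> e > 0 \<Longrightarrow> \<exists>c\<in>C. vnorm V (x - c) < e"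
    and minus: "\<And>y e. y \<in> vecs V \<Longrightarrow> e > 0 \<Longrightarrow>
      \<exists>x\<in>vecs V. vnorm V (y - x) < e \<and> (\<lambda>k. vnorm V ((T ^^ k) x)) \<longlonglongrightarrow> 0"
    and plus: "\<And>y e. y \<in> vecs V \<Longrightarrow> e > 0 \<Longrightarrow>
      \<exists>x\<in>vecs V. vnorm V (y - x) < e \<and>
        (\<exists>u. (\<forall>k. u k \<in> vecs V \<and> (T ^^ k) (u k) = x) \<and> (\<lambda>k. vnorm V (u k)) \<longlonglongrightarrow> 0)"
  shows "\<exists>x\<in>vecs V. \<forall>y\<in>vecs V. \<forall>e>0. \<exists>k. vnorm V (y - (T ^^ k) x) < e"
proof -
  define W where "W p = {x \<in> vecs V. \<exists>k. vnorm V (fst p - (T ^^ k) x) < 1 / (real (snd p) + 1)}"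
    for p :: "('i \<Rightarrow> complex) \<times> nat"
  define \<G> where "\<G> = W ` (C \<times> UNIV)"
  have "MS.mtopology closure_of \<Inter>\<G> = vecs V"
  proof (rule MS.metric_Baire_category[OF mcomplete])
    show "countable \<G>" unfolding \<G>_def using C by (intro countable_image countable_SIGMA) auto
    fix U assume "U \<in> \<G>"
    then obtain c n where c: "c \<in> C" and U: "U = W (c, n)" unfolding \<G>_def by auto
    have cV: "c \<in> vecs V" using c C by auto
    define d where "d = 1 / (real n + 1)"
    have d: "d > 0" by (simp add: d_def)
    have U_eq: "U = {x \<in> vecs V. \<exists>k. vnorm V (c - (T ^^ k) x) < d}" by (simp add: U W_def d_def)
    have "openin MS.mtopology U"
      unfolding MS.openin_mtopology
    proof (intro conjI allI impI)
      show "U \<subseteq> vecs V" by (auto simp: U_eq)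
      fix x assume "x \<in> U"
      then obtain k where x: "x \<in> vecs V" and k: "vnorm V (c - (T ^^ k) x) < d" by (auto simp: U_eq)
      \<comment> \<open>\<open>T ^^ k\<close> has Lipschitz constant \<open>M ^ k\<close>, so a
        displacement by less than \<open>r\<close> uses up less than the slack in the inequality;
        the summand 1 keeps the denominator positive.\<close>
      define r where "r = (d - vnorm V (c - (T ^^ k) x)) / (M ^ k + 1)"
      have Mk: "M ^ k + 1 > 0" using M_nonneg by (simp add: add_nonneg_pos)
      have r: "r > 0" using k Mk by (simp add: r_def)
      have "MS.mball x r \<subseteq> U"
      proof
        fix y assume "y \<in> MS.mball x r"
        then have y: "y \<in> vecs V" "vnorm V (x - y) < r" by (auto simp: MS.in_mball vdist_def)
        have "vnorm V ((T ^^ k) x - (T ^^ k) y) \<le> M ^ k * vnorm V (x - y)"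
          using pow_bound[OF diff_mem[OF x y(1)], of k] bop.op_diff[OF bop_power x y(1)] by simp
        also have "\<dots> \<le> M ^ k * r" using y M_nonneg by (intro mult_left_mono) auto
        also have "\<dots> < (M ^ k + 1) * r" using r by (simp add: algebra_simps)
        also have "\<dots> = d - vnorm V (c - (T ^^ k) x)" using Mk by (simp add: r_def)
        finally have "vnorm V (c - (T ^^ k) y) < d"
          using norm_diff_triangle[OF cV pow_mem[OF x] pow_mem[OF y(1)], of k k] by linarith
        then show "y \<in> U" using y by (auto simp: U_eq)
      qed
      then show "\<exists>r>0. MS.mball x r \<subseteq> U" using r by blast
    qed
    moreover have "MS.mtopology closure_of U = vecs V"
      unfolding MS.metric_closure_of
    proof (intro equalityI subsetI CollectI conjI allI impI)
      fix y r :: "_" assume y: "y \<in> vecs V" and r: "(r::real) > 0"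
      obtain x0 where x0: "x0 \<in> vecs V" "vnorm V (y - x0) < r / 2" "(\<lambda>k. vnorm V ((T ^^ k) x0)) \<longlonglongrightarrow> 0"
        using minus[OF y, of "r/2"] r by auto
      obtain y0 u where y0: "y0 \<in> vecs V" "vnorm V (c - y0) < d / 2"
        and u: "\<And>k. u k \<in> vecs V" "\<And>k. (T ^^ k) (u k) = y0" "(\<lambda>k. vnorm V (u k)) \<longlonglongrightarrow> 0"
        using plus[OF cV, of "d/2"] d by auto
      have "\<forall>\<^sub>F k in sequentially. vnorm V ((T ^^ k) x0) < d / 2 \<and> vnorm V (u k) < r / 2"
        using order_tendstoD(2)[OF x0(3), of "d/2"] order_tendstoD(2)[OF u(3), of "r/2"] r d
        by (intro eventually_conj) auto
      then obtain k where k: "vnorm V ((T ^^ k) x0) < d / 2" "vnorm V (u k) < r / 2"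
        by (auto simp: eventually_sequentially)
      \<comment> \<open>\<open>x0\<close> puts \<open>z\<close> near \<open>y\<close> and fades
        under \<open>T ^^ k\<close>, while \<open>u k\<close> hardly changes \<open>z\<close> but is
        carried to \<open>y0\<close>, near the target \<open>c\<close>.\<close>
      define z where "z = x0 + u k"
      have z: "z \<in> vecs V" using x0 u by (auto simp: z_def)
      have "vnorm V (y - z) \<le> vnorm V (y - x0) + vnorm V (x0 - z)"
        using norm_diff_triangle y x0 z by blast
      also have "x0 - z = - u k" by (simp add: z_def fun_eq_iff vec_apply)
      also have "vnorm V \<dots> = vnorm V (u k)" by (simp add: u)
      finally have yz: "vnorm V (y - z) < r" using x0 k by linarith
      have Tz: "(T ^^ k) z = (T ^^ k) x0 + y0"
        unfolding z_def using bop.op_add[OF bop_power x0(1) u(1)] u(2) by simp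
      have "vnorm V (c - (T ^^ k) z) \<le> vnorm V (c - y0) + vnorm V (y0 - (T ^^ k) z)"
        using norm_diff_triangle cV y0 pow_mem[OF z] by blast
      also have "y0 - (T ^^ k) z = - (T ^^ k) x0" by (simp add: Tz fun_eq_iff vec_apply)
      also have "vnorm V \<dots> = vnorm V ((T ^^ k) x0)" by (simp add: pow_mem[OF x0(1)])
      finally have "vnorm V (c - (T ^^ k) z) < d" using y0 k by linarith
      then show "\<exists>z\<in>U. z \<in> MS.mball y r"
        using z yz y by (intro bexI[of _ z]) (auto simp: U_eq MS.in_mball vdist_def)
    qed auto
    ultimately show "openin MS.mtopology U \<and> MS.mtopology closure_of U = vecs V" by blast
  qed
  then have "0 \<in> MS.mtopology closure_of \<Inter>\<G>" by simp
  then have "\<forall>r::real. r > 0 \<longrightarrow> (\<exists>y\<in>\<Inter>\<G>. y \<in> MS.mball 0 r)"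
    unfolding MS.metric_closure_of mem_Collect_eq by (rule conjunct2)
  from this[THEN spec, of 1]
  obtain x where x: "x \<in> vecs V" "\<And>c n. c \<in> C \<Longrightarrow> x \<in> W (c, n)"
    unfolding \<G>_def by (auto simp: MS.in_mball)
  have "\<exists>k. vnorm V (y - (T ^^ k) x) < e" if y: "y \<in> vecs V" and e: "e > 0" for y e
  proof -
    obtain c where c: "c \<in> C" "vnorm V (y - c) < e / 2" using C(3)[OF y, of "e/2"] e by auto
    obtain n where n: "1 / (real n + 1) < e / 2"
      using reals_Archimedean[of "e/2"] e by (auto simp: inverse_eq_divide add.commute)
    obtain k where "vnorm V (c - (T ^^ k) x) < 1 / (real n + 1)"
      using x(2)[OF c(1), of n] by (auto simp: W_def)
    then have "vnorm V (y - (T ^^ k) x) < e"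
      using norm_diff_triangle[of y c "(T ^^ k) x"] c C(2) y pow_mem[OF x(1)] n by fastforce
    then show ?thesis ..
  qed
  then show ?thesis using x by blast
qed

text \<open>\<open>\<Phi>\<close> is holomorphic in each coordinate; the common majorant
  \<open>s\<close> with \<open>dom\<close> turns scalar Taylor estimates into norm estimates. If
  \<open>\<Phi>\<close> takes values in \<open>Z\<close> at points tending to \<open>a\<close>, the
  Taylor coefficients lie in \<open>Z\<close> one after the other, as limits of the quotients left
  after subtracting the earlier terms, and \<open>\<Phi> l\<close> is a norm limit of Taylor
  polynomials.\<close>

lemma (in bfspace)
  assumes Z: "closed_subspace V Z" and r: "r > 0"
    and hol: "\<And>i. (\<lambda>l. \<Phi> l i) holomorphic_on ball a r"
    and bnd: "\<And>l i. l \<in> ball a r \<Longrightarrow> norm (\<Phi> l i) \<le> s i"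
    and dom: "\<And>x C. C \<ge> 0 \<Longrightarrow> (\<And>i. norm (x i) \<le> C * s i) \<Longrightarrow> x \<in> vecs V \<and> vnorm V x \<le> C * K"
    and acc: "\<And>e. e > 0 \<Longrightarrow> \<exists>l. l \<noteq> a \<and> norm (l - a) < e \<and> \<Phi> l \<in> Z"
    and l: "l \<in> ball a r"
  shows identity: "\<Phi> l \<in> Z"
    and identity_coeff: "(\<lambda>i. (deriv ^^ j) (\<lambda>l. \<Phi> l i) a / fact j) \<in> Z"
proof -
  note ZD = closed_subspaceD[OF Z]
  define \<rho> where "\<rho> = (norm (l - a) + r) / 2"
  have \<rho>: "0 < \<rho>" "\<rho> < r" "norm (l - a) < \<rho>"
    using l r by (auto simp: \<rho>_def dist_norm norm_minus_commute add_nonneg_pos)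
  define c where "c j = (\<lambda>i. (deriv ^^ j) (\<lambda>l. \<Phi> l i) a / fact j)" for j
  define P where "P N l = (\<Sum>j<N. scl ((l - a) ^ j) (c j))" for N l
  have s0: "s i \<ge> 0" for i using bnd[OF l, of i] by (rule order_trans[OF norm_ge_zero])
  have K0: "K \<ge> 0" using dom[of 1 0] s0 by (simp add: vec_apply)
  have cV: "c j \<in> vecs V" for j
    using dom[of "1 / \<rho> ^ j" "c j"] taylor_coeff_bound[OF hol bnd \<rho>(1,2)] \<rho> by (simp add: c_def)
  have bound: "\<Phi> l - P N l \<in> vecs V \<and>
      vnorm V (\<Phi> l - P N l) \<le> (norm (l - a) / \<rho>) ^ N / (1 - norm (l - a) / \<rho>) * K"
    if l: "norm (l - a) < \<rho>" for l N
  proof (rule dom)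
    show "0 \<le> (norm (l - a) / \<rho>) ^ N / (1 - norm (l - a) / \<rho>)" using l \<rho> by simp
    have "P N l i = (\<Sum>j<N. (deriv ^^ j) (\<lambda>l. \<Phi> l i) a / fact j * (l - a) ^ j)" for i
      by (simp add: P_def sum_fun_apply c_def mult.commute vec_apply)
    then show "norm ((\<Phi> l - P N l) i) \<le> (norm (l - a) / \<rho>) ^ N / (1 - norm (l - a) / \<rho>) * s i" for i
      using taylor_tail_bound[OF hol bnd \<rho>(1,2) l, of i N] by (simp add: mult_ac vec_apply)
  qed
  have cZ: "c j \<in> Z" for j
  proof (induction j rule: less_induct)
    case (less j)
    show ?case
    proof (rule ZD(6)[OF cV])
      fix e :: real assume e: "e > 0"
      \<comment> \<open>The final error is \<open>\<delta> * (2 * K) / \<rho> ^ Suc j\<close>, where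
        the factor 2 comes from \<open>1 - \<delta> / \<rho> \<ge> 1 / 2\<close>; the summand 1
        covers the case \<open>K = 0\<close>.\<close>
      have "e * \<rho> ^ Suc j / (2 * K + 1) > 0" using e \<rho> K0 by simp
      then have "min (\<rho> / 2) (e * \<rho> ^ Suc j / (2 * K + 1)) > 0" using \<rho> by simp
      then obtain l' where l': "l' \<noteq> a" "norm (l' - a) < min (\<rho> / 2) (e * \<rho> ^ Suc j / (2 * K + 1))" "\<Phi> l' \<in> Z"
        using acc by blast
      define \<delta> where "\<delta> = norm (l' - a)"
      have \<delta>: "0 < \<delta>" "\<delta> < \<rho> / 2" "\<delta> * (2 * K + 1) < e * \<rho> ^ Suc j" "norm (l' - a) < \<rho>"
        using l' \<rho> K0 by (auto simp: \<delta>_def pos_less_divide_eq)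
      \<comment> \<open>By the induction hypothesis \<open>z\<close> lies in \<open>Z\<close>. It
        differs from \<open>c j\<close> by the Taylor remainder of order \<open>j + 1\<close>
        divided by the j-th power of the increment, hence by a multiple of
        \<open>\<delta>\<close>.\<close>
      define z where "z = scl (1 / (l' - a) ^ j) (\<Phi> l' - P j l')"
      have "P j l' \<in> Z"
        unfolding P_def using less ZD by (intro cvec.subspace_sum) (use Z in \<open>auto simp: closed_subspace_def\<close>)
      then have z: "z \<in> Z" unfolding z_def using l' ZD by blast
      have "c j - z = scl (- (1 / (l' - a) ^ j)) (\<Phi> l' - P (Suc j) l')"
        using l' by (simp add: z_def P_def fun_eq_iff vec_apply field_simps)
      then have "vnorm V (c j - z) = norm (- (1 / (l' - a) ^ j)) * vnorm V (\<Phi> l' - P (Suc j) l')"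
        using norm_scl bound[OF \<delta>(4)] by metis
      also have "norm (- (1 / (l' - a) ^ j)) = 1 / \<delta> ^ j"
        by (simp add: norm_divide norm_power \<delta>_def)
      finally have "vnorm V (c j - z) = (1 / \<delta> ^ j) * vnorm V (\<Phi> l' - P (Suc j) l')" .
      also have "\<dots> \<le> (1 / \<delta> ^ j) * ((\<delta> / \<rho>) ^ Suc j / (1 - \<delta> / \<rho>) * K)"
        using bound[OF \<delta>(4), of "Suc j"] by (intro mult_left_mono) (auto simp: \<delta>_def)
      also have "\<dots> \<le> (1 / \<delta> ^ j) * ((\<delta> / \<rho>) ^ Suc j / (1 / 2) * K)"
        using \<delta> \<rho> K0 by (intro mult_left_mono mult_right_mono divide_left_mono) (auto simp: field_simps)
      also have "\<dots> = \<delta> * (2 * K) / \<rho> ^ Suc j"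
        using \<delta> by (simp add: power_divide field_simps)
      also have "\<dots> < e"
        using \<delta> \<rho> by (simp add: pos_divide_less_eq algebra_simps)
      finally show "\<exists>y\<in>Z. vnorm V (c j - y) < e" using z by blast
    qed
  qed
  show "(\<lambda>i. (deriv ^^ j) (\<lambda>l. \<Phi> l i) a / fact j) \<in> Z" using cZ[of j] by (simp add: c_def)
  have lV: "\<Phi> l \<in> vecs V"
    using dom[of 1 "\<Phi> l"] bnd[OF l] by simp
  show "\<Phi> l \<in> Z"
  proof (rule ZD(6)[OF lV])
    fix e :: real assume e: "e > 0"
    define q where "q = norm (l - a) / \<rho>"
    have q: "0 \<le> q" "q < 1" using \<rho> by (auto simp: q_def)
    have "(\<lambda>N. q ^ N / (1 - q) * K) \<longlonglongrightarrow> 0 / (1 - q) * K"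
      using q by (intro tendsto_intros LIMSEQ_realpow_zero) auto
    then have "\<forall>\<^sub>F N in sequentially. q ^ N / (1 - q) * K < e" using order_tendstoD(2) e by fastforce
    then obtain N where "q ^ N / (1 - q) * K < e" by (auto simp: eventually_sequentially)
    then have "vnorm V (\<Phi> l - P N l) < e" using bound[OF \<rho>(3), of N] by (simp add: q_def)
    moreover have "P N l \<in> Z"
      unfolding P_def using cZ ZD by (intro cvec.subspace_sum) (use Z in \<open>auto simp: closed_subspace_def\<close>)
    ultimately show "\<exists>y\<in>Z. vnorm V (\<Phi> l - y) < e" by blast
  qed
qed

text \<open>Combinations with rational complex coefficients suffice; they are coded as lists over a
  countable type. This provides the countable dense set for the Baire argument.\<close>

lemma (in bfspace) countable_dense_span:
  fixes f :: "nat \<Rightarrow> 'i \<Rightarrow> complex"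
  assumes f: "\<And>j. f j \<in> vecs V"
  shows "\<exists>C. countable C \<and> C \<subseteq> cvec.span (range f) \<and>
    (\<forall>y\<in>cvec.span (range f). \<forall>e>0. \<exists>c\<in>C. vnorm V (y - c) < e)"
proof -
  define q where "q p = Complex (of_rat (fst p)) (of_rat (snd p))" for p :: "rat \<times> rat"
  define val where "val ps = sum_list (map (\<lambda>(p, j). scl (q p) (f j)) ps)" for ps
  have vs: "val ps \<in> cvec.span (range f)" for ps
  proof (induction ps)
    case (Cons a ps)
    have "scl (q (fst a)) (f (snd a)) \<in> cvec.span (range f)"
      by (intro cvec.span_scale cvec.span_base) auto
    from cvec.span_add[OF this Cons] show ?case by (simp add: val_def case_prod_beta)
  qed (simp add: val_def cvec.span_zero)
  have vV: "val ps \<in> vecs V" for ps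
    unfolding val_def by (induction ps) (auto intro!: f add_mem scl_mem)
  have dq: "\<exists>p. norm (c - q p) < e" if "e > 0" for c e
  proof -
    have "Re c < Re c + e / 2" "Im c < Im c + e / 2" using that by auto
    then obtain a b where "Re c < of_rat a" "of_rat a < Re c + e / 2" "Im c < of_rat b" "of_rat b < Im c + e / 2"
      using of_rat_dense by metis
    then have "norm (c - q (a, b)) < e"
      using cmod_le[of "c - q (a, b)"] by (simp add: q_def)
    then show ?thesis ..
  qed
  have "y \<in> vecs V \<and> (\<forall>e>0. \<exists>ps. vnorm V (y - val ps) < e)" if "y \<in> cvec.span (range f)" for y
    using that
  proof (induction rule: cvec.span_induct_alt)
    case base
    have "val [] = 0" by (simp add: val_def)
    then show ?case using norm_zero by (metis diff_zero zero_mem)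
  next
    case (step c x y)
    then obtain j where x: "x = f j" by auto
    have xV: "x \<in> vecs V" using f x by simp
    show ?case
    proof (intro conjI allI impI)
      show "scl c x + y \<in> vecs V" using step xV by auto
      fix e :: real assume e: "e > 0"
      obtain ps where ps: "vnorm V (y - val ps) < e / 2" using step e half_gt_zero by blast
      have n0: "vnorm V x \<ge> 0" using norm_nonneg[OF xV] .
      obtain p where p: "norm (c - q p) < e / 2 / (vnorm V x + 1)"
        using dq[of "e / 2 / (vnorm V x + 1)" c] e n0 by auto
      have "norm (c - q p) * vnorm V x \<le> norm (c - q p) * (vnorm V x + 1)" by (intro mult_left_mono) auto
      also have "\<dots> < e / 2" using p n0 by (simp add: pos_less_divide_eq algebra_simps)
      finally have *: "vnorm V (scl (c - q p) x) < e / 2" by (simp add: norm_scl xV)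
      have "scl c x + y - val ((p, j) # ps) = scl (c - q p) x + (y - val ps)"
        by (simp add: val_def x fun_eq_iff vec_apply algebra_simps)
      moreover have m: "scl (c - q p) x \<in> vecs V" "y - val ps \<in> vecs V"
        using xV vV step by auto
      ultimately have "vnorm V (scl c x + y - val ((p, j) # ps)) < e"
        using norm_triangle[OF m] * ps by (simp only:)
      then show "\<exists>ps. vnorm V (scl c x + y - val ps) < e" by blast
    qed
  qed
  then show ?thesis
    using vs by (intro exI[of _ "range val"]) auto
qed


section \<open>Kernels of analytic functions of an operator\<close>

definition root_prod :: "complex list \<Rightarrow> complex fps" where
  "root_prod cs = prod_list (map (\<lambda>c. fps_X - fps_const c) cs)"

lemma root_prod_simps [simp]: "root_prod [] = 1" "root_prod (c # cs) = (fps_X - fps_const c) * root_prod cs"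
  by (simp_all add: root_prod_def)

lemma conv_radius_linear [simp]: "fps_conv_radius (fps_X - fps_const (c :: complex)) = \<infinity>"
  using fps_conv_radius_diff[of "fps_X :: complex fps" "fps_const c"] by simp

lemma conv_radius_root_prod [simp]: "fps_conv_radius (root_prod cs) = \<infinity>"
proof (induction cs)
  case (Cons c cs)
  then show ?case using fps_conv_radius_mult[of "fps_X - fps_const c" "root_prod cs"] by simp
qed simp

lemma eval_root_prod: "eval_fps (root_prod cs) z = prod_list (map (\<lambda>c. z - c) cs)"
  by (induction cs) (simp_all add: eval_fps_mult eval_fps_diff)

lemma root_prod_append: "root_prod (as @ bs) = root_prod as * root_prod bs"
  by (simp add: root_prod_def)

text \<open>A repeated entry \<open>y\<close> would put the square of a linear factor into
  \<open>F\<close>, and the derivative of \<open>F\<close> would vanish at \<open>y\<close>. The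
  bound \<open>R\<close> ensures that all factors can be evaluated at \<open>y\<close>.\<close>

lemma simple_roots_distinct:
  assumes F: "F = root_prod cs * H" and R: "fps_conv_radius H > ereal R"
    and c: "\<And>c. c \<in> set cs \<Longrightarrow> norm c \<le> R \<and> eval_fps (fps_deriv F) c \<noteq> 0"
  shows "distinct cs"
proof (rule ccontr)
  assume "\<not> distinct cs"
  then obtain xs ys zs y where cs: "cs = xs @ [y] @ ys @ [y] @ zs" using not_distinct_decomp by blast
  define L where "L = fps_X - fps_const y"
  define Q where "Q = root_prod (xs @ ys @ zs) * H"
  have FQ: "F = L * (L * Q)" by (simp add: F cs root_prod_append L_def Q_def mult_ac)
  have y: "norm y \<le> R" "eval_fps (fps_deriv F) y \<noteq> 0" using c cs by auto
  have rQ: "ereal (norm y) < fps_conv_radius Q"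
  proof -
    have "ereal (norm y) < fps_conv_radius H" using y R by (simp add: le_less_trans[of "ereal (norm y)" "ereal R"])
    also have "\<dots> \<le> fps_conv_radius Q"
      unfolding Q_def using fps_conv_radius_mult[of "root_prod (xs @ ys @ zs)" H] by simp
    finally show ?thesis .
  qed
  define Q' where "Q' = fps_deriv (L * Q) + Q"
  have dF: "fps_deriv F = L * Q'"
    unfolding FQ Q'_def by (simp add: L_def algebra_simps)
  have "ereal (norm y) < fps_conv_radius (L * Q)"
    using rQ fps_conv_radius_mult[of L Q] by (simp add: L_def)
  then have "ereal (norm y) < fps_conv_radius (fps_deriv (L * Q))"
    using fps_conv_radius_deriv[of "L * Q"] by (rule less_le_trans)
  then have "ereal (norm y) < min (fps_conv_radius (fps_deriv (L * Q))) (fps_conv_radius Q)" using rQ by simp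
  then have "ereal (norm y) < fps_conv_radius Q'"
    unfolding Q'_def using fps_conv_radius_add by (rule less_le_trans)
  then have "eval_fps (fps_deriv F) y = eval_fps L y * eval_fps Q' y"
    unfolding dF by (intro eval_fps_mult) (auto simp: L_def)
  also have "eval_fps L y = 0" by (simp add: L_def eval_fps_diff)
  finally show False using y by simp
qed

context bop begin

lemma fcalc_linear: "x \<in> vecs V \<Longrightarrow> fcalc (fps_X - fps_const c) T x = T x - scl c x"
  using fcalc_diff[of fps_X "fps_const c" x] by (simp add: fcalc_X fcalc_const)

lemma fcalc_zero: "fps_conv_radius F > ereal M \<Longrightarrow> fcalc F T 0 = 0"
  using bop.op_zero[OF bop_fcalc] .

text \<open>The cofactor \<open>H\<close> has no zeros on a disc larger than the bound of
  \<open>T\<close>, so \<open>inverse H\<close> can be applied to \<open>T\<close> and cancels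
  \<open>H\<close>. An analytic equation for \<open>x\<close> is thereby reduced to a polynomial
  one.\<close>

lemma kernel_factor:
  assumes F: "F \<noteq> 0" "fps_conv_radius F > ereal M" and x: "x \<in> vecs V" "fcalc F T x = 0"
  obtains cs H R where "F = root_prod cs * H" "fps_conv_radius H > ereal R" "ereal R < fps_conv_radius F"
    "\<And>c. c \<in> set cs \<Longrightarrow> norm c \<le> R \<and> eval_fps F c = 0" "fcalc (root_prod cs) T x = 0"
proof -
  txt \<open>Zeros are split off in a disc larger than \<open>cball 0 M\<close>, so that \<open>inverse H\<close> below has radius
    of convergence greater than \<open>M\<close>.\<close>
  obtain R where R: "ereal M < ereal R" "ereal R < fps_conv_radius F"
    using ereal_dense2[OF F(2)] by blast
  obtain cs H where H: "F = root_prod cs * H" "fps_conv_radius H > ereal R"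
    "\<And>z. norm z \<le> R \<Longrightarrow> eval_fps H z \<noteq> 0" "\<And>c. c \<in> set cs \<Longrightarrow> norm c \<le> R \<and> eval_fps F c = 0"
    using fps_factor_zeros[OF F(1) R(2)] unfolding root_prod_def by blast
  have "eval_fps H 0 \<noteq> 0" using H(3)[of 0] R M_nonneg by simp
  then have H0: "fps_nth H 0 \<noteq> 0" by (simp add: eval_fps_at_0)
  have "min (ereal R) (fps_conv_radius H) \<le> fps_conv_radius (inverse H)"
    by (rule fps_conv_radius_inverse) (use H(3) in auto)
  moreover have "ereal M < min (ereal R) (fps_conv_radius H)"
    using R(1) less_trans[OF R(1) H(2)] by simp
  ultimately have invH: "fps_conv_radius (inverse H) > ereal M" by (rule less_le_trans[rotated])
  have "root_prod cs = inverse H * F"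
    using inverse_mult_eq_1[OF H0] by (simp add: H(1) mult_ac)
  then have "fcalc (root_prod cs) T x = fcalc (inverse H) T (fcalc F T x)"
    using fcalc_mult[OF invH F(2) x(1)] by simp
  also have "\<dots> = 0" by (simp add: x fcalc_zero[OF invH])
  finally show ?thesis using that H R by blast
qed

text \<open>The linear factors are applied one at a time; the last nonzero vector before
  annihilation is an eigenvector.\<close>

lemma root_prod_eigenvector:
  assumes "x \<in> vecs V" "x \<noteq> 0" "fcalc (root_prod cs) T x = 0"
  shows "\<exists>c\<in>set cs. \<exists>u\<in>vecs V. u \<noteq> 0 \<and> T u = scl c u"
  using assms
proof (induction cs)
  case Nil
  then show ?case by (simp add: fcalc_1)
next
  case (Cons c cs)
  define u where "u = fcalc (root_prod cs) T x"
  show ?case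
  proof (cases "u = 0")
    case True
    then show ?thesis using Cons by (auto simp: u_def)
  next
    case False
    have u: "u \<in> vecs V" unfolding u_def by (rule fcalc_mem) (use Cons in auto)
    have "fcalc (root_prod (c # cs)) T x = T u - scl c u"
      using Cons.prems fcalc_mult[of "fps_X - fps_const c" "root_prod cs" x] fcalc_linear[OF u]
      by (simp add: u_def)
    then have "T u = scl c u" using Cons.prems by simp
    then show ?thesis using u False by auto
  qed
qed

text \<open>Distinct roots split the kernel into eigenspaces. The vector
  \<open>T x - scl c x\<close> is decomposed by induction, its components are divided by
  \<open>d - c\<close> to give \<open>s\<close> with the same image as \<open>x\<close>, and the
  rest \<open>x - s\<close> is the eigenvector for \<open>c\<close>.\<close>

lemma root_prod_decomp:
  assumes "x \<in> vecs V" "fcalc (root_prod cs) T x = 0" "distinct cs"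
  shows "\<exists>e. (\<forall>c\<in>set cs. e c \<in> vecs V \<and> T (e c) = scl c (e c)) \<and> x = (\<Sum>c\<in>set cs. e c)"
  using assms
proof (induction cs arbitrary: x)
  case Nil
  then show ?case by (auto simp: fcalc_1)
next
  case (Cons c cs)
  define y where "y = T x - scl c x"
  have y: "y \<in> vecs V" unfolding y_def using Cons.prems op_mem by auto
  have "fcalc (root_prod cs) T y = fcalc (root_prod cs * (fps_X - fps_const c)) T x"
    using Cons.prems fcalc_mult[of "root_prod cs" "fps_X - fps_const c" x] by (simp add: fcalc_linear y_def)
  then have "fcalc (root_prod cs) T y = 0" using Cons.prems by (simp add: mult.commute)
  then obtain e where e: "\<And>d. d \<in> set cs \<Longrightarrow> e d \<in> vecs V \<and> T (e d) = scl d (e d)" "y = (\<Sum>d\<in>set cs. e d)"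
    using Cons.IH[OF y] Cons.prems by auto
  define s where "s = (\<Sum>d\<in>set cs. scl (1 / (d - c)) (e d))"
  have sV: "s \<in> vecs V" unfolding s_def using e by (intro sum_mem) auto
  have "T s - scl c s = (\<Sum>d\<in>set cs. T (scl (1 / (d - c)) (e d)) - scl c (scl (1 / (d - c)) (e d)))"
    unfolding s_def using e by (subst op_sum) (auto simp: sum_subtractf cvec.scale_sum_right)
  also have "\<dots> = (\<Sum>d\<in>set cs. e d)"
  proof (rule sum.cong[OF refl])
    fix d assume d: "d \<in> set cs"
    then have "d \<noteq> c" using Cons.prems by auto
    then show "T (scl (1 / (d - c)) (e d)) - scl c (scl (1 / (d - c)) (e d)) = e d"
      using e(1)[OF d]
      by (simp add: op_scl cvec.scale_left_diff_distrib[symmetric] diff_divide_distrib[symmetric])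
  qed
  finally have Ts: "T s - scl c s = y" using e by simp
  define e' where "e' d = (if d = c then x - s else scl (1 / (d - c)) (e d))" for d
  have "T x = y + scl c x" "T s = y + scl c s"
    using Ts by (simp_all add: y_def algebra_simps)
  then have "T (x - s) = scl c (x - s)"
    by (simp add: op_diff[OF Cons.prems(1) sV] cvec.scale_right_diff_distrib)
  then have "\<forall>d\<in>set (c # cs). e' d \<in> vecs V \<and> T (e' d) = scl d (e' d)"
    using e Cons.prems sV by (auto simp: e'_def op_scl cvec.scale_left_commute)
  moreover have "x = (\<Sum>d\<in>set (c # cs). e' d)"
  proof -
    have "(\<Sum>d\<in>set cs. e' d) = s"
      unfolding s_def by (rule sum.cong) (use Cons.prems in \<open>auto simp: e'_def\<close>)
    then show ?thesis using Cons.prems by (simp add: e'_def)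
  qed
  ultimately show ?case by blast
qed

text \<open>A fixed vector is annihilated by the function \<open>exp (t * z) - 1\<close> of
  \<open>T\<close>. Its zeros are imaginary, and they are simple because the derivative
  \<open>t * exp (t * z)\<close> never vanishes; simplicity excludes generalized
  eigenvectors.\<close>

lemma op_exp_fixed_decomp:
  assumes x: "x \<in> vecs V" "op_exp V T t x = x" and t: "t > 0"
  obtains S e where "finite S" "\<And>c. c \<in> S \<Longrightarrow> Re c = 0 \<and> e c \<in> vecs V \<and> T (e c) = scl c (e c)"
    "x = (\<Sum>c\<in>S. e c)"
proof -
  define F where "F = fps_exp (of_real t :: complex) - 1"
  have rF: "fps_conv_radius F = \<infinity>"
    using fps_conv_radius_diff[of "fps_exp (of_real t :: complex)" 1] by (simp add: F_def)
  have evF: "eval_fps F z = exp (of_real t * z) - 1" for z by (simp add: F_def eval_fps_diff)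
  have dF: "fps_deriv F = fps_const (of_real t) * fps_exp (of_real t)"
    by (simp add: F_def fps_exp_deriv)
  have Fnz: "F \<noteq> 0"
  proof
    assume "F = 0"
    then have "fps_nth F 1 = 0" by simp
    then show False using t by (simp add: F_def)
  qed
  have Fx: "fcalc F T x = 0"
    unfolding F_def using x by (subst fcalc_diff) (auto simp: fcalc_1 op_exp_eq)
  have rM: "fps_conv_radius F > ereal M" by (simp add: rF)
  obtain cs H R where cs: "F = root_prod cs * H" "fps_conv_radius H > ereal R"
    "\<And>c. c \<in> set cs \<Longrightarrow> norm c \<le> R \<and> eval_fps F c = 0" "fcalc (root_prod cs) T x = 0"
    using kernel_factor[OF Fnz rM x(1) Fx] by metis
  have "distinct cs"
  proof (rule simple_roots_distinct[OF cs(1,2)])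
    show "norm c \<le> R \<and> eval_fps (fps_deriv F) c \<noteq> 0" if "c \<in> set cs" for c
      using cs(3)[OF that] t by (simp add: dF eval_fps_mult)
  qed
  then obtain e where e: "\<forall>c\<in>set cs. e c \<in> vecs V \<and> T (e c) = scl c (e c)" "x = (\<Sum>c\<in>set cs. e c)"
    using root_prod_decomp[OF x(1) cs(4)] by blast
  have "Re c = 0" if "c \<in> set cs" for c
  proof -
    have "exp (of_real t * c) = 1" using cs(3)[OF that] by (simp add: evF)
    then have "Re (of_real t * c) = 0" by (auto simp: exp_eq_1)
    then show ?thesis using t by simp
  qed
  then show ?thesis using that[of "set cs" e] e by blast
qed

text \<open>If only finitely many imaginary eigenvalues are available, all periodic vectors lie in the
  kernel of a fixed polynomial in the operator, and on this kernel the group acts boundedly.\<close>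

lemma finite_imaginary_spectrum_not_chaotic:
  assumes L: "finite L" "\<And>c. c \<in> L \<Longrightarrow> Re c = 0"
    and ev: "\<And>c v. Re c = 0 \<Longrightarrow> v \<in> vecs V \<Longrightarrow> v \<noteq> 0 \<Longrightarrow> T v = scl c v \<Longrightarrow> c \<in> L"
    and Y: "closed_subspace V Y" "Y \<noteq> {0}"
    and per: "\<And>y e. y \<in> Y \<Longrightarrow> e > 0 \<Longrightarrow> \<exists>x\<in>Y. (\<exists>t>0. op_exp V T t x = x) \<and> vnorm V (y - x) < e"
    and orb: "x \<in> Y" "\<And>y e. y \<in> Y \<Longrightarrow> e > 0 \<Longrightarrow> \<exists>t\<ge>0. vnorm V (y - op_exp V T t x) < e"
  shows False
proof -
  note YD = closed_subspaceD[OF Y(1)]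
  obtain ls where ls: "set ls = L" "distinct ls" using finite_distinct_list[OF L(1)] by blast
  define P where "P = fcalc (root_prod ls) T"
  define K where "K = (\<Sum>m. norm (fps_nth (root_prod ls) m) * M ^ m)"
  interpret P: bop V P K unfolding P_def K_def by (rule bop_fcalc) simp
  have P_per: "P x = 0" if x: "x \<in> vecs V" "op_exp V T t x = x" "t > 0" for x t
  proof -
    obtain S e where e: "finite S" "\<And>c. c \<in> S \<Longrightarrow> Re c = 0 \<and> e c \<in> vecs V \<and> T (e c) = scl c (e c)"
      "x = (\<Sum>c\<in>S. e c)"
      using op_exp_fixed_decomp[OF x] by blast
    have "P (e c) = 0" if c: "c \<in> S" for c
    proof (cases "e c = 0")
      case False
      then have "c \<in> set ls" using ev e(2)[OF c] ls by blast
      then have "eval_fps (root_prod ls) c = 0" by (auto simp: eval_root_prod prod_list_zero_iff)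
      then show ?thesis
        unfolding P_def using e(2)[OF c] by (subst fcalc_eigen[of _ c]) auto
    qed (simp add: P.op_zero)
    then show ?thesis unfolding e(3) using e(2) by (subst P.op_sum) auto
  qed
  have PY: "P y = 0" if y: "y \<in> Y" for y
  proof -
    have yV: "y \<in> vecs V" using y YD by blast
    have "vnorm V (P y) \<le> 0 + d" if d: "d > 0" for d
    proof -
      have "d / (K + 1) > 0" using d P.M_nonneg by simp
      then obtain x t where x: "x \<in> Y" "t > 0" "op_exp V T t x = x" "vnorm V (y - x) < d / (K + 1)"
        using per[OF y] by blast
      then have xV: "x \<in> vecs V" using YD by blast
      have "P y = P (y - x)" using P_per[OF xV x(3,2)] P.op_diff[OF yV xV] by simp
      then have "vnorm V (P y) \<le> K * vnorm V (y - x)" using P.op_bound[OF diff_mem[OF yV xV]] by simp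
      also have "\<dots> \<le> K * (d / (K + 1))" using x P.M_nonneg by (intro mult_left_mono) auto
      also have "\<dots> \<le> d" using d P.M_nonneg by (simp add: field_simps)
      finally show ?thesis by simp
    qed
    then have "vnorm V (P y) \<le> 0" by (rule field_le_epsilon)
    then show ?thesis using norm_nonneg[OF P.op_mem[OF yV]] norm_eq_0[OF P.op_mem[OF yV]] by simp
  qed
  have xV: "x \<in> vecs V" using orb YD by blast
  obtain e where e: "\<And>c. c \<in> L \<Longrightarrow> e c \<in> vecs V \<and> T (e c) = scl c (e c)" "x = (\<Sum>c\<in>L. e c)"
    using root_prod_decomp[OF xV _ ls(2)] PY[OF orb(1)] ls(1) unfolding P_def by blast
  define B where "B = (\<Sum>c\<in>L. vnorm V (e c))"
  have orbit: "vnorm V (op_exp V T t x) \<le> B" for t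
  proof -
    have eq: "op_exp V T t x = (\<Sum>c\<in>L. op_exp V T t (e c))"
      unfolding e(2) using e(1) by (subst bop.op_sum[OF bop_op_exp]) auto
    have "vnorm V (op_exp V T t x) \<le> (\<Sum>c\<in>L. vnorm V (op_exp V T t (e c)))"
      unfolding eq using e(1) op_exp_mem by (intro norm_sum_le) auto
    also have "\<dots> = B"
      unfolding B_def
    proof (rule sum.cong[OF refl])
      fix c assume c: "c \<in> L"
      then show "vnorm V (op_exp V T t (e c)) = vnorm V (e c)"
        using e(1)[OF c] op_exp_eigen[of "e c" c t] L(2)[OF c] by (simp add: norm_scl)
    qed
    finally show ?thesis .
  qed
  obtain y where y: "y \<in> Y" "y \<noteq> 0" using Y YD(2) by auto
  then have yV: "y \<in> vecs V" using YD by blast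
  have ny: "vnorm V y > 0" using norm_nonneg[OF yV] norm_eq_0[OF yV] y by simp
  have B0: "B \<ge> 0" unfolding B_def using e(1) norm_nonneg by (intro sum_nonneg) auto
  \<comment> \<open>The norm \<open>B + 1\<close> keeps \<open>z\<close> at distance at least 1 from
    an orbit bounded by \<open>B\<close>, which contradicts density.\<close>
  define z where "z = scl (of_real ((B + 1) / vnorm V y)) y"
  have z: "z \<in> Y" "z \<in> vecs V" "vnorm V z = B + 1"
  proof -
    have "norm (complex_of_real ((B + 1) / vnorm V y)) = (B + 1) / vnorm V y"
      unfolding norm_of_real using ny B0 by simp
    then show "vnorm V z = B + 1"
      unfolding z_def norm_scl[OF yV] using ny by (simp del: of_real_divide)
  qed (use y YD(4) yV in \<open>auto simp: z_def\<close>)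
  obtain t where "vnorm V (z - op_exp V T t x) < 1" using orb(2)[OF z(1), of 1] by auto
  moreover have "vnorm V z \<le> vnorm V (z - op_exp V T t x) + vnorm V (op_exp V T t x)"
    using norm_triangle[OF diff_mem[OF z(2) op_exp_mem[OF xV, of t]] op_exp_mem[OF xV, of t]] by simp
  ultimately show False using orbit[of t] z(3) by linarith
qed

end


section \<open>Chaos from a holomorphic field of eigenvectors\<close>

lemma funpow_fixed: "(f ^^ k) x = x \<Longrightarrow> (f ^^ (k * n)) x = x"
  by (induction n) (simp_all add: funpow_add)

text \<open>\<open>Y\<close> is the closed span of the eigenvectors for one sequence of eigenvalues
  tending to \<open>l0\<close>: countability of the family makes \<open>Y\<close> separable, and
  accumulation at \<open>l0\<close> lets the identity theorem put the whole field into
  \<open>Y\<close>. The majorant \<open>s\<close> is shared by all \<open>l\<close>, as that theorem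
  demands.\<close>

theorem (in bop) chaos_from_eigenvectors:
  assumes r: "r > 0" and l0: "Re l0 = 0" and nz: "\<Phi> l0 \<noteq> 0"
    and hol: "\<And>i. (\<lambda>l. \<Phi> l i) holomorphic_on ball l0 r"
    and bnd: "\<And>l i. l \<in> ball l0 r \<Longrightarrow> norm (\<Phi> l i) \<le> s i"
    and dom: "\<And>x C. C \<ge> 0 \<Longrightarrow> (\<And>i. norm (x i) \<le> C * s i) \<Longrightarrow> x \<in> vecs V \<and> vnorm V x \<le> C * K"
    and eig: "\<And>l. l \<in> ball l0 r \<Longrightarrow> T (\<Phi> l) = scl l (\<Phi> l)"
  shows "\<exists>Y. (\<forall>l\<in>ball l0 r. \<Phi> l \<in> Y) \<and> subchaotic_sg_wrt V (op_exp V T) Y \<and>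
    (\<forall>t>0. subchaotic_op_wrt V (op_exp V T t) Y)"
proof -
  have \<Phi>V: "\<Phi> l \<in> vecs V" if "l \<in> ball l0 r" for l
    using dom[of 1 "\<Phi> l"] bnd[OF that] by simp
  define spn where "spn S = cvec.span (\<Phi> ` S)" for S
  define cl where "cl E = {x \<in> vecs V. \<forall>e>0. \<exists>y\<in>E. vnorm V (x - y) < e}" for E
  \<comment> \<open>This is what the identity theorem asks of a set of eigenvalues: it lies in the
    domain of the field and accumulates at \<open>l0\<close>.\<close>
  define accum where "accum S \<longleftrightarrow> S \<subseteq> ball l0 r \<and> (\<forall>e>0. \<exists>l\<in>S. l \<noteq> l0 \<and> norm (l - l0) < e)" for S
  have V_sub: "cvec.subspace (vecs V)"
    by (rule cvec.subspaceI) auto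
  have spnV: "spn S \<subseteq> vecs V" if "S \<subseteq> ball l0 r" for S
    unfolding spn_def using \<Phi>V that by (intro cvec.span_minimal V_sub) auto
  have clS: "closed_subspace V (cl (spn S))" "spn S \<subseteq> cl (spn S)" if "S \<subseteq> ball l0 r" for S
    using closed_subspace_closure[OF spnV[OF that]] cvec.subspace_span unfolding cl_def spn_def by blast+
  have all_in: "\<Phi> l \<in> cl (spn S)" if "accum S" "l \<in> ball l0 r" for S l
  proof (rule identity[OF clS(1) r hol bnd dom _ that(2)])
    show "S \<subseteq> ball l0 r" using that by (simp add: accum_def)
    show "\<exists>l. l \<noteq> l0 \<and> norm (l - l0) < e \<and> \<Phi> l \<in> cl (spn S)" if e: "e > 0" for e
    proof -
      obtain l where "l \<in> S" "l \<noteq> l0" "norm (l - l0) < e" using \<open>accum S\<close> e by (auto simp: accum_def)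
      then show ?thesis
        using clS(2)[of S] \<open>accum S\<close> cvec.span_base[of "\<Phi> l" "\<Phi> ` S"] by (auto simp: accum_def spn_def)
    qed
  qed
  \<comment> \<open>The denominators start at 2, so that all points lie in the open ball.\<close>
  define lc where "lc j = l0 + of_real (r / (real j + 2))" for j
  have lc: "norm (lc j - l0) = r / (real j + 2)" for j
  proof -
    have "lc j - l0 = of_real (r / (real j + 2))" by (simp add: lc_def)
    then show ?thesis using r by (simp only: norm_of_real) simp
  qed
  define S0 where "S0 = range lc"
  have S0: "accum S0"
    unfolding accum_def
  proof (intro conjI allI impI)
    show "S0 \<subseteq> ball l0 r"
      using r lc by (auto simp: S0_def dist_norm norm_minus_commute pos_divide_less_eq)
    fix e :: real assume e: "e > 0"
    obtain n where n: "inverse (real (Suc n)) < e / r" using reals_Archimedean[of "e / r"] e r by auto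
    have "r / (real n + 2) \<le> r * inverse (real (Suc n))"
      using r by (simp add: divide_inverse mult_left_mono)
    also have "\<dots> < e" using n r by (simp add: pos_less_divide_eq mult.commute)
    finally have "norm (lc n - l0) < e" by (simp add: lc)
    moreover have "lc n \<noteq> l0" using lc[of n] r by auto
    ultimately show "\<exists>l\<in>S0. l \<noteq> l0 \<and> norm (l - l0) < e" by (auto simp: S0_def)
  qed
  have S0b: "S0 \<subseteq> ball l0 r" using S0 by (simp add: accum_def)
  define Y where "Y = cl (spn S0)"
  have Y: "closed_subspace V Y" unfolding Y_def by (rule clS(1)[OF S0b])
  note YD = closed_subspaceD[OF Y]
  have \<Phi>Y: "\<Phi> l \<in> Y" if "l \<in> ball l0 r" for l
    unfolding Y_def by (rule all_in[OF S0 that])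
  have spnY: "spn S \<subseteq> Y" if "S \<subseteq> ball l0 r" for S
    unfolding spn_def using \<Phi>Y that Y by (intro cvec.span_minimal) (auto simp: closed_subspace_def)
  \<comment> \<open>All accumulating sets of eigenvalues have the same closed span. Below this is
    applied to three sets besides \<open>S0\<close>: those with decaying, with growing and with
    periodic eigenvectors.\<close>
  have dense: "\<exists>x\<in>spn S. vnorm V (y - x) < e" if S: "accum S" and y: "y \<in> Y" and e: "e > 0" for S y e
  proof -
    have "spn S0 \<subseteq> cl (spn S)"
      unfolding spn_def[of S0] using all_in[OF S] S0b clS(1)[of S] S
      by (intro cvec.span_minimal) (auto simp: closed_subspace_def accum_def)
    moreover have "e / 2 > 0" using e by simp
    ultimately obtain z where z: "z \<in> spn S0" "z \<in> cl (spn S)" "vnorm V (y - z) < e / 2"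
      using y unfolding Y_def cl_def by blast
    then obtain x where x: "x \<in> spn S" "vnorm V (z - x) < e / 2"
      using \<open>e / 2 > 0\<close> unfolding cl_def by blast
    have "x \<in> vecs V" "z \<in> vecs V" "y \<in> vecs V"
      using spnV S x z y YD(1) S0b by (auto simp: accum_def)
    then have "vnorm V (y - x) < e" using norm_diff_triangle[of y z x] x z by simp
    then show ?thesis using x by blast
  qed
  have inv: "op_exp V T t y \<in> Y" if y: "y \<in> Y" for t y
  proof -
    define C where "C = (\<Sum>m. norm (fps_nth (fps_exp (of_real t :: complex)) m) * M ^ m)"
    interpret E: bop V "op_exp V T t" C unfolding C_def by (rule bop_op_exp)
    have yV: "y \<in> vecs V" using y YD by blast
    have sp: "op_exp V T t x \<in> Y" if x: "x \<in> spn S0" for x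
    proof -
      have "spn S0 \<subseteq> {x \<in> vecs V. op_exp V T t x \<in> Y}"
        unfolding spn_def
      proof (rule cvec.span_minimal)
        show "\<Phi> ` S0 \<subseteq> {x \<in> vecs V. op_exp V T t x \<in> Y}"
        proof safe
          fix l assume "l \<in> S0"
          then have "l \<in> ball l0 r" using S0b by blast
          then show "\<Phi> l \<in> vecs V" "op_exp V T t (\<Phi> l) \<in> Y"
            using op_exp_eigen[OF \<Phi>V eig] YD(4) \<Phi>Y \<Phi>V by auto
        qed
        show "cvec.subspace {x \<in> vecs V. op_exp V T t x \<in> Y}"
          by (rule cvec.subspaceI) (use YD in \<open>auto simp: E.op_zero E.op_add E.op_scl\<close>)
      qed
      then show ?thesis using x by blast
    qed
    show ?thesis
    proof (rule YD(6)[OF op_exp_mem[OF yV]])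
      fix e :: real assume e: "e > 0"
      have "e / (C + 1) > 0" using e E.M_nonneg by simp
      then obtain x where x: "x \<in> spn S0" "vnorm V (y - x) < e / (C + 1)"
        using dense[OF S0 y] by blast
      have xV: "x \<in> vecs V" using x spnV[OF S0b] by blast
      have "vnorm V (op_exp V T t y - op_exp V T t x) \<le> C * vnorm V (y - x)"
        using E.op_bound[OF diff_mem[OF yV xV]] E.op_diff[OF yV xV] by simp
      also have "\<dots> \<le> C * (e / (C + 1))" using x E.M_nonneg by (intro mult_left_mono) auto
      also have "\<dots> < e" using e E.M_nonneg by (simp add: field_simps)
      finally show "\<exists>z\<in>Y. vnorm V (op_exp V T t y - z) < e" using sp[OF x(1)] by blast
    qed
  qed

  \<comment> \<open>Chaos of each single operator on \<open>Y\<close>\<close>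
  define VY where "VY = V\<lparr>vecs := Y\<rparr>"
  have VY [simp]: "vecs VY = Y" "vnorm VY = vnorm V" by (simp_all add: VY_def)
  interpret Y: bfspace VY unfolding VY_def by (rule restrict_bfspace[OF Y])
  have chaos: "devaney_chaotic_op VY (op_exp V T t)" if t: "t > 0" for t
  proof -
    define E where "E = op_exp V T t"
    define C where "C = (\<Sum>m. norm (fps_nth (fps_exp (of_real t :: complex)) m) * M ^ m)"
    interpret EV: bop V E C unfolding E_def C_def by (rule bop_op_exp)
    interpret EY: bop VY E C
      by unfold_locales
        (use inv YD(1) EV.op_add EV.op_scl EV.op_bound EV.M_nonneg in \<open>auto simp: E_def subset_iff\<close>)
    have Eeig: "(E ^^ k) (\<Phi> l) = scl (exp (of_real t * l) ^ k) (\<Phi> l)" if "l \<in> ball l0 r" for l k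
      by (rule EV.pow_eigen[OF \<Phi>V[OF that]]) (use op_exp_eigen[OF \<Phi>V[OF that] eig[OF that]] in \<open>simp add: E_def\<close>)
    define Sm Sp where "Sm = {l \<in> ball l0 r. Re l < 0}" and "Sp = {l \<in> ball l0 r. Re l > 0}"
    define S1 where "S1 = {l \<in> ball l0 r. \<exists>q\<in>\<rat>. l = \<i> * of_real (2 * pi * q / t)}"
    have acc_real: "\<exists>x::real. x \<in> {0<..<min e r}" if "e > 0" for e
      using that r by (intro exI[of _ "min e r / 2"]) auto
    have Sm: "accum Sm"
      unfolding accum_def
    proof (intro conjI allI impI)
      fix e :: real assume "e > 0"
      then obtain x :: real where "x \<in> {0<..<min e r}" using acc_real by blast
      then show "\<exists>l\<in>Sm. l \<noteq> l0 \<and> norm (l - l0) < e"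
        using l0 by (intro bexI[of _ "l0 - of_real x"]) (auto simp: Sm_def dist_norm)
    qed (auto simp: Sm_def)
    have Sp: "accum Sp"
      unfolding accum_def
    proof (intro conjI allI impI)
      fix e :: real assume "e > 0"
      then obtain x :: real where "x \<in> {0<..<min e r}" using acc_real by blast
      then show "\<exists>l\<in>Sp. l \<noteq> l0 \<and> norm (l - l0) < e"
        using l0 by (intro bexI[of _ "l0 + of_real x"]) (auto simp: Sp_def dist_norm)
    qed (auto simp: Sp_def)
    have S1: "accum S1"
      unfolding accum_def
    proof (intro conjI allI impI)
      fix e :: real assume e: "e > 0"
      define b where "b = Im l0"
      have lb: "l0 = \<i> * of_real b" using l0 by (simp add: b_def complex_eq_iff)
      \<comment> \<open>The rational \<open>q\<close> is taken strictly above the value that belongs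
        to \<open>l0\<close>, so that the resulting eigenvalue differs from
        \<open>l0\<close>.\<close>
      have "b * t / (2 * pi) < (b + min e r) * t / (2 * pi)"
        using t e r by (intro divide_strict_right_mono mult_strict_right_mono) auto
      then obtain q where q: "q \<in> \<rat>" "b * t / (2 * pi) < q" "q < (b + min e r) * t / (2 * pi)"
        using Rats_dense_in_real by blast
      define x where "x = 2 * pi * q / t"
      have x: "b < x" "x < b + min e r"
        using q t by (auto simp: x_def field_simps)
      have "norm (\<i> * of_real x - l0) = norm (\<i> * of_real (x - b))" by (simp add: lb algebra_simps)
      also have "\<dots> = x - b" using x by (simp add: norm_mult del: of_real_diff)
      finally have "norm (\<i> * of_real x - l0) = x - b" .
      then show "\<exists>l\<in>S1. l \<noteq> l0 \<and> norm (l - l0) < e"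
        using x q by (intro bexI[of _ "\<i> * of_real x"])
          (auto simp: S1_def dist_norm norm_minus_commute lb x_def)
    qed (auto simp: S1_def)
    have "\<exists>C. countable C \<and> C \<subseteq> spn S0 \<and> (\<forall>y\<in>spn S0. \<forall>e>0. \<exists>c\<in>C. vnorm V (y - c) < e)"
      using countable_dense_span[of "\<lambda>j. \<Phi> (lc j)"] \<Phi>V S0b
      by (simp add: spn_def S0_def image_image subset_iff)
    then obtain C where C: "countable C" "C \<subseteq> spn S0" "\<And>y e. y \<in> spn S0 \<Longrightarrow> e > 0 \<Longrightarrow> \<exists>c\<in>C. vnorm V (y - c) < e"
      by blast
    have C_dense: "\<exists>c\<in>C. vnorm V (y - c) < e" if y: "y \<in> Y" and e: "e > 0" for y e
    proof -
      obtain x where x: "x \<in> spn S0" "vnorm V (y - x) < e / 2" using dense[OF S0 y, of "e/2"] e by auto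
      obtain c where c: "c \<in> C" "vnorm V (x - c) < e / 2" using C(3)[OF x(1), of "e/2"] e by auto
      have "vnorm V (y - c) < e"
        using norm_diff_triangle[of y x c] x c y YD(1) C(2) spnV[OF S0b] by fastforce
      then show ?thesis using c by blast
    qed
    \<comment> \<open>Vectors with vanishing orbits form a subspace, so it suffices to look at
      eigenvectors, where \<open>E\<close> multiplies by a number of modulus less than 1.\<close>
    have minus: "(\<lambda>k. vnorm V ((E ^^ k) x)) \<longlonglongrightarrow> 0" if "x \<in> spn Sm" for x
    proof -
      have "spn Sm \<subseteq> {x \<in> vecs V. (\<lambda>k. vnorm V ((E ^^ k) x)) \<longlonglongrightarrow> 0}"
        unfolding spn_def
      proof (rule cvec.span_minimal)
        show "\<Phi> ` Sm \<subseteq> {x \<in> vecs V. (\<lambda>k. vnorm V ((E ^^ k) x)) \<longlonglongrightarrow> 0}"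
        proof safe
          fix l assume l: "l \<in> Sm"
          then have lb: "l \<in> ball l0 r" by (simp add: Sm_def)
          then show "\<Phi> l \<in> vecs V" by (rule \<Phi>V)
          have "norm (exp (of_real t * l)) < 1" using l t by (simp add: Sm_def mult_pos_neg)
          then have "(\<lambda>k. norm (exp (of_real t * l)) ^ k * vnorm V (\<Phi> l)) \<longlonglongrightarrow> 0"
            by (intro tendsto_mult_left_zero LIMSEQ_realpow_zero) auto
          then show "(\<lambda>k. vnorm V ((E ^^ k) (\<Phi> l))) \<longlonglongrightarrow> 0"
            unfolding Eeig[OF lb] norm_scl[OF \<Phi>V[OF lb]] norm_power .
        qed
        show "cvec.subspace {x \<in> vecs V. (\<lambda>k. vnorm V ((E ^^ k) x)) \<longlonglongrightarrow> 0}"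
        proof (rule cvec.subspaceI)
          show "0 \<in> {x \<in> vecs V. (\<lambda>k. vnorm V ((E ^^ k) x)) \<longlonglongrightarrow> 0}"
            by (simp add: bop.op_zero[OF EV.bop_power])
          fix x y assume xy: "x \<in> {x \<in> vecs V. (\<lambda>k. vnorm V ((E ^^ k) x)) \<longlonglongrightarrow> 0}"
            "y \<in> {x \<in> vecs V. (\<lambda>k. vnorm V ((E ^^ k) x)) \<longlonglongrightarrow> 0}"
          have "(\<lambda>k. vnorm V ((E ^^ k) (x + y))) \<longlonglongrightarrow> 0"
          proof (rule Lim_null_comparison[OF always_eventually])
            show "\<forall>k. norm (vnorm V ((E ^^ k) (x + y))) \<le> vnorm V ((E ^^ k) x) + vnorm V ((E ^^ k) y)"
              using xy norm_triangle EV.pow_mem norm_nonneg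
              by (simp add: bop.op_add[OF EV.bop_power] add_mem)
            show "(\<lambda>k. vnorm V ((E ^^ k) x) + vnorm V ((E ^^ k) y)) \<longlonglongrightarrow> 0"
              using xy by (intro tendsto_add_zero) auto
          qed
          then show "x + y \<in> {x \<in> vecs V. (\<lambda>k. vnorm V ((E ^^ k) x)) \<longlonglongrightarrow> 0}" using xy by auto
        next
          fix c x assume x: "x \<in> {x \<in> vecs V. (\<lambda>k. vnorm V ((E ^^ k) x)) \<longlonglongrightarrow> 0}"
          then show "scl c x \<in> {x \<in> vecs V. (\<lambda>k. vnorm V ((E ^^ k) x)) \<longlonglongrightarrow> 0}"
            using tendsto_mult_right_zero[of "\<lambda>k. vnorm V ((E ^^ k) x)" sequentially "norm c"]
            by (auto simp: bop.op_scl[OF EV.bop_power] norm_scl EV.pow_mem)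
        qed
      qed
      then show ?thesis using that by blast
    qed
    \<comment> \<open>\<open>u\<close> consists of preimages of \<open>x\<close> under the powers of
      \<open>E\<close> and tends to 0. For an eigenvector it is obtained by dividing by the powers
      of an eigenvalue of modulus greater than 1; the existence of such a \<open>u\<close> is stable
      under linear combinations.\<close>
    define PP where "PP x u \<longleftrightarrow> (\<forall>k. u k \<in> Y \<and> (E ^^ k) (u k) = x) \<and> (\<lambda>k. vnorm V (u k)) \<longlonglongrightarrow> 0" for x and u :: "nat \<Rightarrow> 'i \<Rightarrow> complex"
    have plus: "\<exists>u. PP x u" if "x \<in> spn Sp" for x
    proof -
      have "spn Sp \<subseteq> {x. \<exists>u. PP x u}"
        unfolding spn_def
      proof (rule cvec.span_minimal)
        show "\<Phi> ` Sp \<subseteq> {x. \<exists>u. PP x u}"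
        proof safe
          fix l assume l: "l \<in> Sp"
          then have lb: "l \<in> ball l0 r" by (simp add: Sp_def)
          define u where "u k = scl (exp (- of_real t * l) ^ k) (\<Phi> l)" for k
          have "norm (exp (- of_real t * l)) < 1" using l t by (simp add: Sp_def)
          then have "(\<lambda>k. norm (exp (- of_real t * l)) ^ k * vnorm V (\<Phi> l)) \<longlonglongrightarrow> 0"
            by (intro tendsto_mult_left_zero LIMSEQ_realpow_zero) auto
          then have "(\<lambda>k. vnorm V (u k)) \<longlonglongrightarrow> 0"
            unfolding u_def norm_scl[OF \<Phi>V[OF lb]] norm_power .
          moreover have "(E ^^ k) (u k) = \<Phi> l" for k
          proof -
            have "exp (- of_real t * l) ^ k * exp (of_real t * l) ^ k = 1"
              unfolding power_mult_distrib[symmetric] mult_exp_exp by simp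
            then show ?thesis
              by (simp add: u_def bop.op_scl[OF EV.bop_power] \<Phi>V[OF lb] Eeig[OF lb] del: exp_minus)
          qed
          moreover have "u k \<in> Y" for k unfolding u_def using \<Phi>Y[OF lb] YD by blast
          ultimately show "\<exists>u. PP (\<Phi> l) u" unfolding PP_def by blast
        qed
        show "cvec.subspace {x. \<exists>u. PP x u}"
        proof (rule cvec.subspaceI)
          have "PP 0 (\<lambda>_. 0)" using YD by (simp add: PP_def bop.op_zero[OF EV.bop_power])
          then show "0 \<in> {x. \<exists>u. PP x u}" by blast
          fix x y assume "x \<in> {x. \<exists>u. PP x u}" "y \<in> {x. \<exists>u. PP x u}"
          then obtain u v where uv: "PP x u" "PP y v" by blast
          have mem: "u k \<in> vecs V" "v k \<in> vecs V" for k using uv YD(1) by (auto simp: PP_def)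
          have "(\<lambda>k. vnorm V (u k + v k)) \<longlonglongrightarrow> 0"
          proof (rule Lim_null_comparison[OF always_eventually])
            show "\<forall>k. norm (vnorm V (u k + v k)) \<le> vnorm V (u k) + vnorm V (v k)"
              using norm_triangle[OF mem] norm_nonneg[OF add_mem[OF mem]] by simp
            show "(\<lambda>k. vnorm V (u k) + vnorm V (v k)) \<longlonglongrightarrow> 0"
              using uv by (intro tendsto_add_zero) (auto simp: PP_def)
          qed
          then have "PP (x + y) (\<lambda>k. u k + v k)"
            using uv YD(3) mem by (auto simp: PP_def bop.op_add[OF EV.bop_power])
          then show "x + y \<in> {x. \<exists>u. PP x u}" by blast
        next
          fix c x assume "x \<in> {x. \<exists>u. PP x u}"
          then obtain u where u: "PP x u" by blast
          have mem: "u k \<in> vecs V" for k using u YD(1) by (auto simp: PP_def)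
          have "PP (scl c x) (\<lambda>k. scl c (u k))"
            using u YD(4) mem tendsto_mult_right_zero[of "\<lambda>k. vnorm V (u k)" sequentially "norm c"]
            by (auto simp: PP_def bop.op_scl[OF EV.bop_power] norm_scl)
          then show "scl c x \<in> {x. \<exists>u. PP x u}" by blast
        qed
      qed
      then show ?thesis using that by blast
    qed
    \<comment> \<open>On these eigenvectors \<open>E\<close> acts as a root of unity whose order
      divides the denominator of \<open>q\<close>. For a sum of two periodic vectors the product of
      their periods is a period.\<close>
    have periodic: "\<exists>k\<ge>1. (E ^^ k) x = x" if "x \<in> spn S1" for x
    proof -
      have "spn S1 \<subseteq> {x \<in> vecs V. \<exists>k\<ge>1. (E ^^ k) x = x}"
        unfolding spn_def
      proof (rule cvec.span_minimal)
        show "\<Phi> ` S1 \<subseteq> {x \<in> vecs V. \<exists>k\<ge>1. (E ^^ k) x = x}"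
        proof safe
          fix l assume l: "l \<in> S1"
          then have lb: "l \<in> ball l0 r" by (simp add: S1_def)
          then show "\<Phi> l \<in> vecs V" by (rule \<Phi>V)
          obtain q where q: "q \<in> \<rat>" "l = \<i> * of_real (2 * pi * q / t)" using l by (auto simp: S1_def)
          obtain a b where ab: "b > 0" "q = real_of_int a / real_of_int b" by (rule Rats_cases'[OF q(1)])
          define k where "k = nat b"
          have k: "k \<ge> 1" "real_of_int b = real k" using ab(1) by (auto simp: k_def)
          have "exp (of_real t * l) ^ k = exp (of_nat k * (of_real t * l))" by (rule exp_of_nat_mult[symmetric])
          also have "of_nat k * (of_real t * l) = 2 * of_real (pi * of_int a) * \<i>"
            using t k by (simp add: q(2) ab(2) field_simps)
          also have "exp \<dots> = 1" by (subst exp_eq_1) auto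
          finally have "(E ^^ k) (\<Phi> l) = \<Phi> l" by (simp add: Eeig[OF lb])
          then show "\<exists>k\<ge>1. (E ^^ k) (\<Phi> l) = \<Phi> l" using k by blast
        qed
        show "cvec.subspace {x \<in> vecs V. \<exists>k\<ge>1. (E ^^ k) x = x}"
        proof (rule cvec.subspaceI)
          show "0 \<in> {x \<in> vecs V. \<exists>k\<ge>1. (E ^^ k) x = x}"
            using bop.op_zero[OF EV.bop_power, of 1] by auto
          fix x y assume "x \<in> {x \<in> vecs V. \<exists>k\<ge>1. (E ^^ k) x = x}" "y \<in> {x \<in> vecs V. \<exists>k\<ge>1. (E ^^ k) x = x}"
          then obtain j k where jk: "j \<ge> 1" "k \<ge> 1" "(E ^^ j) x = x" "(E ^^ k) y = y" and xy: "x \<in> vecs V" "y \<in> vecs V"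
            by blast
          have "(E ^^ (j * k)) (x + y) = x + y"
            using funpow_fixed[OF jk(3), of k] funpow_fixed[OF jk(4), of j]
            by (simp add: bop.op_add[OF EV.bop_power xy] mult.commute)
          moreover have "j * k \<ge> 1" using jk by (simp add: Suc_le_eq)
          ultimately show "x + y \<in> {x \<in> vecs V. \<exists>k\<ge>1. (E ^^ k) x = x}" using xy by blast
        next
          fix c x assume "x \<in> {x \<in> vecs V. \<exists>k\<ge>1. (E ^^ k) x = x}"
          then show "scl c x \<in> {x \<in> vecs V. \<exists>k\<ge>1. (E ^^ k) x = x}"
            by (auto simp: bop.op_scl[OF EV.bop_power])
        qed
      qed
      then show ?thesis using that by blast
    qed
    have "\<exists>x\<in>vecs VY. \<forall>y\<in>vecs VY. \<forall>e>0. \<exists>k. vnorm VY (y - (E ^^ k) x) < e"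
    proof (rule EY.hypercyclic[OF C(1)])
      show "C \<subseteq> vecs VY" using C(2) spnY[OF S0b] by simp
      show "\<exists>c\<in>C. vnorm VY (x - c) < e" if "x \<in> vecs VY" "e > 0" for x e
        using C_dense that by simp
      fix y :: "'i \<Rightarrow> complex" and e :: real assume ye: "y \<in> vecs VY" "e > 0"
      show "\<exists>x\<in>vecs VY. vnorm VY (y - x) < e \<and> (\<lambda>k. vnorm VY ((E ^^ k) x)) \<longlonglongrightarrow> 0"
        using dense[OF Sm, of y e] ye minus spnY[of Sm] Sm by (auto simp: accum_def)
      show "\<exists>x\<in>vecs VY. vnorm VY (y - x) < e \<and>
          (\<exists>u. (\<forall>k. u k \<in> vecs VY \<and> (E ^^ k) (u k) = x) \<and> (\<lambda>k. vnorm VY (u k)) \<longlonglongrightarrow> 0)"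
        using dense[OF Sp, of y e] ye plus spnY[of Sp] Sp unfolding PP_def VY accum_def by blast
    qed
    then obtain x where x: "x \<in> Y" "\<And>y e. y \<in> Y \<Longrightarrow> e > 0 \<Longrightarrow> \<exists>k. vnorm V (y - (E ^^ k) x) < e"
      by auto
    have xk: "(E ^^ k) x \<in> Y" for k using EY.pow_mem[of x k] x by simp
    show ?thesis
      unfolding devaney_chaotic_op_def E_def[symmetric] Y.dense_in_iff VY
    proof (intro conjI bexI[OF _ x(1)] ballI allI impI)
      show "\<exists>z\<in>{(E ^^ k) x |k. True}. z \<in> Y \<and> vnorm V (y - z) < e" if "y \<in> Y" "e > 0" for y e
        using x(2)[OF that] xk by auto
      show "\<exists>z\<in>{x \<in> Y. \<exists>k\<ge>1. (E ^^ k) x = x}. z \<in> Y \<and> vnorm V (y - z) < e" if "y \<in> Y" "e > 0" for y e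
        using dense[OF S1 that] periodic spnY[of S1] S1 by (auto simp: accum_def)
    qed
  qed
  have Y0: "Y \<noteq> {0}" using \<Phi>Y[of l0] nz r by auto
  have op: "subchaotic_op_wrt V (op_exp V T t) Y" if "t > 0" for t
    unfolding subchaotic_op_wrt_def VY_def[symmetric] using Y Y0 inv chaos[OF that] by blast
  \<comment> \<open>The time-one operator suffices: its orbits are contained in those of the
    semigroup, and its periodic points are periodic for the semigroup.\<close>
  have "devaney_chaotic_sg VY (op_exp V T)"
  proof -
    have ch: "devaney_chaotic_op VY (op_exp V T 1)" by (rule chaos) simp
    then obtain x where x: "x \<in> Y" "dense_in VY {(op_exp V T 1 ^^ k) x |k. True}"
      and per: "dense_in VY {x \<in> Y. \<exists>k\<ge>1. (op_exp V T 1 ^^ k) x = x}"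
      unfolding devaney_chaotic_op_def VY by blast
    have pw: "(op_exp V T 1 ^^ k) y = op_exp V T (of_nat k) y" if "y \<in> Y" for y k
      using op_exp_pow[OF subsetD[OF YD(1) that], where t = 1 and k = k] by simp
    have mono: "dense_in VY B" if "dense_in VY A" "A \<subseteq> B" for A B
      using that unfolding Y.dense_in_iff by blast
    have "dense_in VY {op_exp V T t x |t. t \<ge> 0}"
      by (rule mono[OF x(2)]) (auto simp: pw[OF x(1)])
    moreover have "dense_in VY {x \<in> Y. \<exists>t>0. op_exp V T t x = x}"
    proof (rule mono[OF per], safe)
      fix y k assume "y \<in> Y" "1 \<le> k" "(op_exp V T 1 ^^ k) y = y"
      then show "\<exists>t>0. op_exp V T t y = y" using pw[of y k] by (intro exI[of _ "of_nat k"]) auto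
    qed
    ultimately show ?thesis unfolding devaney_chaotic_sg_def VY using x by blast
  qed
  then have "subchaotic_sg_wrt V (op_exp V T) Y"
    unfolding subchaotic_sg_wrt_def VY_def[symmetric] using Y Y0 inv by blast
  then show ?thesis using op \<Phi>Y by blast
qed


section \<open>Sequence spaces\<close>

definition shift :: "(nat \<Rightarrow> complex) \<Rightarrow> nat \<Rightarrow> complex" where
  "shift x = (\<lambda>k. x (Suc k))"

lemma shift_apply: "shift x k = x (Suc k)"
  by (simp add: shift_def)

text \<open>The common ground of l^p and c_0. \<open>geometric\<close> provides eigenvectors with a
  norm control that is linear in the constant, \<open>tendsto_zero\<close> excludes eigenvectors of
  the shift for eigenvalues of modulus at least 1, and \<open>truncate\<close> makes the finitely
  supported sequences dense.\<close>

locale seqspace = bfspace X for X :: "nat fspace" +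
  assumes shift_mem: "x \<in> vecs X \<Longrightarrow> shift x \<in> vecs X"
    and shift_norm: "x \<in> vecs X \<Longrightarrow> vnorm X (shift x) \<le> vnorm X x"
    and geometric: "0 \<le> \<rho> \<Longrightarrow> \<rho> < 1 \<Longrightarrow>
      \<exists>K. \<forall>x C. C \<ge> 0 \<longrightarrow> (\<forall>k. norm (x k) \<le> C * \<rho> ^ k) \<longrightarrow> x \<in> vecs X \<and> vnorm X x \<le> C * K"
    and tendsto_zero: "x \<in> vecs X \<Longrightarrow> x \<longlonglongrightarrow> 0"
    and truncate: "x \<in> vecs X \<Longrightarrow> e > 0 \<Longrightarrow> \<exists>N. vnorm X (x - (\<lambda>k. if k < N then x k else 0)) < e"

text \<open>Convexity on the positive reals, extended to 0; if \<open>u\<close> or \<open>v\<close>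
  is 0, the claim reduces to \<open>s powr p \<le> s\<close> for \<open>s\<close> in the unit
  interval.\<close>

lemma convex_powr:
  fixes u v t p :: real
  assumes p: "p \<ge> 1" and uv: "u \<ge> 0" "v \<ge> 0" and t: "0 \<le> t" "t \<le> 1"
  shows "((1 - t) * u + t * v) powr p \<le> (1 - t) * u powr p + t * v powr p"
proof -
  have s: "s powr p \<le> s" if "0 \<le> s" "s \<le> 1" for s
    using powr_le_one_le[of s p] that p by (cases "s = 0") auto
  consider "u = 0" | "v = 0" | "u > 0" "v > 0" using uv by fastforce
  then show ?thesis
  proof cases
    case 1
    then show ?thesis using s[OF t] uv t p by (simp add: powr_mult mult_right_mono)
  next
    case 2
    then show ?thesis using s[of "1 - t"] uv t p by (simp add: powr_mult mult_right_mono)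
  next
    case 3
    then show ?thesis using convex_onD[OF powr_convex[OF p], of t u v] t by simp
  qed
qed

section \<open>The spaces l^p\<close>

context
  fixes p :: real
  assumes p: "p \<ge> 1"
begin

text \<open>A bound on all partial sums gives summability and the norm bound at once; the membership
  claims for l^p below take this route.\<close>

lemma lp_memI:
  assumes a: "a \<ge> 0" and s: "\<And>K. (\<Sum>k<K. cmod (x k) powr p) \<le> a powr p"
  shows "x \<in> vecs (lp_space p) \<and> vnorm (lp_space p) x \<le> a"
proof -
  have sm: "summable (\<lambda>k. cmod (x k) powr p)"
    by (rule summableI_nonneg_bounded[OF _ s]) simp
  have "(\<Sum>k. cmod (x k) powr p) \<le> a powr p"
    by (rule suminf_le_const[OF sm]) (rule s)
  then have "(\<Sum>k. cmod (x k) powr p) powr (1 / p) \<le> (a powr p) powr (1 / p)"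
    using p by (intro powr_mono2 suminf_nonneg[OF sm]) auto
  also have "\<dots> = a" using p a by (simp add: powr_powr)
  finally show ?thesis using sm by (simp add: lp_space_def)
qed

lemma lp_memD:
  assumes x: "x \<in> vecs (lp_space p)"
  shows "(\<Sum>k<K. cmod (x k) powr p) \<le> vnorm (lp_space p) x powr p" "vnorm (lp_space p) x \<ge> 0"
proof -
  have sm: "summable (\<lambda>k. cmod (x k) powr p)" using x by (simp add: lp_space_def)
  have "(\<Sum>k<K. cmod (x k) powr p) \<le> (\<Sum>k. cmod (x k) powr p)"
    by (rule sum_le_suminf[OF sm]) auto
  also have "\<dots> = vnorm (lp_space p) x powr p"
    using p suminf_nonneg[OF sm] by (simp add: lp_space_def powr_powr)
  finally show "(\<Sum>k<K. cmod (x k) powr p) \<le> vnorm (lp_space p) x powr p" .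
  show "vnorm (lp_space p) x \<ge> 0" by (simp add: lp_space_def)
qed

text \<open>\<open>(x + y) / s\<close> is a convex combination of \<open>x / a\<close> and
  \<open>y / b\<close> with the weights \<open>a / s\<close> and \<open>b / s\<close>; convexity of
  the p-th power then gives the estimate termwise.\<close>

lemma lp_minkowski:
  assumes a: "a > 0" "b > 0" and x: "(\<Sum>k<K. cmod (x k) powr p) \<le> a powr p"
    and y: "(\<Sum>k<K. cmod (y k) powr p) \<le> b powr p"
  shows "(\<Sum>k<K. cmod (x k + y k) powr p) \<le> (a + b) powr p"
proof -
  define s where "s = a + b"
  define t where "t = b / s"
  have s: "s > 0" using a by (simp add: s_def)
  have t: "0 \<le> t" "t \<le> 1" "1 - t = a / s" using a by (auto simp: t_def s_def field_simps)
  have "cmod (x k + y k) powr p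
      \<le> s powr p * ((1 - t) * (cmod (x k) powr p / a powr p) + t * (cmod (y k) powr p / b powr p))" for k
  proof -
    have "cmod (x k + y k) \<le> s * ((1 - t) * (cmod (x k) / a) + t * (cmod (y k) / b))"
    proof -
      have "s * ((1 - t) * (cmod (x k) / a) + t * (cmod (y k) / b)) = cmod (x k) + cmod (y k)"
        using a s unfolding t(3) by (simp add: t_def field_simps)
      then show ?thesis using norm_triangle_ineq[of "x k" "y k"] by simp
    qed
    then have "cmod (x k + y k) powr p \<le> (s * ((1 - t) * (cmod (x k) / a) + t * (cmod (y k) / b))) powr p"
      using p by (intro powr_mono2) auto
    also have "\<dots> = s powr p * ((1 - t) * (cmod (x k) / a) + t * (cmod (y k) / b)) powr p"
      by (rule powr_mult)
    also have "\<dots> \<le> s powr p * ((1 - t) * (cmod (x k) / a) powr p + t * (cmod (y k) / b) powr p)"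
      using t a by (intro mult_left_mono convex_powr p) auto
    finally show ?thesis using a by (simp add: powr_divide)
  qed
  then have "(\<Sum>k<K. cmod (x k + y k) powr p) \<le> (\<Sum>k<K. s powr p *
      ((1 - t) * (cmod (x k) powr p / a powr p) + t * (cmod (y k) powr p / b powr p)))"
    by (intro sum_mono)
  also have "\<dots> = s powr p * ((1 - t) * ((\<Sum>k<K. cmod (x k) powr p) / a powr p)
      + t * ((\<Sum>k<K. cmod (y k) powr p) / b powr p))"
    by (simp add: sum_distrib_left sum.distrib sum_divide_distrib distrib_left)
  also have "\<dots> \<le> s powr p * ((1 - t) * 1 + t * 1)"
    using x y a t by (intro mult_left_mono add_mono) (auto simp: divide_le_eq)
  finally show ?thesis by (simp add: s_def)
qed

lemma lp_coord_le:
  assumes x: "x \<in> vecs (lp_space p)"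
  shows "cmod (x i) \<le> vnorm (lp_space p) x"
proof (rule ccontr)
  assume "\<not> cmod (x i) \<le> vnorm (lp_space p) x"
  then have "vnorm (lp_space p) x powr p < cmod (x i) powr p"
    using p lp_memD(2)[OF x] by (intro powr_less_mono2) auto
  also have "\<dots> \<le> (\<Sum>k<Suc i. cmod (x k) powr p)"
    by (intro member_le_sum) auto
  also have "\<dots> \<le> vnorm (lp_space p) x powr p" by (rule lp_memD(1)[OF x])
  finally show False by simp
qed

lemma lp_add:
  assumes x: "x \<in> vecs (lp_space p)" and y: "y \<in> vecs (lp_space p)"
  shows "x + y \<in> vecs (lp_space p) \<and> vnorm (lp_space p) (x + y) \<le> vnorm (lp_space p) x + vnorm (lp_space p) y"
proof -
  define a b where "a = vnorm (lp_space p) x" and "b = vnorm (lp_space p) y"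
  have ab: "a \<ge> 0" "b \<ge> 0" using lp_memD(2) x y by (auto simp: a_def b_def)
  have *: "x + y \<in> vecs (lp_space p) \<and> vnorm (lp_space p) (x + y) \<le> a + b + e" if e: "e > 0" for e
  proof (rule lp_memI)
    show "a + b + e \<ge> 0" using ab e by simp
    fix K
    \<comment> \<open>The norms are enlarged by \<open>e / 2\<close> because they may be 0, where
      the division behind Minkowski's inequality fails.\<close>
    have "a powr p \<le> (a + e / 2) powr p" "b powr p \<le> (b + e / 2) powr p"
      using ab e p by (auto intro!: powr_mono2)
    then have "(\<Sum>k<K. cmod (x k + y k) powr p) \<le> (a + e / 2 + (b + e / 2)) powr p"
      using lp_memD(1)[OF x, of K] lp_memD(1)[OF y, of K] ab e unfolding a_def[symmetric] b_def[symmetric]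
      by (intro lp_minkowski) auto
    also have "a + e / 2 + (b + e / 2) = a + b + e" by simp
    finally show "(\<Sum>k<K. cmod ((x + y) k) powr p) \<le> (a + b + e) powr p"
      by (simp add: vec_apply)
  qed
  then show ?thesis
    using *[of 1] field_le_epsilon[of "vnorm (lp_space p) (x + y)" "a + b"] by (auto simp: a_def b_def)
qed

text \<open>The upper estimate, applied with the factor \<open>1 / c\<close>, yields the lower
  estimate for \<open>c\<close>.\<close>

lemma lp_scl:
  assumes x: "x \<in> vecs (lp_space p)"
  shows "scl c x \<in> vecs (lp_space p) \<and> vnorm (lp_space p) (scl c x) = cmod c * vnorm (lp_space p) x"
proof -
  have *: "scl c x \<in> vecs (lp_space p) \<and> vnorm (lp_space p) (scl c x) \<le> cmod c * vnorm (lp_space p) x"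
    if x: "x \<in> vecs (lp_space p)" for c x
  proof (rule lp_memI)
    show "cmod c * vnorm (lp_space p) x \<ge> 0" using lp_memD(2)[OF x] by simp
    fix K
    have "(\<Sum>k<K. cmod (scl c x k) powr p) = cmod c powr p * (\<Sum>k<K. cmod (x k) powr p)"
      by (simp add: scl_apply norm_mult powr_mult sum_distrib_left)
    also have "\<dots> \<le> cmod c powr p * vnorm (lp_space p) x powr p"
      using lp_memD(1)[OF x] by (intro mult_left_mono) auto
    also have "\<dots> = (cmod c * vnorm (lp_space p) x) powr p"
      using lp_memD(2)[OF x] by (simp add: powr_mult)
    finally show "(\<Sum>k<K. cmod (scl c x k) powr p) \<le> (cmod c * vnorm (lp_space p) x) powr p" .
  qed
  show ?thesis
  proof (cases "c = 0")
    case True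
    then show ?thesis using *[OF x, of 0] lp_memD(2)[of "scl 0 x"] by simp
  next
    case False
    have "scl (1 / c) (scl c x) = x" using False by simp
    then have "vnorm (lp_space p) x \<le> cmod (1 / c) * vnorm (lp_space p) (scl c x)"
      using *[OF conjunct1[OF *[OF x, of c]], of "1 / c"] by simp
    then have "cmod c * vnorm (lp_space p) x \<le> vnorm (lp_space p) (scl c x)"
      using False by (simp add: norm_divide field_simps)
    then show ?thesis using *[OF x, of c] by simp
  qed
qed

lemma lp_seqspace: "seqspace (lp_space p)"
proof
  let ?N = "vnorm (lp_space p)"
  show "0 \<in> vecs (lp_space p)" using p by (simp add: lp_space_def vec_apply)
  show "x + y \<in> vecs (lp_space p)" "?N (x + y) \<le> ?N x + ?N y"
    if "x \<in> vecs (lp_space p)" "y \<in> vecs (lp_space p)" for x y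
    using lp_add[OF that] by auto
  show "scl c x \<in> vecs (lp_space p)" "?N (scl c x) = cmod c * ?N x" if "x \<in> vecs (lp_space p)" for x c
    using lp_scl[OF that] by auto
  show "cmod (x i) \<le> ?N x" if "x \<in> vecs (lp_space p)" for x i by (rule lp_coord_le[OF that])
  fix \<sigma> :: "nat \<Rightarrow> nat \<Rightarrow> complex"
  assume \<sigma>: "\<And>m. \<sigma> m \<in> vecs (lp_space p)"
    and C: "\<And>e. e > 0 \<Longrightarrow> \<exists>N. \<forall>m\<ge>N. \<forall>n\<ge>N. ?N (\<sigma> m - \<sigma> n) < e"
  have dm: "\<sigma> m - \<sigma> n \<in> vecs (lp_space p)" for m n
    using lp_add[OF \<sigma>[of m] conjunct1[OF lp_scl[OF \<sigma>[of n], of "-1"]]] by simp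
  have "Cauchy (\<lambda>m. \<sigma> m k)" for k
    unfolding Cauchy_def
  proof (intro allI impI)
    fix e :: real assume "e > 0"
    then obtain N where N: "\<forall>m\<ge>N. \<forall>n\<ge>N. ?N (\<sigma> m - \<sigma> n) < e" using C by blast
    have "dist (\<sigma> m k) (\<sigma> n k) < e" if "m \<ge> N" "n \<ge> N" for m n
      using lp_coord_le[OF dm, of m n k] N that by (force simp: dist_norm vec_apply)
    then show "\<exists>M. \<forall>m\<ge>M. \<forall>n\<ge>M. dist (\<sigma> m k) (\<sigma> n k) < e" by blast
  qed
  then have "\<exists>x. \<forall>k. (\<lambda>m. \<sigma> m k) \<longlonglongrightarrow> x k"
    by (intro choice allI) (auto simp: Cauchy_convergent_iff convergent_def)
  then obtain x where x: "\<And>k. (\<lambda>m. \<sigma> m k) \<longlonglongrightarrow> x k" by blast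
  \<comment> \<open>The candidate \<open>x\<close> is the coordinatewise limit. A partial sum has
    finitely many terms, so the Cauchy bound passes to the limit in it, and then the bound holds for
    all partial sums.\<close>
  have close: "\<exists>N. \<forall>m\<ge>N. \<sigma> m - x \<in> vecs (lp_space p) \<and> ?N (\<sigma> m - x) \<le> e" if e: "e > 0" for e
  proof -
    obtain N where N: "\<forall>m\<ge>N. \<forall>n\<ge>N. ?N (\<sigma> m - \<sigma> n) < e" using C e by blast
    have "\<sigma> m - x \<in> vecs (lp_space p) \<and> ?N (\<sigma> m - x) \<le> e" if m: "m \<ge> N" for m
    proof (rule lp_memI)
      fix K
      have "(\<lambda>n. \<Sum>k<K. cmod (\<sigma> m k - \<sigma> n k) powr p) \<longlonglongrightarrow> (\<Sum>k<K. cmod (\<sigma> m k - x k) powr p)"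
        using p by (intro tendsto_sum tendsto_powr' tendsto_intros x) auto
      moreover have "(\<Sum>k<K. cmod (\<sigma> m k - \<sigma> n k) powr p) \<le> e powr p" if n: "n \<ge> N" for n
      proof -
        have "(\<Sum>k<K. cmod (\<sigma> m k - \<sigma> n k) powr p) \<le> ?N (\<sigma> m - \<sigma> n) powr p"
          using lp_memD(1)[OF dm, of m n K] by (simp add: vec_apply)
        also have "\<dots> \<le> e powr p"
          using N m n p lp_memD(2)[OF dm] by (intro powr_mono2) (auto intro: less_imp_le)
        finally show ?thesis .
      qed
      ultimately have "(\<Sum>k<K. cmod (\<sigma> m k - x k) powr p) \<le> e powr p"
        by (intro LIMSEQ_le_const2) auto
      then show "(\<Sum>k<K. cmod ((\<sigma> m - x) k) powr p) \<le> e powr p" by (simp add: vec_apply)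
    qed (use e in simp)
    then show ?thesis by blast
  qed
  obtain N where "\<sigma> N - x \<in> vecs (lp_space p)" using close[of 1] by auto
  from lp_add[OF \<sigma>[of N] conjunct1[OF lp_scl[OF this, of "-1"]]]
  have xm: "x \<in> vecs (lp_space p)" by simp
  have "(\<lambda>m. ?N (\<sigma> m - x)) \<longlonglongrightarrow> 0"
  proof (rule LIMSEQ_I)
    fix r :: real assume "r > 0"
    then obtain N where "\<forall>m\<ge>N. \<sigma> m - x \<in> vecs (lp_space p) \<and> ?N (\<sigma> m - x) \<le> r / 2"
      using close[of "r / 2"] by auto
    then show "\<exists>N. \<forall>m\<ge>N. norm (?N (\<sigma> m - x) - 0) < r"
      using \<open>r > 0\<close> lp_memD(2) by (intro exI[of _ N]) fastforce
  qed
  then show "\<exists>x\<in>vecs (lp_space p). (\<lambda>m. ?N (\<sigma> m - x)) \<longlonglongrightarrow> 0" using xm by blast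
next
  let ?N = "vnorm (lp_space p)"
  fix x assume x: "x \<in> vecs (lp_space p)"
  have "shift x \<in> vecs (lp_space p) \<and> ?N (shift x) \<le> ?N x"
  proof (rule lp_memI[OF lp_memD(2)[OF x]])
    fix K
    have "(\<Sum>k<K. cmod (shift x k) powr p) \<le> (\<Sum>k<Suc K. cmod (x k) powr p)"
      by (simp add: shift_def sum.lessThan_Suc_shift del: sum.lessThan_Suc)
    also have "\<dots> \<le> ?N x powr p" by (rule lp_memD(1)[OF x])
    finally show "(\<Sum>k<K. cmod (shift x k) powr p) \<le> ?N x powr p" .
  qed
  then show "shift x \<in> vecs (lp_space p)" "?N (shift x) \<le> ?N x" by auto
  have sm: "summable (\<lambda>k. cmod (x k) powr p)" using x by (simp add: lp_space_def)
  have small: "cmod z < e" if "cmod z powr p < e powr p" "e > 0" for z :: complex and e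
    using that p powr_mono2[of p e "cmod z"] by force
  show "x \<longlonglongrightarrow> 0"
  proof (rule LIMSEQ_I)
    fix e :: real assume e: "e > 0"
    then have "e powr p > 0" by simp
    then have "\<forall>\<^sub>F k in sequentially. cmod (x k) powr p < e powr p"
      by (rule order_tendstoD(2)[OF summable_LIMSEQ_zero[OF sm]])
    then show "\<exists>N. \<forall>k\<ge>N. norm (x k - 0) < e"
      using small e by (auto simp: eventually_sequentially)
  qed
  fix e :: real assume e: "e > 0"
  have "(e / 2) powr p > 0" using e by simp
  then obtain N where N: "\<And>n m. m \<ge> N \<Longrightarrow> norm (\<Sum>k=m..<n. cmod (x k) powr p) < (e / 2) powr p"
    using sm unfolding summable_Cauchy by blast
  have "x - (\<lambda>k. if k < N then x k else 0) \<in> vecs (lp_space p)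
      \<and> ?N (x - (\<lambda>k. if k < N then x k else 0)) \<le> e / 2"
  proof (rule lp_memI)
    fix K
    have "(\<Sum>k<K. cmod ((x - (\<lambda>k. if k < N then x k else 0)) k) powr p) = (\<Sum>k=N..<K. cmod (x k) powr p)"
      using p by (intro sum.mono_neutral_cong_right) (auto simp: vec_apply)
    also have "\<dots> \<le> (e / 2) powr p" using N[of N K] by simp
    finally show "(\<Sum>k<K. cmod ((x - (\<lambda>k. if k < N then x k else 0)) k) powr p) \<le> (e / 2) powr p" .
  qed (use e in simp)
  then show "\<exists>N. ?N (x - (\<lambda>k. if k < N then x k else 0)) < e" using e by (intro exI[of _ N]) auto
next
  let ?N = "vnorm (lp_space p)"
  fix \<rho> :: real assume \<rho>: "0 \<le> \<rho>" "\<rho> < 1"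
  \<comment> \<open>Since \<open>(\<rho> ^ k) powr p \<le> \<rho> ^ k\<close>, the p-th power of the
    norm is at most \<open>C powr p\<close> times the geometric sum
    \<open>1 / (1 - \<rho>)\<close>.\<close>
  define K where "K = (1 / (1 - \<rho>)) powr (1 / p)"
  have Kp: "K powr p = 1 / (1 - \<rho>)" using p \<rho> by (simp add: K_def powr_powr)
  have "x \<in> vecs (lp_space p) \<and> ?N x \<le> C * K" if C: "C \<ge> 0" and x: "\<forall>k. cmod (x k) \<le> C * \<rho> ^ k" for x C
  proof (rule lp_memI)
    show "C * K \<ge> 0" using C by (simp add: K_def)
    fix n
    have "(\<Sum>k<n. cmod (x k) powr p) \<le> (\<Sum>k<n. C powr p * \<rho> ^ k)"
    proof (rule sum_mono)
      fix k
      have "cmod (x k) powr p \<le> (C * \<rho> ^ k) powr p" using x p by (intro powr_mono2) auto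
      also have "\<dots> = C powr p * (\<rho> ^ k) powr p" by (rule powr_mult)
      also have "(\<rho> ^ k) powr p \<le> (\<rho> ^ k) powr 1"
        using \<rho> p by (intro powr_mono') (auto intro: power_le_one)
      finally show "cmod (x k) powr p \<le> C powr p * \<rho> ^ k"
        using \<rho> by (simp add: mult_left_mono)
    qed
    also have "\<dots> = C powr p * (\<Sum>k<n. \<rho> ^ k)" by (simp add: sum_distrib_left)
    also have "\<dots> \<le> C powr p * (\<Sum>k. \<rho> ^ k)"
      using \<rho> by (intro mult_left_mono sum_le_suminf summable_geometric) auto
    also have "\<dots> = (C * K) powr p"
      using C \<rho> by (simp add: suminf_geometric powr_mult Kp)
    finally show "(\<Sum>k<n. cmod (x k) powr p) \<le> (C * K) powr p" .
  qed
  then show "\<exists>K. \<forall>x C. C \<ge> 0 \<longrightarrow> (\<forall>k. cmod (x k) \<le> C * \<rho> ^ k) \<longrightarrow> x \<in> vecs (lp_space p) \<and> ?N x \<le> C * K"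
    by blast
qed

end

section \<open>The space c_0\<close>

lemma c0_memI:
  assumes "x \<longlonglongrightarrow> 0" "\<And>k. cmod (x k) \<le> a"
  shows "x \<in> vecs c0_space \<and> vnorm c0_space x \<le> a"
  using assms by (auto simp: c0_space_def intro!: cSUP_least)

lemma c0_memD:
  assumes "x \<in> vecs c0_space"
  shows "x \<longlonglongrightarrow> 0" "cmod (x k) \<le> vnorm c0_space x"
proof -
  show x: "x \<longlonglongrightarrow> 0" using assms by (simp add: c0_space_def)
  have "Bseq x" using x convergentI convergent_imp_Bseq by blast
  then have "bdd_above (range (\<lambda>k. cmod (x k)))" by (elim BseqE) (auto intro: bdd_aboveI2)
  then show "cmod (x k) \<le> vnorm c0_space x" by (simp add: c0_space_def) (rule cSUP_upper, auto)
qed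

lemma c0_scl_le:
  assumes x: "x \<in> vecs c0_space"
  shows "scl c x \<in> vecs c0_space \<and> vnorm c0_space (scl c x) \<le> cmod c * vnorm c0_space x"
proof (rule c0_memI)
  show "scl c x \<longlonglongrightarrow> 0" unfolding scl_def using tendsto_mult_right_zero[OF c0_memD(1)[OF x]] .
  show "cmod (scl c x k) \<le> cmod c * vnorm c0_space x" for k
    using c0_memD(2)[OF x, of k] by (simp add: scl_apply norm_mult mult_left_mono)
qed

lemma c0_seqspace: "seqspace c0_space"
proof
  let ?N = "vnorm c0_space"
  show "0 \<in> vecs c0_space" by (simp add: c0_space_def zero_fun_def)
  fix x assume x: "x \<in> vecs c0_space"
  show xi: "cmod (x i) \<le> ?N x" for i by (rule c0_memD(2)[OF x])
  show "x \<longlonglongrightarrow> 0" by (rule c0_memD(1)[OF x])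
  show sm: "scl c x \<in> vecs c0_space" for c using c0_scl_le[OF x] by blast
  show "?N (scl c x) = cmod c * ?N x" for c
  proof (cases "c = 0")
    case True
    then show ?thesis using c0_scl_le[OF x, of 0] c0_memD(2)[OF sm[of 0], of 0] by (simp add: vec_apply)
  next
    case False
    then have "scl (1 / c) (scl c x) = x" by simp
    then have "?N x \<le> cmod (1 / c) * ?N (scl c x)"
      using c0_scl_le[OF sm[of c], of "1 / c"] by simp
    then have "cmod c * ?N x \<le> ?N (scl c x)" using False by (simp add: norm_divide field_simps)
    then show ?thesis using c0_scl_le[OF x, of c] by simp
  qed
  have "shift x \<in> vecs c0_space \<and> ?N (shift x) \<le> ?N x"
    unfolding shift_def by (rule c0_memI) (auto intro: LIMSEQ_Suc c0_memD x)
  then show "shift x \<in> vecs c0_space" "?N (shift x) \<le> ?N x" by auto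
  show "\<exists>N. ?N (x - (\<lambda>k. if k < N then x k else 0)) < e" if e: "e > 0" for e
  proof -
    obtain N where N: "\<And>k. k \<ge> N \<Longrightarrow> cmod (x k) < e / 2"
      using LIMSEQ_D[OF c0_memD(1)[OF x], of "e / 2"] e by auto
    have "(\<lambda>k. x k - (if k < N then x k else 0)) \<longlonglongrightarrow> 0"
      by (rule Lim_transform_eventually[OF c0_memD(1)[OF x]], rule eventually_sequentiallyI[of N]) auto
    then have "?N (x - (\<lambda>k. if k < N then x k else 0)) \<le> e / 2"
      using N e by (intro conjunct2[OF c0_memI]) (auto simp: fun_diff_def less_imp_le)
    then show ?thesis using e by (intro exI[of _ N]) simp
  qed
  fix y assume y: "y \<in> vecs c0_space"
  have "x + y \<in> vecs c0_space \<and> ?N (x + y) \<le> ?N x + ?N y"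
    unfolding plus_fun_def
  proof (rule c0_memI)
    show "(\<lambda>k. x k + y k) \<longlonglongrightarrow> 0" by (intro tendsto_add_zero c0_memD(1) x y)
    show "cmod (x k + y k) \<le> ?N x + ?N y" for k
      using norm_triangle_ineq[of "x k" "y k"] c0_memD(2)[OF x, of k] c0_memD(2)[OF y, of k] by linarith
  qed
  then show "x + y \<in> vecs c0_space" "?N (x + y) \<le> ?N x + ?N y" by auto
next
  let ?N = "vnorm c0_space"
  fix \<sigma> :: "nat \<Rightarrow> nat \<Rightarrow> complex"
  assume \<sigma>: "\<And>m. \<sigma> m \<in> vecs c0_space"
    and C: "\<And>e. e > 0 \<Longrightarrow> \<exists>N. \<forall>m\<ge>N. \<forall>n\<ge>N. ?N (\<sigma> m - \<sigma> n) < e"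
  have dm: "\<sigma> m - \<sigma> n \<in> vecs c0_space" for m n
    using tendsto_diff[OF c0_memD(1)[OF \<sigma>[of m]] c0_memD(1)[OF \<sigma>[of n]]]
    by (simp add: c0_space_def fun_diff_def)
  have coord: "dist (\<sigma> m k) (\<sigma> n k) \<le> ?N (\<sigma> m - \<sigma> n)" for m n k
    using c0_memD(2)[OF dm, of m n k] by (simp add: dist_norm vec_apply)
  have "Cauchy (\<lambda>m. \<sigma> m k)" for k
    unfolding Cauchy_def using C coord by (meson le_less_trans)
  then have "\<exists>x. \<forall>k. (\<lambda>m. \<sigma> m k) \<longlonglongrightarrow> x k"
    by (intro choice allI) (auto simp: Cauchy_convergent_iff convergent_def)
  then obtain x where x: "\<And>k. (\<lambda>m. \<sigma> m k) \<longlonglongrightarrow> x k" by blast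
  have close: "\<exists>N. \<forall>m\<ge>N. \<forall>k. cmod (\<sigma> m k - x k) \<le> e" if e: "e > 0" for e
  proof -
    obtain N where N: "\<forall>m\<ge>N. \<forall>n\<ge>N. ?N (\<sigma> m - \<sigma> n) < e" using C e by blast
    have "cmod (\<sigma> m k - x k) \<le> e" if m: "m \<ge> N" for m k
    proof (rule LIMSEQ_le_const2)
      show "(\<lambda>n. cmod (\<sigma> m k - \<sigma> n k)) \<longlonglongrightarrow> cmod (\<sigma> m k - x k)" by (intro tendsto_intros x)
      show "\<exists>N. \<forall>n\<ge>N. cmod (\<sigma> m k - \<sigma> n k) \<le> e"
      proof (intro exI[of _ N] allI impI)
        fix k' assume "k' \<ge> N"
        then have "?N (\<sigma> m - \<sigma> k') < e" using N m by blast
        then show "cmod (\<sigma> m k - \<sigma> k' k) \<le> e" using coord[of m k k'] by (simp add: dist_norm)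
      qed
    qed
    then show ?thesis by blast
  qed
  have x0: "x \<longlonglongrightarrow> 0"
  proof (rule LIMSEQ_I)
    fix e :: real assume e: "e > 0"
    obtain m where m: "\<And>k. cmod (\<sigma> m k - x k) \<le> e / 2" using close[of "e / 2"] e by auto
    obtain N where N: "\<And>k. k \<ge> N \<Longrightarrow> cmod (\<sigma> m k) < e / 2"
      using LIMSEQ_D[OF c0_memD(1)[OF \<sigma>[of m]], of "e / 2"] e by auto
    have "cmod (x k) < e" if "k \<ge> N" for k
      using norm_triangle_ineq4[of "\<sigma> m k" "\<sigma> m k - x k"] m[of k] N[OF that] by simp
    then show "\<exists>N. \<forall>k\<ge>N. norm (x k - 0) < e" by auto
  qed
  have "(\<lambda>m. ?N (\<sigma> m - x)) \<longlonglongrightarrow> 0"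
  proof (rule LIMSEQ_I)
    fix r :: real assume r: "r > 0"
    then obtain N where N: "\<forall>m\<ge>N. \<forall>k. cmod (\<sigma> m k - x k) \<le> r / 2" using close[of "r / 2"] by auto
    have "norm (?N (\<sigma> m - x) - 0) < r" if m: "m \<ge> N" for m
    proof -
      have "(\<lambda>k. \<sigma> m k - x k) \<longlonglongrightarrow> 0" using tendsto_diff[OF c0_memD(1)[OF \<sigma>[of m]] x0] by simp
      then have *: "\<sigma> m - x \<in> vecs c0_space \<and> ?N (\<sigma> m - x) \<le> r / 2"
        using N m by (intro c0_memI) (auto simp: fun_diff_def)
      then have "?N (\<sigma> m - x) \<ge> 0" using c0_memD(2)[of "\<sigma> m - x" 0] norm_ge_zero order_trans by blast
      then show ?thesis using * r by simp
    qed
    then show "\<exists>N. \<forall>m\<ge>N. norm (?N (\<sigma> m - x) - 0) < r" by blast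
  qed
  then show "\<exists>x\<in>vecs c0_space. (\<lambda>m. ?N (\<sigma> m - x)) \<longlonglongrightarrow> 0"
    using x0 by (intro bexI[of _ x]) (auto simp: c0_space_def)
next
  let ?N = "vnorm c0_space"
  fix \<rho> :: real assume \<rho>: "0 \<le> \<rho>" "\<rho> < 1"
  have "x \<in> vecs c0_space \<and> ?N x \<le> C * 1" if C: "C \<ge> 0" and x: "\<forall>k. cmod (x k) \<le> C * \<rho> ^ k" for x C
  proof (rule c0_memI)
    have "(\<lambda>k. C * \<rho> ^ k) \<longlonglongrightarrow> 0" using \<rho> by (intro tendsto_mult_right_zero LIMSEQ_realpow_zero) auto
    then show "x \<longlonglongrightarrow> 0" by (rule Lim_null_comparison[rotated]) (use x in auto)
    show "cmod (x k) \<le> C * 1" for k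
      using x mult_left_mono[OF power_le_one[of \<rho> k] C] \<rho> order_trans by (metis less_imp_le)
  qed
  then show "\<exists>K. \<forall>x C. C \<ge> 0 \<longrightarrow> (\<forall>k. cmod (x k) \<le> C * \<rho> ^ k) \<longrightarrow> x \<in> vecs c0_space \<and> ?N x \<le> C * K"
    by blast
qed

section \<open>Finite powers of a space\<close>

lemma curry_simps: "curry (x + y) i = curry x i + curry y i" "curry (x - y) i = curry x i - curry y i"
  "curry (scl c x) i = scl c (curry x i)" "curry 0 i = 0"
  for x y :: "nat \<times> nat \<Rightarrow> complex"
  by (auto simp: fun_eq_iff vec_apply)

lemma power_bfspace:
  fixes X :: "nat fspace"
  assumes "bfspace X"
  shows "bfspace (power_space X n)"
proof -
  interpret X: bfspace X by fact
  let ?V = "power_space X n"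
  have mem: "x \<in> vecs ?V \<longleftrightarrow> (\<forall>i<n. curry x i \<in> vecs X) \<and> (\<forall>i\<ge>n. curry x i = 0)" for x
    by (simp add: power_space_def)
  have nrm: "vnorm ?V x = (\<Sum>i<n. vnorm X (curry x i))" for x by (simp add: power_space_def)
  have comp_le: "vnorm X (curry x i) \<le> vnorm ?V x" if "x \<in> vecs ?V" "i < n" for x i
    unfolding nrm using that X.norm_nonneg by (intro member_le_sum) (auto simp: mem)
  have dmem: "x - y \<in> vecs ?V" if "x \<in> vecs ?V" "y \<in> vecs ?V" for x y
    using that by (auto simp: mem curry_simps)
  show ?thesis
  proof
    show "0 \<in> vecs ?V" by (simp add: mem curry_simps)
    show "x + y \<in> vecs ?V" "vnorm ?V (x + y) \<le> vnorm ?V x + vnorm ?V y"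
      if "x \<in> vecs ?V" "y \<in> vecs ?V" for x y
      using that by (auto simp: mem nrm curry_simps sum.distrib[symmetric] intro!: sum_mono X.norm_triangle)
    show "scl c x \<in> vecs ?V" "vnorm ?V (scl c x) = cmod c * vnorm ?V x" if "x \<in> vecs ?V" for c x
      using that by (auto simp: mem nrm curry_simps sum_distrib_left X.norm_scl)
    show "cmod (x p) \<le> vnorm ?V x" if x: "x \<in> vecs ?V" for x p
    proof (cases "fst p < n")
      case True
      then have "curry x (fst p) \<in> vecs X" using x unfolding mem by blast
      from X.coord_le[OF this, of "snd p"] show ?thesis using comp_le[OF x True] by (simp add: curry_def)
    next
      case False
      then have "curry x (fst p) (snd p) = 0" using x by (simp add: mem vec_apply)
      then show ?thesis unfolding nrm using x X.norm_nonneg by (auto simp: mem intro!: sum_nonneg)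
    qed
    fix \<sigma> :: "nat \<Rightarrow> nat \<times> nat \<Rightarrow> complex" assume \<sigma>: "\<And>m. \<sigma> m \<in> vecs ?V"
      and C: "\<And>e. e > 0 \<Longrightarrow> \<exists>N. \<forall>m\<ge>N. \<forall>k\<ge>N. vnorm ?V (\<sigma> m - \<sigma> k) < e"
    have "\<exists>x\<in>vecs X. (\<lambda>m. vnorm X (curry (\<sigma> m) i - x)) \<longlonglongrightarrow> 0" if i: "i < n" for i
    proof (rule X.complete)
      show "curry (\<sigma> m) i \<in> vecs X" for m using \<sigma>[of m] i by (simp add: mem)
      fix e :: real assume "e > 0"
      then obtain N where N: "\<forall>m\<ge>N. \<forall>k\<ge>N. vnorm ?V (\<sigma> m - \<sigma> k) < e" using C by blast
      have "vnorm X (curry (\<sigma> m) i - curry (\<sigma> k) i) < e" if "m \<ge> N" "k \<ge> N" for m k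
        using comp_le[OF dmem[OF \<sigma> \<sigma>] i, of m k] N that unfolding curry_simps by (meson le_less_trans)
      then show "\<exists>N. \<forall>m\<ge>N. \<forall>k\<ge>N. vnorm X (curry (\<sigma> m) i - curry (\<sigma> k) i) < e" by blast
    qed
    then obtain y where y: "\<And>i. i < n \<Longrightarrow> y i \<in> vecs X"
      "\<And>i. i < n \<Longrightarrow> (\<lambda>m. vnorm X (curry (\<sigma> m) i - y i)) \<longlonglongrightarrow> 0" by metis
    define x where "x = (\<lambda>(i, k). if i < n then y i k else 0)"
    have cx: "curry x i = (if i < n then y i else 0)" for i by (auto simp: x_def fun_eq_iff vec_apply)
    have "(\<lambda>m. \<Sum>i<n. vnorm X (curry (\<sigma> m) i - y i)) \<longlonglongrightarrow> (\<Sum>i<n. 0)"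
      by (intro tendsto_sum y) auto
    then have "(\<lambda>m. vnorm ?V (\<sigma> m - x)) \<longlonglongrightarrow> 0" by (simp add: nrm curry_simps cx)
    moreover have "x \<in> vecs ?V" using y by (auto simp: mem cx)
    ultimately show "\<exists>x\<in>vecs ?V. (\<lambda>m. vnorm ?V (\<sigma> m - x)) \<longlonglongrightarrow> 0" by blast
  qed
qed


section \<open>The functional calculus of the difference operator\<close>

text \<open>Boundedness lets \<open>\<phi>\<close> be applied to the series term by term. The
  vector-valued integral is tested by functionals, so this reduces it to scalar series.\<close>

lemma (in bop) dual_fcalc:
  assumes \<phi>: "\<phi> \<in> topological_dual V" and F: "fps_conv_radius F > ereal M" and x: "x \<in> vecs V"
  shows "(\<lambda>j. fps_nth F j * \<phi> ((T ^^ j) x)) sums \<phi> (fcalc F T x)"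
proof -
  have add: "\<phi> (x + y) = \<phi> x + \<phi> y" if "x \<in> vecs V" "y \<in> vecs V" for x y
    using \<phi> that by (auto simp: topological_dual_def)
  have sc: "\<phi> (scl c x) = c * \<phi> x" if "x \<in> vecs V" for c x
    using \<phi> that by (auto simp: topological_dual_def)
  obtain C where C: "\<And>x. x \<in> vecs V \<Longrightarrow> cmod (\<phi> x) \<le> C * vnorm V x"
    using \<phi> unfolding topological_dual_def by blast
  have zero: "\<phi> 0 = 0" using sc[OF zero_mem, of 0] by simp
  have sum: "\<phi> (\<Sum>j<N. u j) = (\<Sum>j<N. \<phi> (u j))" if "\<And>j. u j \<in> vecs V" for u and N :: nat
    by (induction N) (auto simp: zero add sum_mem that)
  have diff: "\<phi> (x - y) = \<phi> x - \<phi> y" if "x \<in> vecs V" "y \<in> vecs V" for x y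
    using add[of "x - y" y] that by (simp add: diff_mem)
  let ?S = "\<lambda>N. \<Sum>j<N. scl (fps_nth F j) ((T ^^ j) x)"
  have mem: "scl (fps_nth F j) ((T ^^ j) x) \<in> vecs V" for j using pow_mem[OF x] by auto
  then have memS: "?S N \<in> vecs V" for N by (intro sum_mem)
  have "(\<lambda>N. \<phi> (?S N) - \<phi> (fcalc F T x)) \<longlonglongrightarrow> 0"
  proof (rule Lim_null_comparison)
    show "\<forall>\<^sub>F N in sequentially. norm (\<phi> (?S N) - \<phi> (fcalc F T x)) \<le> C * vnorm V (?S N - fcalc F T x)"
      using C[OF diff_mem[OF memS fcalc_mem[OF F x]]] diff[OF memS fcalc_mem[OF F x]] by simp
    show "(\<lambda>N. C * vnorm V (?S N - fcalc F T x)) \<longlonglongrightarrow> 0"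
      by (rule tendsto_mult_right_zero[OF fcalc_lim[OF F x]])
  qed
  then have "(\<lambda>N. \<phi> (?S N)) \<longlonglongrightarrow> \<phi> (fcalc F T x)" by (rule LIM_zero_cancel)
  then show ?thesis unfolding sums_def sum[OF mem] by (simp add: sc pow_mem[OF x])
qed

text \<open>These functionals separate points, which makes the vector described in
  \<open>riesz_dunford\<close> unique.\<close>

lemma (in bfspace) coord_in_dual: "(\<lambda>x. x i) \<in> topological_dual V"
  unfolding topological_dual_def using coord_le by (auto simp: vec_apply intro!: exI[of _ 1])

text \<open>A Neumann series: for \<open>w = 1 + h * z\<close> the resolvent of the difference
  operator at \<open>z\<close> is \<open>h\<close> times the inverse of w - B, where B is the shift,
  that is, the sum of the terms h B^j / w^(j+1).\<close>

definition res_fps :: "real \<Rightarrow> complex \<Rightarrow> complex fps" where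
  "res_fps h w = Abs_fps (\<lambda>j. of_real h / w ^ Suc j)"

lemma res_fps_radius:
  assumes "norm w > 1"
  shows "fps_conv_radius (res_fps h w) > ereal 1"
proof -
  have w: "w \<noteq> 0" using assms by auto
  have "ereal (norm w) \<le> fps_conv_radius (res_fps h w)"
    unfolding fps_conv_radius_def
  proof (rule conv_radius_geI_ex)
    fix r :: real assume r: "0 < r" "ereal r < ereal (norm w)"
    have "summable (\<lambda>n. of_real h / w * (of_real r / w) ^ n)"
      using r w by (intro summable_mult summable_geometric) (simp add: norm_divide)
    then have "summable (\<lambda>n. fps_nth (res_fps h w) n * of_real r ^ n)"
      by (rule summable_cong[THEN iffD1, rotated]) (simp add: res_fps_def power_divide)
    then show "\<exists>z. cmod z = r \<and> summable (\<lambda>n. fps_nth (res_fps h w) n * z ^ n)"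
      using r by (intro exI[of _ "of_real r"]) simp
  qed
  moreover have "ereal 1 < ereal (norm w)" using assms by simp
  ultimately show ?thesis by (rule less_le_trans[rotated])
qed

lemma res_fps_inverse:
  assumes "w \<noteq> 0" "h \<noteq> 0"
  shows "res_fps h w * (fps_const (w / of_real h) - fps_const (1 / of_real h) * fps_X) = 1"
proof (rule fps_ext)
  fix n
  have "res_fps h w * (fps_const (w / of_real h) - fps_const (1 / of_real h) * fps_X)
    = res_fps h w * fps_const (w / of_real h) - (res_fps h w * fps_X) * fps_const (1 / of_real h)"
    by (simp only: right_diff_distrib mult_ac)
  then have "fps_nth (res_fps h w * (fps_const (w / of_real h) - fps_const (1 / of_real h) * fps_X)) n
    = fps_nth (res_fps h w) n * (w / of_real h)
      - (if n = 0 then 0 else fps_nth (res_fps h w) (n - 1)) * (1 / of_real h)"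
    by (simp only: fps_sub_nth fps_mult_right_const_nth fps_X_mult_right_nth)
  also have "\<dots> = fps_nth 1 n"
    using assms by (cases n) (auto simp: res_fps_def)
  finally show "fps_nth (res_fps h w * (fps_const (w / of_real h) - fps_const (1 / of_real h) * fps_X)) n
    = fps_nth 1 n" .
qed

lemma mem_disc_iff:
  fixes z :: complex
  assumes "h > 0"
  shows "z \<in> cball (- 1 / of_real h) (1 / h) \<longleftrightarrow> norm (1 + of_real h * z) \<le> 1"
    and "z \<in> ball (- 1 / of_real h) (1 / h) \<longleftrightarrow> norm (1 + of_real h * z) < 1"
proof -
  have "1 + of_real h * z = of_real h * (z - (- 1 / of_real h))"
    using assms by (simp add: field_simps)
  then have "norm (1 + of_real h * z) = h * dist (- 1 / of_real h) z"
    using assms dist_norm[of z "- 1 / of_real h"] by (simp only: norm_mult norm_of_real dist_commute)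
  then show "z \<in> cball (- 1 / of_real h) (1 / h) \<longleftrightarrow> norm (1 + of_real h * z) \<le> 1"
    "z \<in> ball (- 1 / of_real h) (1 / h) \<longleftrightarrow> norm (1 + of_real h * z) < 1"
    unfolding mem_cball mem_ball using assms by (auto simp: le_divide_eq less_divide_eq mult.commute)
qed

text \<open>A function is given on some neighbourhood of the closed disc. A larger concentric disc
  is what gives its Taylor series in \<open>w\<close> a radius of convergence greater than
  1.\<close>

lemma ball_subset_open:
  fixes c :: complex
  assumes U: "open U" "cball c r \<subseteq> U" and r: "r \<ge> 0"
  obtains R where "R > r" "ball c R \<subseteq> U"
proof -
  obtain e where e: "e > 0" "(\<Union>x\<in>cball c r. ball x e) \<subseteq> U"
    using compact_subset_open_imp_ball_epsilon_subset[OF compact_cball U] by blast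
  have "ball c (r + e) \<subseteq> U"
  proof
    fix z assume z: "z \<in> ball c (r + e)"
    show "z \<in> U"
    proof (cases "z \<in> cball c r")
      case False
      then have d: "dist c z > r" by simp
      then have d0: "dist c z > 0" using r by linarith
      \<comment> \<open>The radial projection of \<open>z\<close> onto the boundary circle.\<close>
      define x where "x = c + (r / dist c z) *\<^sub>R (z - c)"
      have "x \<in> cball c r" using r d0 by (simp add: x_def dist_norm norm_minus_commute)
      moreover have "z - x = (1 - r / dist c z) *\<^sub>R (z - c)" by (simp add: x_def algebra_simps)
      then have "dist x z = (1 - r / dist c z) * dist c z"
        using d d0 by (simp add: dist_norm norm_minus_commute[of x z] norm_minus_commute[of z c])
      then have "dist x z < e" using z d0 by (simp add: field_simps)
      ultimately have "z \<in> (\<Union>x\<in>cball c r. ball x e)" by auto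
      then show ?thesis using e by blast
    qed (use U in auto)
  qed
  then show ?thesis using e that[of "r + e"] by simp
qed

lemma holomorphic_disc_coordinate:
  assumes h: "h > 0" and f: "f holomorphic_on ball (- 1 / of_real h) R"
  shows "(\<lambda>w. f ((w - 1) / of_real h)) holomorphic_on ball 0 (h * R)"
proof -
  define c where "c = - 1 / complex_of_real h"
  have "(\<lambda>w. (w - 1) / complex_of_real h) ` ball 0 (h * R) \<subseteq> ball c R"
  proof safe
    fix v :: complex assume v: "v \<in> ball 0 (h * R)"
    have "(v - 1) / of_real h - c = v / of_real h" by (simp add: c_def diff_divide_distrib)
    then have "dist c ((v - 1) / of_real h) = norm v / h"
      using h dist_norm[of "(v - 1) / of_real h" c] by (simp add: norm_divide dist_commute)
    then show "(v - 1) / of_real h \<in> ball c R" using v h by (simp add: pos_divide_less_eq mult.commute)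
  qed
  then have "f \<circ> (\<lambda>w. (w - 1) / complex_of_real h) holomorphic_on ball 0 (h * R)"
    using h f unfolding c_def
    by (intro holomorphic_on_compose_gen[of _ _ _ "ball (- 1 / of_real h) R"] holomorphic_intros) auto
  then show ?thesis by (simp add: o_def)
qed

context seqspace
begin

lemma bop_shift: "bop X shift 1"
proof
  show "shift (x + y) = shift x + shift y" "shift (scl c x) = scl c (shift x)" for x y c
    by (auto simp: fun_eq_iff vec_apply shift_apply)
qed (use shift_mem shift_norm in auto)

sublocale B: bop X shift 1
  by (rule bop_shift)

lemma geometric_vec:
  assumes "norm w < 1"
  shows "(\<lambda>k. w ^ k) \<in> vecs X"
proof -
  obtain K where "\<forall>x C. C \<ge> 0 \<longrightarrow> (\<forall>k. norm (x k) \<le> C * norm w ^ k) \<longrightarrow> x \<in> vecs X \<and> vnorm X x \<le> C * K"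
    using geometric[of "norm w"] assms by auto
  from this[rule_format, of 1 "\<lambda>k. w ^ k"] show ?thesis by (simp add: norm_power)
qed

lemma resolvent_eq:
  assumes h: "h > 0" and x: "x \<in> vecs X"
  defines "w \<equiv> \<lambda>z. 1 + of_real h * z"
  shows "scl z x - forward_diff h x = fcalc (fps_const (w z / of_real h) - fps_const (1 / of_real h) * fps_X) shift x"
proof -
  have c1: "fps_conv_radius (fps_const (a :: complex)) > ereal 1" "fps_conv_radius (fps_X :: complex fps) > ereal 1" for a
    by simp_all
  have c2: "fps_conv_radius (fps_const (a :: complex) * fps_X) > ereal 1" for a
    using fps_conv_radius_mult[of "fps_const a" fps_X] by simp
  show ?thesis
    using h by (simp add: B.fcalc_diff[OF c1(1) c2 x] B.fcalc_mult[OF c1 x] fcalc_const fcalc_X)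
      (simp add: fun_eq_iff vec_apply forward_diff_def shift_apply w_def field_simps)
qed

text \<open>\<open>res_fps\<close> and the linear series of z - \<Delta> are inverse to each other
  and the calculus is multiplicative, so the operators are inverse as well; the lower bound is the
  norm bound of the inverse.\<close>

lemma resolvent:
  assumes h: "h > 0" and w: "norm (1 + of_real h * z) > 1"
  shows "bij_betw (\<lambda>x. scl z x - forward_diff h x) (vecs X) (vecs X)"
    and "\<exists>C. \<forall>x\<in>vecs X. vnorm X x \<le> C * vnorm X (scl z x - forward_diff h x)"
    and "x \<in> vecs X \<Longrightarrow> op_resolvent X (forward_diff h) z x = fcalc (res_fps h (1 + of_real h * z)) shift x"
proof -
  define w' where "w' = 1 + of_real h * z"
  define L where "L = fps_const (w' / of_real h) - fps_const (1 / of_real h) * fps_X"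
  define R where "R = res_fps h w'"
  have cL: "fps_conv_radius L > ereal 1"
  proof -
    have "fps_conv_radius (fps_const (1 / complex_of_real h) * fps_X) = \<infinity>"
      using fps_conv_radius_mult[of "fps_const (1 / complex_of_real h)" fps_X] by simp
    then show ?thesis
      using fps_conv_radius_diff[of "fps_const (w' / of_real h)" "fps_const (1 / of_real h) * fps_X"] by (simp add: L_def)
  qed
  have cR: "fps_conv_radius R > ereal 1" unfolding R_def by (rule res_fps_radius) (use w w'_def in simp)
  have "w' \<noteq> 0" using w by (auto simp: w'_def)
  then have RL: "R * L = 1" unfolding R_def L_def using h by (intro res_fps_inverse) auto
  have LR: "L * R = 1" using RL by (simp add: mult.commute)
  have eq: "scl z x - forward_diff h x = fcalc L shift x" if "x \<in> vecs X" for x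
    using resolvent_eq[OF h that, of z] by (simp add: L_def w'_def)
  have inv1: "fcalc R shift (scl z x - forward_diff h x) = x" if "x \<in> vecs X" for x
    unfolding eq[OF that] using B.fcalc_mult[OF cR cL that] by (simp add: RL fcalc_1)
  have mR: "fcalc R shift x \<in> vecs X" if "x \<in> vecs X" for x by (rule B.fcalc_mem[OF cR that])
  have inv2: "scl z (fcalc R shift x) - forward_diff h (fcalc R shift x) = x" if "x \<in> vecs X" for x
    unfolding eq[OF mR[OF that]] using B.fcalc_mult[OF cL cR that] by (simp add: LR fcalc_1)
  have mL: "scl z x - forward_diff h x \<in> vecs X" if "x \<in> vecs X" for x
    unfolding eq[OF that] by (rule B.fcalc_mem[OF cL that])
  show bij: "bij_betw (\<lambda>x. scl z x - forward_diff h x) (vecs X) (vecs X)"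
    by (rule bij_betwI[where g = "fcalc R shift"]) (use inv1 inv2 mR mL in auto)
  show "\<exists>C. \<forall>x\<in>vecs X. vnorm X x \<le> C * vnorm X (scl z x - forward_diff h x)"
    using B.fcalc_bound[OF cR mL] inv1 by metis
  show "op_resolvent X (forward_diff h) z x = fcalc (res_fps h (1 + of_real h * z)) shift x" if x: "x \<in> vecs X"
    unfolding op_resolvent_def
    using inv_into_f_eq[where f = "\<lambda>x. scl z x - forward_diff h x", OF bij_betw_imp_inj_on[OF bij] mR[OF x] inv2[OF x]]
    by (simp add: R_def w'_def)
qed

text \<open>Outside the closed disc the Neumann series converges. On the disc the lower bound in the
  definition of the spectrum fails: geometric sequences with ratio \<open>r * w\<close> and
  \<open>r\<close> close to 1 are approximate eigenvectors. This treats the interior together with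
  the boundary, where no eigenvectors exist.\<close>

lemma spectrum_forward_diff:
  assumes h: "h > 0"
  shows "op_spectrum X (forward_diff h) = cball (- 1 / of_real h) (1 / h)"
proof (intro equalityI subsetI)
  fix z assume "z \<in> op_spectrum X (forward_diff h)"
  then have "\<not> norm (1 + of_real h * z) > 1"
    using resolvent(1,2)[OF h, of z] by (auto simp: op_spectrum_def)
  then show "z \<in> cball (- 1 / of_real h) (1 / h)" unfolding mem_disc_iff[OF h] by simp
next
  fix z assume "z \<in> cball (- 1 / complex_of_real h) (1 / h)"
  then have w1: "norm (1 + of_real h * z) \<le> 1" unfolding mem_disc_iff[OF h] .
  define w where "w = 1 + of_real h * z"
  have "False" if C: "\<forall>x\<in>vecs X. vnorm X x \<le> C * vnorm X (scl z x - forward_diff h x)" for C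
  proof -
    \<comment> \<open>Chosen so that \<open>norm w * (1 - r) / h\<close> is at most
      \<open>1 / (2 * (\<bar>C\<bar> + 1))\<close>, too small for the supposed lower bound; the
      maximum keeps \<open>r\<close> nonnegative.\<close>
    define r where "r = max 0 (1 - h / (2 * (\<bar>C\<bar> + 1)))"
    have r: "0 \<le> r" "r < 1" "1 - r \<le> h / (2 * (\<bar>C\<bar> + 1))" using h by (auto simp: r_def)
    define e where "e = (\<lambda>k. (of_real r * w) ^ k)"
    have "norm (of_real r * w) \<le> r * 1"
      using r w1 unfolding norm_mult by (intro mult_mono) (auto simp: w_def)
    then have "norm (of_real r * w) < 1" using r by simp
    then have e: "e \<in> vecs X" unfolding e_def by (rule geometric_vec)
    have "cmod (e 0) \<le> vnorm X e" by (rule coord_le[OF e])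
    then have ne: "vnorm X e \<ge> 1" by (simp add: e_def)
    have "scl z e - forward_diff h e = scl (w * of_real (1 - r) / of_real h) e"
      using h by (simp add: fun_eq_iff vec_apply forward_diff_def e_def w_def field_simps)
    then have "vnorm X (scl z e - forward_diff h e) = norm w * (1 - r) / h * vnorm X e"
      using h r by (simp add: norm_scl[OF e] norm_mult norm_divide del: of_real_diff)
    also have "\<dots> \<le> 1 * (1 - r) / h * vnorm X e"
      using w1 r h ne by (intro mult_right_mono divide_right_mono) (auto simp: w_def)
    also have "\<dots> \<le> (h / (2 * (\<bar>C\<bar> + 1))) / h * vnorm X e"
      using r h ne by (intro mult_right_mono divide_right_mono) auto
    also have "\<dots> = vnorm X e / (2 * (\<bar>C\<bar> + 1))" using h by simp
    finally have 1: "vnorm X (scl z e - forward_diff h e) \<le> vnorm X e / (2 * (\<bar>C\<bar> + 1))" .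
    have m: "scl z e - forward_diff h e \<in> vecs X"
      unfolding \<open>scl z e - forward_diff h e = _\<close> using e by auto
    have "vnorm X e \<le> \<bar>C\<bar> * vnorm X (scl z e - forward_diff h e)"
      using C e norm_nonneg[OF m] by (meson abs_ge_self mult_right_mono order_trans)
    also have "\<dots> \<le> \<bar>C\<bar> * (vnorm X e / (2 * (\<bar>C\<bar> + 1)))" by (intro mult_left_mono 1) simp
    also have "\<dots> < vnorm X e" using ne by (simp add: field_simps add_nonneg_pos)
    finally show False by simp
  qed
  then show "z \<in> op_spectrum X (forward_diff h)" unfolding op_spectrum_def by blast
qed

text \<open>The Neumann series of the resolvent is integrated term by term. As
  \<open>w z = h * (z - c)\<close>, the j-th term has denominator \<open>(z - c) ^ Suc j\<close>,
  and Cauchy's formula turns it into the j-th Taylor coefficient in the variable \<open>w\<close>.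
  The value is the same for all admissible \<open>U\<close> and \<open>\<gamma>\<close>.\<close>

lemma riesz_dunford_integral:
  assumes h: "h > 0" and U: "open U" "cball (- 1 / of_real h) (1 / h) \<subseteq> U" and f: "f holomorphic_on U"
    and \<gamma>: "surrounds_within \<gamma> (cball (- 1 / of_real h) (1 / h)) U"
    and \<phi>: "\<phi> \<in> topological_dual X" and x: "x \<in> vecs X"
  shows "((\<lambda>z. f z * \<phi> (op_resolvent X (forward_diff h) z x)) has_contour_integral
    2 * pi * \<i> * \<phi> (fcalc (fps_expansion (\<lambda>w. f ((w - 1) / of_real h)) 0) shift x)) \<gamma>"
proof -
  define c where "c = - 1 / complex_of_real h"
  define w where "w z = 1 + of_real h * z" for z :: complex
  have wc: "w z = of_real h * (z - c)" for z using h by (simp add: w_def c_def field_simps)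
  have cU: "c \<in> U" using U h by (auto simp: c_def)
  have vp: "valid_path \<gamma>" "pathfinish \<gamma> = pathstart \<gamma>" "path_image \<gamma> \<subseteq> U - cball c (1 / h)"
    "winding_number \<gamma> c = 1" "\<And>z. z \<notin> U \<Longrightarrow> winding_number \<gamma> z = 0"
    using \<gamma> h unfolding surrounds_within_def c_def[symmetric] by auto
  define g where "g = (\<lambda>w. f ((w - 1) / of_real h))"
  define F where "F = fps_expansion g 0"
  obtain R where R: "R > 1 / h" "ball c R \<subseteq> U"
    using ball_subset_open[OF U] h unfolding c_def by (metis divide_nonneg_pos zero_le_one)
  have hR: "h * R > 1" using R h by (simp add: field_simps)
  have gh: "g holomorphic_on ball 0 (h * R)"
    unfolding g_def using holomorphic_disc_coordinate[OF h] holomorphic_on_subset[OF f R(2)] by (simp add: c_def)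
  have cF: "fps_conv_radius F > ereal 1"
  proof -
    have "ereal (h * R) \<le> fps_conv_radius F"
      unfolding F_def using gh by (intro conv_radius_fps_expansion) simp
    then show ?thesis using hR by (meson ereal_less(3) less_ereal.simps(1) less_le_trans)
  qed
  have Fn: "fps_nth F j = (deriv ^^ j) f c / fact j / of_real h ^ j" for j
  proof -
    have "g = (\<lambda>v. f (1 / of_real h * v + c))" by (simp add: g_def c_def diff_divide_distrib)
    moreover have "(deriv ^^ j) (\<lambda>v. f (1 / of_real h * v + c)) 0 = (1 / of_real h) ^ j * (deriv ^^ j) f (1 / of_real h * 0 + c)"
    proof (rule higher_deriv_compose_linear'[OF f, of "ball 0 (h * R)"])
      show "1 / of_real h * v + c \<in> U" if v: "v \<in> ball 0 (h * R)" for v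
      proof -
        have "1 / of_real h * v + c \<in> ball c R"
          using v h by (simp add: dist_norm norm_divide field_simps)
        then show ?thesis using R by blast
      qed
    qed (use U hR in auto)
    ultimately show ?thesis by (simp add: F_def fps_expansion_def power_divide)
  qed
  define a where "a j = \<phi> ((shift ^^ j) x)" for j
  obtain C where C: "\<And>x. x \<in> vecs X \<Longrightarrow> cmod (\<phi> x) \<le> C * vnorm X x"
    using \<phi> unfolding topological_dual_def by blast
  define A where "A = \<bar>C\<bar> * vnorm X x"
  have A: "cmod (a j) \<le> A" for j
  proof -
    have m: "(shift ^^ j) x \<in> vecs X" by (rule B.pow_mem[OF x])
    have "cmod (a j) \<le> \<bar>C\<bar> * vnorm X ((shift ^^ j) x)"
      unfolding a_def using C[OF m] norm_nonneg[OF m] by (meson abs_ge_self mult_right_mono order_trans)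
    also have "\<dots> \<le> A" unfolding A_def using B.pow_bound[OF x, of j] by (intro mult_left_mono) auto
    finally show ?thesis .
  qed
  have A0: "A \<ge> 0" using A[of 0] norm_ge_zero order_trans by blast
  have res: "(\<lambda>j. of_real h / w z ^ Suc j * a j) sums \<phi> (op_resolvent X (forward_diff h) z x)" if "norm (w z) > 1" for z
    using B.dual_fcalc[OF \<phi> res_fps_radius[OF that] x, of h] that resolvent(3)[OF h _ x, of z]
    by (simp add: res_fps_def a_def w_def)
  define H where "H z = \<phi> (op_resolvent X (forward_diff h) z x)" for z
  define P where "P N z = (\<Sum>j<N. f z * (of_real h / w z ^ Suc j * a j))" for N z
  have compact: "compact (path_image \<gamma>)" "path_image \<gamma> \<noteq> {}" using vp(1) by (auto simp: compact_valid_path_image)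
  have w_gt: "norm (w z) > 1" if "z \<in> path_image \<gamma>" for z
    using vp(3) that mem_disc_iff(1)[OF h, of z] unfolding w_def c_def by auto
  obtain z1 where z1: "z1 \<in> path_image \<gamma>" "\<And>z. z \<in> path_image \<gamma> \<Longrightarrow> norm (w z1) \<le> norm (w z)"
    using continuous_attains_inf[OF compact, of "\<lambda>z. norm (w z)"] unfolding w_def by (force intro!: continuous_intros)
  \<comment> \<open>Halfway between 1 and the minimum of \<open>norm (w z)\<close> on the path, so
    that the Neumann series is dominated by a geometric series on an open set around the
    path.\<close>
  define \<rho> where "\<rho> = (1 + norm (w z1)) / 2"
  have \<rho>: "\<rho> > 1" "\<And>z. z \<in> path_image \<gamma> \<Longrightarrow> norm (w z) > \<rho>"
    using w_gt[OF z1(1)] z1(2) by (auto simp: \<rho>_def) (smt (verit) field_sum_of_halves)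
  have fc: "continuous_on U f" by (rule holomorphic_on_imp_continuous_on[OF f])
  have "continuous_on (path_image \<gamma>) (\<lambda>z. norm (f z))"
    using vp(3) by (intro continuous_intros continuous_on_subset[OF fc]) auto
  then obtain z2 where z2: "\<And>z. z \<in> path_image \<gamma> \<Longrightarrow> norm (f z) \<le> norm (f z2)"
    using continuous_attains_sup[OF compact] by blast
  \<comment> \<open>The summand 1 makes the bound on \<open>f\<close> strict, so that it defines an
    open set containing the path.\<close>
  define D where "D = norm (f z2) + 1"
  have D0: "D \<ge> 0" by (simp add: D_def)
  define S where "S = (f -` ball 0 D \<inter> U) \<inter> (w -` (- cball 0 \<rho>))"
  have wcont: "continuous_on UNIV w" unfolding w_def by (intro continuous_intros)
  have S: "open S"
    unfolding S_def
    by (intro open_Int continuous_on_open_vimage[OF U(1), THEN iffD1, rule_format] fc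
        open_vimage[OF _ wcont]) auto
  have SU: "S \<subseteq> U" "\<And>z. z \<in> S \<Longrightarrow> norm (w z) > \<rho>" "\<And>z. z \<in> S \<Longrightarrow> norm (f z) < D"
    by (auto simp: S_def)
  have pS: "path_image \<gamma> \<subseteq> S"
    using vp(3) \<rho>(2) z2 by (fastforce simp: S_def D_def)
  have w0: "w z \<noteq> 0" if "z \<in> S" for z using SU(2)[OF that] \<rho> by auto
  define E where "E j = D * (h / \<rho> ^ Suc j * A)" for j
  have bound: "norm (f z * (of_real h / w z ^ Suc j * a j)) \<le> E j" if z: "z \<in> S" for z j
  proof -
    have "norm (of_real h / w z ^ Suc j) \<le> h / \<rho> ^ Suc j"
    proof -
      have "\<rho> ^ Suc j \<le> norm (w z) ^ Suc j" "\<rho> ^ Suc j > 0"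
        using \<rho> SU(2)[OF z] by (auto intro!: power_mono simp del: power_Suc)
      then show ?thesis
        using h by (simp add: norm_divide norm_power frac_le del: power_Suc)
    qed
    then show ?thesis
      unfolding E_def norm_mult using A[of j] SU(3)[OF z] h \<rho> A0 D0
      by (intro mult_mono) (auto intro: less_imp_le)
  qed
  have smE: "summable E"
  proof -
    have "summable (\<lambda>j. D * (h / \<rho> * A) * (1 / \<rho>) ^ j)"
      using \<rho> by (intro summable_mult summable_geometric) simp
    then show ?thesis by (rule summable_cong[THEN iffD1, rotated]) (simp add: E_def power_divide)
  qed
  have lim: "(\<Sum>j. f z * (of_real h / w z ^ Suc j * a j)) = f z * H z" if "z \<in> S" for z
    using sums_mult[OF res[of z], of "f z"] SU(2)[OF that] \<rho> by (simp add: sums_iff H_def)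
  have "uniform_limit S P (\<lambda>z. \<Sum>j. f z * (of_real h / w z ^ Suc j * a j)) sequentially"
    unfolding P_def by (rule Weierstrass_m_test[OF bound smE])
  then have ul: "uniform_limit S P (\<lambda>z. f z * H z) sequentially"
    by (rule uniform_limit_cong'[THEN iffD1, rotated 2], intro refl) (erule lim)
  have Phol: "P N holomorphic_on S" for N
    unfolding P_def w_def
    by (intro holomorphic_intros holomorphic_on_subset[OF f SU(1)]) (use w0 w_def in auto)
  have fH: "(\<lambda>z. f z * H z) holomorphic_on S"
  proof (rule holomorphic_uniform_sequence[OF S Phol])
    fix z assume "z \<in> S"
    then obtain d where d: "d > 0" "cball z d \<subseteq> S" using S open_contains_cball by blast
    then show "\<exists>d>0. cball z d \<subseteq> S \<and> uniform_limit (cball z d) P (\<lambda>z. f z * H z) sequentially"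
      using uniform_limit_on_subset[OF ul] by blast
  qed
  txt \<open>A valid path may have infinite length; the following bound only holds for integrands
    holomorphic on a neighbourhood of its image.\<close>
  obtain L where L: "L > 0" "\<And>u B. u holomorphic_on S \<Longrightarrow> (\<forall>z\<in>S. norm (u z) \<le> B) \<Longrightarrow> norm (contour_integral \<gamma> u) \<le> L * B"
    using contour_integral_bound_exists[OF S vp(1) pS] by blast
  have ciH: "(\<lambda>z. f z * H z) contour_integrable_on \<gamma>" and ciP: "P N contour_integrable_on \<gamma>" for N
    using contour_integrable_holomorphic_simple[OF _ S vp(1) pS] fH Phol by blast+
  have intP: "contour_integral \<gamma> (P N) = 2 * pi * \<i> * (\<Sum>j<N. fps_nth F j * a j)" for N
  proof -
    have "(P N has_contour_integral (\<Sum>j<N. 2 * pi * \<i> * winding_number \<gamma> c * ((deriv ^^ j) f c / fact j)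
        * (of_real h / of_real h ^ Suc j * a j))) \<gamma>"
    proof -
      have "((\<lambda>z. \<Sum>j<N. f z / (z - c) ^ Suc j * (of_real h / of_real h ^ Suc j * a j)) has_contour_integral
          (\<Sum>j<N. 2 * pi * \<i> * winding_number \<gamma> c * ((deriv ^^ j) f c / fact j)
            * (of_real h / of_real h ^ Suc j * a j))) \<gamma>"
        using vp cU h by (intro has_contour_integral_sum has_contour_integral_rmul
            has_contour_integral_div_power[OF f U(1)]) auto
      moreover have "P N = (\<lambda>z. \<Sum>j<N. f z / (z - c) ^ Suc j * (of_real h / of_real h ^ Suc j * a j))"
        unfolding P_def wc power_mult_distrib by (intro ext sum.cong refl) (simp add: divide_simps)
      ultimately show ?thesis by simp
    qed
    then show ?thesis
      using h by (simp add: contour_integral_unique vp(4) Fn sum_distrib_left mult_ac)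
  qed
  have "(\<lambda>N. contour_integral \<gamma> (P N) - contour_integral \<gamma> (\<lambda>z. f z * H z)) \<longlonglongrightarrow> 0"
  proof (rule LIMSEQ_I)
    fix r :: real assume r: "r > 0"
    then have "r / (2 * L) > 0" using L by simp
    then obtain N where N: "\<And>n z. n \<ge> N \<Longrightarrow> z \<in> S \<Longrightarrow> dist (P n z) (f z * H z) < r / (2 * L)"
      using ul unfolding uniform_limit_sequentially_iff by blast
    have "norm (contour_integral \<gamma> (P n) - contour_integral \<gamma> (\<lambda>z. f z * H z) - 0) < r" if n: "n \<ge> N" for n
    proof -
      have "norm (contour_integral \<gamma> (\<lambda>z. P n z - f z * H z)) \<le> L * (r / (2 * L))"
        using N[OF n] by (intro L(2) holomorphic_intros Phol fH) (auto simp: dist_norm less_imp_le)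
      also have "\<dots> < r" using L r by simp
      finally show ?thesis using contour_integral_diff[OF ciP ciH] by simp
    qed
    then show "\<exists>N. \<forall>n\<ge>N. norm (contour_integral \<gamma> (P n) - contour_integral \<gamma> (\<lambda>z. f z * H z) - 0) < r" by blast
  qed
  then have "(\<lambda>N. contour_integral \<gamma> (P N)) \<longlonglongrightarrow> contour_integral \<gamma> (\<lambda>z. f z * H z)" by (rule LIM_zero_cancel)
  moreover have "(\<lambda>N. contour_integral \<gamma> (P N)) \<longlonglongrightarrow> 2 * pi * \<i> * \<phi> (fcalc F shift x)"
    unfolding intP using B.dual_fcalc[OF \<phi> cF x] by (intro tendsto_intros) (simp add: sums_def a_def)
  ultimately have "contour_integral \<gamma> (\<lambda>z. f z * H z) = 2 * pi * \<i> * \<phi> (fcalc F shift x)"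
    by (rule LIMSEQ_unique)
  then show ?thesis
    using has_contour_integral_integral[OF ciH] by (simp add: H_def F_def g_def)
qed

text \<open>A circle of radius between \<open>1 / h\<close> and \<open>R\<close> shows that the
  described vector exists. It is unique because every admissible path gives the same integrals and
  the coordinate functionals separate points.\<close>

theorem riesz_dunford_eq:
  assumes h: "h > 0" and f: "f analytic_on cball (- 1 / of_real h) (1 / h)" and x: "x \<in> vecs X"
  shows "riesz_dunford X (forward_diff h) f x = fcalc (fps_expansion (\<lambda>w. f ((w - 1) / of_real h)) 0) shift x"
    and "fps_conv_radius (fps_expansion (\<lambda>w. f ((w - 1) / of_real h)) 0) > ereal 1"
proof -
  define c where "c = - 1 / complex_of_real h"
  obtain U0 where U0: "open U0" "cball c (1 / h) \<subseteq> U0" "f holomorphic_on U0"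
    using f unfolding analytic_on_holomorphic c_def by blast
  obtain R where R: "R > 1 / h" "ball c R \<subseteq> U0"
    using ball_subset_open[OF U0(1,2)] h by (metis divide_nonneg_pos zero_le_one)
  have fR: "f holomorphic_on ball c R" using U0(3) R holomorphic_on_subset by blast
  define r where "r = (1 / h + R) / 2"
  have r: "1 / h < r" "r < R" "r > 0" using R h by (auto simp: r_def add_pos_pos field_simps)
  have sub: "cball c (1 / h) \<subseteq> ball c R" using R by auto
  have sur: "surrounds_within (circlepath c r) (cball c (1 / h)) (ball c R)"
    unfolding surrounds_within_def
  proof (intro conjI ballI allI impI)
    show "path_image (circlepath c r) \<subseteq> ball c R - cball c (1 / h)"
      using r by (auto simp: path_image_circlepath)
    show "winding_number (circlepath c r) z = 1" if "z \<in> cball c (1 / h)" for z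
      using that r by (intro winding_number_circlepath) (auto simp: dist_norm norm_minus_commute)
    show "winding_number (circlepath c r) z = 0" if "z \<notin> ball c R" for z
      by (rule winding_number_zero_outside[of _ "cball c r"]) (use r that in \<open>auto simp: path_image_circlepath\<close>)
  qed auto
  define F where "F = fps_expansion (\<lambda>w. f ((w - 1) / of_real h)) 0"
  have gh: "(\<lambda>w. f ((w - 1) / of_real h)) holomorphic_on ball 0 (h * R)"
    using holomorphic_disc_coordinate[OF h] fR by (simp add: c_def)
  have hR: "h * R > 1" using R h by (simp add: field_simps)
  have "ereal (h * R) \<le> fps_conv_radius F"
    unfolding F_def using gh by (intro conv_radius_fps_expansion) simp
  then show cF: "fps_conv_radius (fps_expansion (\<lambda>w. f ((w - 1) / of_real h)) 0) > ereal 1"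
    unfolding F_def using hR by (meson less_ereal.simps(1) less_le_trans)
  have spec: "op_spectrum X (forward_diff h) = cball c (1 / h)"
    unfolding c_def by (rule spectrum_forward_diff[OF h])
  note int = riesz_dunford_integral[OF h, folded c_def]
  show "riesz_dunford X (forward_diff h) f x = fcalc (fps_expansion (\<lambda>w. f ((w - 1) / of_real h)) 0) shift x"
    unfolding riesz_dunford_def spec F_def[symmetric]
  proof (rule the_equality)
    show "fcalc F shift x \<in> vecs X \<and> (\<exists>U \<gamma>. open U \<and> cball c (1 / h) \<subseteq> U \<and> f holomorphic_on U \<and>
        surrounds_within \<gamma> (cball c (1 / h)) U \<and>
        (\<forall>\<phi>\<in>topological_dual X. ((\<lambda>z. f z * \<phi> (op_resolvent X (forward_diff h) z x))
          has_contour_integral 2 * pi * \<i> * \<phi> (fcalc F shift x)) \<gamma>))"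
      using B.fcalc_mem[OF cF x] int[OF open_ball sub fR sur _ x] sub fR sur unfolding F_def by blast
  next
    fix y assume y: "y \<in> vecs X \<and> (\<exists>U \<gamma>. open U \<and> cball c (1 / h) \<subseteq> U \<and> f holomorphic_on U \<and>
        surrounds_within \<gamma> (cball c (1 / h)) U \<and>
        (\<forall>\<phi>\<in>topological_dual X. ((\<lambda>z. f z * \<phi> (op_resolvent X (forward_diff h) z x))
          has_contour_integral 2 * pi * \<i> * \<phi> y) \<gamma>))"
    then obtain U \<gamma> where U: "open U" "cball c (1 / h) \<subseteq> U" "f holomorphic_on U"
      "surrounds_within \<gamma> (cball c (1 / h)) U"
      "\<And>\<phi>. \<phi> \<in> topological_dual X \<Longrightarrow> ((\<lambda>z. f z * \<phi> (op_resolvent X (forward_diff h) z x))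
          has_contour_integral 2 * pi * \<i> * \<phi> y) \<gamma>" by blast
    show "y = fcalc F shift x"
    proof
      fix i
      have "2 * pi * \<i> * y i = 2 * pi * \<i> * fcalc F shift x i"
        using has_contour_integral_unique[OF U(5)[OF coord_in_dual[of i]] int[OF U(1-4) coord_in_dual x, of i]]
        by (simp add: F_def)
      then show "y i = fcalc F shift x i" by simp
    qed
  qed
qed

end

declare curry_conv [simp del]

section \<open>The characteristic polynomial and its resultant\<close>

lemma G_eq: "G n f l z = (\<Sum>j<n. l ^ j * f (Suc j) z) - l ^ n"
  by (simp add: G_def sum.atLeast1_atMost_eq)

lemma coeff_G_poly: "coeff (G_poly n f z) k = (if k < n then f (Suc k) z else 0) - (if k = n then 1 else 0)"
  by (auto simp: G_poly_def coeff_sum sum.atLeast1_atMost_eq)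

lemma coeff_dG_poly: "coeff (dG_poly n f z) k = (if k < n then deriv (f (Suc k)) z else 0)"
  by (auto simp: dG_poly_def coeff_sum sum.atLeast1_atMost_eq)

lemma G_poly_nonzero: "G_poly n f z \<noteq> 0"
proof
  assume "G_poly n f z = 0"
  then have "coeff (G_poly n f z) n = 0" by simp
  then show False by (simp add: coeff_G_poly)
qed

lemma finite_G_zeros: "finite {l. G n f l z = 0}"
  using poly_roots_finite[OF G_poly_nonzero[of n f z]] by (simp add: poly_G_poly)

text \<open>The formal degrees bound the actual ones, and \<open>n \<ge> 1\<close> makes the
  Sylvester matrix nonempty.\<close>

lemma G_res_common_root:
  assumes n: "n \<ge> 1" and "G n f l z = 0" and "poly (dG_poly n f z) l = 0"
  shows "G_res n f z = 0"
  unfolding G_res_def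
proof (rule resultant_sub_common_root)
  show "degree (G_poly n f z) \<le> n" by (rule degree_le) (simp add: coeff_G_poly)
  show "degree (dG_poly n f z) \<le> n - 1" using n by (intro degree_le) (auto simp: coeff_dG_poly)
qed (use assms in \<open>simp_all add: poly_G_poly\<close>)

text \<open>By the Leibniz formula the determinant is a sum of products of entries, and each entry
  is a constant, a value of some \<open>f i\<close> or a value of its derivative.\<close>

lemma holomorphic_on_G_res:
  assumes f: "\<And>i. i \<in> {1..n} \<Longrightarrow> f i holomorphic_on U" and U: "open U"
  shows "G_res n f holomorphic_on U"
proof -
  let ?N = "n + (n - 1)"
  let ?M = "\<lambda>z. sylvester_mat_sub n (n - 1) (G_poly n f z) (dG_poly n f z)"
  have cG: "(\<lambda>z. coeff (G_poly n f z) k) holomorphic_on U" for k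
    unfolding coeff_G_poly by (cases "k < n") (auto intro!: holomorphic_intros f)
  have cD: "(\<lambda>z. coeff (dG_poly n f z) k) holomorphic_on U" for k
    unfolding coeff_dG_poly by (cases "k < n") (auto intro!: holomorphic_intros f U)
  have if_hol: "(\<lambda>z. if b then g z else k z) holomorphic_on U"
    if "g holomorphic_on U" "k holomorphic_on U" for b and g k :: "complex \<Rightarrow> complex"
    using that by (cases b) auto
  have entry: "(\<lambda>z. ?M z $$ (i, j)) holomorphic_on U" if "i < ?N" "j < ?N" for i j
    unfolding sylvester_mat_sub_index[OF that]
    by (intro if_hol cG cD holomorphic_on_const)
  have "G_res n f = (\<lambda>z. \<Sum>p\<in>{p. p permutes {0..<?N}}. signof p * (\<Prod>i=0..<?N. ?M z $$ (i, p i)))"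
    by (simp add: fun_eq_iff G_res_def resultant_sub_def Determinant.det_def)
  moreover have "(\<lambda>z. \<Sum>p\<in>{p. p permutes {0..<?N}}. signof p * (\<Prod>i=0..<?N. ?M z $$ (i, p i))) holomorphic_on U"
  proof (intro holomorphic_intros)
    fix p i assume "p \<in> {p. p permutes {0..<?N}}" "i \<in> {0..<?N}"
    then have "i < ?N" "p i < ?N" using permutes_in_image[of p "{0..<?N}" i] by auto
    then show "(\<lambda>z. ?M z $$ (i, p i)) holomorphic_on U" by (rule entry)
  qed
  ultimately show ?thesis by simp
qed


section \<open>The companion operator\<close>

text \<open>The identity theorem does not reach across the unit disc at once, because a majorant
  \<open>\<rho> ^ k\<close> with \<open>\<rho> < 1\<close> exists on smaller discs only. Instead the
  limit points of \<open>Q\<close> in the unit disc form an open and closed subset, which is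
  everything by connectedness. At 0 the Taylor coefficients of the field are the unit vectors, and
  these span a dense subspace.\<close>

lemma (in seqspace) geometric_total:
  assumes Z: "closed_subspace X Z" and a: "norm a < 1"
    and acc: "\<And>e. e > 0 \<Longrightarrow> \<exists>w. w \<noteq> a \<and> norm (w - a) < e \<and> (\<lambda>k. w ^ k) \<in> Z"
  shows "Z = vecs X"
proof -
  define \<Psi> where "\<Psi> w = (\<lambda>k. w ^ k)" for w :: complex
  define Q where "Q = {w \<in> ball 0 1. \<Psi> w \<in> Z}"
  note ZD = closed_subspaceD[OF Z]
  have step: "\<Psi> l \<in> Z \<and> (\<lambda>k. (deriv ^^ j) (\<lambda>l. l ^ k) b / fact j) \<in> Z"
    if b: "b \<in> ball 0 1" "b islimpt Q" and l: "l \<in> ball b ((1 - norm b) / 2)" for b l j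
  proof -
    define r where "r = (1 - norm b) / 2"
    define \<rho> where "\<rho> = (1 + norm b) / 2"
    have r: "r > 0" "0 \<le> \<rho>" "\<rho> < 1" using b by (auto simp: r_def \<rho>_def add_nonneg_nonneg)
    obtain K where K: "\<And>x C. C \<ge> 0 \<Longrightarrow> (\<And>k. norm (x k) \<le> C * \<rho> ^ k) \<Longrightarrow> x \<in> vecs X \<and> vnorm X x \<le> C * K"
      using geometric[OF r(2,3)] by blast
    have bnd: "norm (\<Psi> l k) \<le> \<rho> ^ k" if "l \<in> ball b r" for l k
    proof -
      have "norm l \<le> norm b + norm (l - b)" using norm_triangle_ineq[of b "l - b"] by simp
      also have "\<dots> \<le> \<rho>" using that by (simp add: r_def \<rho>_def dist_norm norm_minus_commute field_simps)
      finally show ?thesis by (simp add: \<Psi>_def norm_power power_mono)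
    qed
    have hol: "(\<lambda>l. \<Psi> l k) holomorphic_on ball b r" for k
      unfolding \<Psi>_def by (intro holomorphic_intros)
    have ac: "\<exists>l. l \<noteq> b \<and> norm (l - b) < e \<and> \<Psi> l \<in> Z" if e: "e > 0" for e
    proof -
      obtain w where "w \<in> Q" "w \<noteq> b" "dist w b < e" using b(2) e unfolding islimpt_approachable by blast
      then show ?thesis by (auto simp: Q_def dist_norm)
    qed
    have lr: "l \<in> ball b r" using l by (simp add: r_def)
    show ?thesis
      using identity[OF Z r(1) hol bnd K ac lr] identity_coeff[OF Z r(1) hol bnd K ac lr, of j]
      unfolding \<Psi>_def by blast
  qed
  have sub: "ball b ((1 - norm b) / 2) \<subseteq> Q" if b: "b \<in> ball 0 1" "b islimpt Q" for b
  proof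
    fix l assume l: "l \<in> ball b ((1 - norm b) / 2)"
    have "norm l \<le> norm b + norm (l - b)" using norm_triangle_ineq[of b "l - b"] by simp
    then have "norm l < 1" using l b by (simp add: dist_norm norm_minus_commute field_simps)
    then show "l \<in> Q" using conjunct1[OF step[OF b l]] by (simp add: Q_def)
  qed
  define L where "L = ball 0 1 \<inter> {b. b islimpt Q}"
  have "openin (top_of_set (ball 0 1)) L"
  proof -
    have "open L"
      unfolding open_contains_ball
    proof
      fix b assume b: "b \<in> L"
      then have b': "b \<in> ball 0 1" "b islimpt Q" by (auto simp: L_def)
      have "c \<in> L" if c: "c \<in> ball b ((1 - norm b) / 2)" for c
      proof -
        have "c islimpt ball b ((1 - norm b) / 2)"
          using c by (intro interior_limit_point) simp
        then have "c islimpt Q" using sub[OF b'] islimpt_subset by blast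
        then show ?thesis using sub[OF b'] c by (auto simp: L_def Q_def)
      qed
      then show "\<exists>e>0. ball b e \<subseteq> L" using b' by (intro exI[of _ "(1 - norm b) / 2"]) auto
    qed
    then show ?thesis by (intro open_subset) (auto simp: L_def)
  qed
  moreover have "closedin (top_of_set (ball 0 1)) L"
    unfolding L_def by (rule closedin_closed_Int[OF closed_limpts])
  moreover have "a \<in> L"
  proof -
    have "a islimpt Q"
      unfolding islimpt_approachable
    proof (intro allI impI)
      fix e :: real assume "e > 0"
      then have "min e (1 - norm a) > 0" using a by simp
      then obtain w where w: "w \<noteq> a" "norm (w - a) < min e (1 - norm a)" "(\<lambda>k. w ^ k) \<in> Z" using acc by blast
      have "norm w < 1" using norm_triangle_ineq[of a "w - a"] w by simp
      then show "\<exists>w\<in>Q. w \<noteq> a \<and> dist w a < e"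
        using w by (intro bexI[of _ w]) (auto simp: Q_def \<Psi>_def dist_norm)
    qed
    then show ?thesis using a by (simp add: L_def)
  qed
  moreover have "connected (ball (0::complex) 1)" by (intro convex_connected) simp
  ultimately have "L = ball 0 1" unfolding connected_clopen by blast
  then have "0 \<in> L" by simp
  then have "(0::complex) islimpt Q" by (simp add: L_def)
  have unit: "(\<lambda>k. if k = j then 1 else 0) \<in> Z" for j
  proof -
    have "(\<lambda>k. (deriv ^^ j) (\<lambda>l. l ^ k) 0 / fact j) \<in> Z"
      using step[of 0 0 j] \<open>0 islimpt Q\<close> by simp
    moreover have "(deriv ^^ j) (\<lambda>l. l ^ k) 0 / fact j = (if k = j then 1 else (0::complex))" for k
      using fps_nth_fps_expansion[OF has_fps_expansion_fps_X_power[of k], of j] by auto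
    ultimately show ?thesis by simp
  qed
  have "x \<in> Z" if x: "x \<in> vecs X" for x
  proof (rule ZD(6)[OF x])
    fix e :: real assume "e > 0"
    then obtain N where N: "vnorm X (x - (\<lambda>k. if k < N then x k else 0)) < e" using truncate[OF x] by blast
    have "(\<lambda>k. if k < N then x k else 0) = (\<Sum>j<N. scl (x j) (\<lambda>k. if k = j then 1 else 0))"
      by (simp add: fun_eq_iff sum_fun_apply vec_apply if_distrib[of "\<lambda>t. _ * t"] cong: if_cong)
    also have "\<dots> \<in> Z"
      using Z unit ZD(4) by (intro cvec.subspace_sum) (auto simp: closed_subspace_def)
    finally show "\<exists>y\<in>Z. vnorm X (x - y) < e" using N by blast
  qed
  then show ?thesis using ZD(1) by blast
qed

locale companion = seqspace X for X :: "nat fspace" +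
  fixes h :: real and n :: nat and f :: "nat \<Rightarrow> complex \<Rightarrow> complex"
  assumes h: "h > 0" and n: "n \<ge> 1"
    and f: "\<And>i. i \<in> {1..n} \<Longrightarrow> f i analytic_on cball (- 1 / of_real h) (1 / h)"
begin

abbreviation "Xn \<equiv> power_space X n"
abbreviation "cop \<equiv> companion_op X h n f"
abbreviation "csg \<equiv> op_exp Xn cop"
abbreviation "disc \<equiv> ball (- 1 / complex_of_real h) (1 / h)"
abbreviation "cdisc \<equiv> cball (- 1 / complex_of_real h) (1 / h)"

text \<open>The Taylor series in the variable \<open>w = 1 + h * z\<close>; thus \<open>f i\<close>
  of the difference operator is this series in the shift.\<close>

definition F :: "nat \<Rightarrow> complex fps" where
  "F i = fps_expansion (\<lambda>w. f i ((w - 1) / of_real h)) 0"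

text \<open>The series of G(\<mu>, z) in the variable \<open>w\<close>. Applied to the shift it is
  the operator that annihilates the first component of an eigenvector for
  \<open>\<mu>\<close>.\<close>

definition GF :: "complex \<Rightarrow> complex fps" where
  "GF \<mu> = (\<Sum>j<n. fps_const (\<mu> ^ j) * F (Suc j)) - fps_const (\<mu> ^ n)"

sublocale V: bfspace "Xn"
  by (rule power_bfspace) unfold_locales

lemma V_mem: "x \<in> vecs Xn \<longleftrightarrow> (\<forall>i<n. curry x i \<in> vecs X) \<and> (\<forall>i\<ge>n. curry x i = 0)"
  by (simp add: power_space_def)

lemma V_norm: "vnorm Xn x = (\<Sum>i<n. vnorm X (curry x i))"
  by (simp add: power_space_def)

lemma V_eqI:
  assumes "x \<in> vecs Xn" "y \<in> vecs Xn" "\<And>i. i < n \<Longrightarrow> curry x i = curry y i"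
  shows "x = y"
proof
  fix p :: "nat \<times> nat"
  have "curry x (fst p) = curry y (fst p)" using assms by (cases "fst p < n") (auto simp: V_mem)
  then have "curry x (fst p) (snd p) = curry y (fst p) (snd p)" by (rule fun_cong)
  then show "x p = y p" by (simp add: curry_def)
qed

lemma F_radius: "j < n \<Longrightarrow> fps_conv_radius (F (Suc j)) > ereal 1"
  unfolding F_def by (rule riesz_dunford_eq(2)[OF h f zero_mem]) simp

lemma F_radius': "j < n \<Longrightarrow> fps_conv_radius (fps_const c * F (Suc j)) > ereal 1"
  using fps_conv_radius_mult[of "fps_const c" "F (Suc j)"] F_radius[of j] by (simp add: less_le_trans)

lemma hol_f: "j < n \<Longrightarrow> f (Suc j) holomorphic_on disc"
  using f[of "Suc j"] by (intro analytic_imp_holomorphic) (auto elim: analytic_on_subset)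

lemma hol_coordinate: "j < n \<Longrightarrow> (\<lambda>w. f (Suc j) ((w - 1) / of_real h)) holomorphic_on ball 0 1"
  using holomorphic_disc_coordinate[OF h hol_f] h by simp

lemma eval_F: "j < n \<Longrightarrow> norm w < 1 \<Longrightarrow> eval_fps (F (Suc j)) w = f (Suc j) ((w - 1) / of_real h)"
  unfolding F_def using eval_fps_expansion'[of _ 0 "ereal 1" w] hol_coordinate[of j] by (simp add: one_ereal_def)

text \<open>The three claims share one induction because operators and values of the partial sums
  can be added once their radius of convergence is known.\<close>

lemma GF_sum:
  assumes "m \<le> n"
  shows "fps_conv_radius (\<Sum>j<m. fps_const (\<mu> ^ j) * F (Suc j)) > ereal 1 \<and>
    (\<forall>x\<in>vecs X. fcalc (\<Sum>j<m. fps_const (\<mu> ^ j) * F (Suc j)) shift x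
      = (\<Sum>j<m. scl (\<mu> ^ j) (fcalc (F (Suc j)) shift x))) \<and>
    (\<forall>w. norm w < 1 \<longrightarrow> eval_fps (\<Sum>j<m. fps_const (\<mu> ^ j) * F (Suc j)) w
      = (\<Sum>j<m. \<mu> ^ j * f (Suc j) ((w - 1) / of_real h)))"
  using assms
proof (induction m)
  case 0
  then show ?case by (simp add: fcalc_0)
next
  case (Suc m)
  define S where "S = (\<Sum>j<m. fps_const (\<mu> ^ j) * F (Suc j))"
  have m: "m < n" using Suc.prems by simp
  have S: "fps_conv_radius S > ereal 1" using Suc by (simp add: S_def)
  have c: "fps_conv_radius (fps_const (\<mu> ^ m)) > ereal 1" by simp
  have "ereal 1 < min (fps_conv_radius S) (fps_conv_radius (fps_const (\<mu> ^ m) * F (Suc m)))"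
    using S F_radius'[OF m] by simp
  then have 1: "ereal 1 < fps_conv_radius (S + fps_const (\<mu> ^ m) * F (Suc m))"
    using fps_conv_radius_add by (rule less_le_trans)
  have 2: "fcalc (S + fps_const (\<mu> ^ m) * F (Suc m)) shift x
      = (\<Sum>j<Suc m. scl (\<mu> ^ j) (fcalc (F (Suc j)) shift x))" if x: "x \<in> vecs X" for x
    unfolding B.fcalc_add[OF S F_radius'[OF m] x] B.fcalc_mult[OF c F_radius[OF m] x] fcalc_const
    using Suc x by (simp add: S_def)
  have 3: "eval_fps (S + fps_const (\<mu> ^ m) * F (Suc m)) w = (\<Sum>j<Suc m. \<mu> ^ j * f (Suc j) ((w - 1) / of_real h))"
    if w: "norm w < 1" for w
  proof -
    have w1: "ereal (norm w) < ereal 1" using w by simp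
    have "eval_fps (S + fps_const (\<mu> ^ m) * F (Suc m)) w = eval_fps S w + \<mu> ^ m * eval_fps (F (Suc m)) w"
      using less_trans[OF w1 S] less_trans[OF w1 F_radius'[OF m]] less_trans[OF w1 F_radius[OF m]]
      by (subst eval_fps_add) (auto simp: eval_fps_mult)
    then show ?thesis using Suc w m by (simp add: S_def eval_F)
  qed
  show ?case using 1 2 3 by (simp add: S_def)
qed

lemma GF_radius: "fps_conv_radius (GF \<mu>) > ereal 1"
proof -
  have "ereal 1 < min (fps_conv_radius (\<Sum>j<n. fps_const (\<mu> ^ j) * F (Suc j))) (fps_conv_radius (fps_const (\<mu> ^ n)))"
    using GF_sum[of n \<mu>] by simp
  then show ?thesis unfolding GF_def using fps_conv_radius_diff by (rule less_le_trans)
qed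

lemma fcalc_GF:
  assumes x: "x \<in> vecs X"
  shows "fcalc (GF \<mu>) shift x = (\<Sum>j<n. scl (\<mu> ^ j) (fcalc (F (Suc j)) shift x)) - scl (\<mu> ^ n) x"
proof -
  have c: "fps_conv_radius (fps_const (\<mu> ^ n)) > ereal 1" by simp
  show ?thesis
    unfolding GF_def using GF_sum[of n \<mu>] x by (simp add: B.fcalc_diff[OF _ c x] fcalc_const)
qed

lemma eval_GF:
  assumes w: "norm w < 1"
  shows "eval_fps (GF \<mu>) w = G n f \<mu> ((w - 1) / of_real h)"
proof -
  have "ereal (norm w) < ereal 1" using w by simp
  then have "ereal (norm w) < fps_conv_radius (\<Sum>j<n. fps_const (\<mu> ^ j) * F (Suc j))"
    using GF_sum[of n \<mu>] less_trans by blast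
  then show ?thesis
    unfolding GF_def using GF_sum[of n \<mu>] w by (simp add: eval_fps_diff G_eq)
qed

lemma curry_companion:
  assumes x: "x \<in> vecs Xn"
  shows "curry (cop x) i = (if Suc i < n then curry x (Suc i) else
    if Suc i = n then (\<Sum>j<n. fcalc (F (Suc j)) shift (curry x j)) else 0)"
proof
  fix k
  have "riesz_dunford X (forward_diff h) (f (Suc j)) (curry x j) = fcalc (F (Suc j)) shift (curry x j)" if "j < n" for j
    unfolding F_def using x that by (intro riesz_dunford_eq(1) h f) (auto simp: V_mem)
  then have "(\<Sum>j<n. riesz_dunford X (forward_diff h) (f (Suc j)) (curry x j))
      = (\<Sum>j<n. fcalc (F (Suc j)) shift (curry x j))"
    by (intro sum.cong) auto
  then show "curry (cop x) i k = (if Suc i < n then curry x (Suc i) else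
    if Suc i = n then (\<Sum>j<n. fcalc (F (Suc j)) shift (curry x j)) else 0) k"
    by (simp add: companion_op_def curry_def vec_apply)
qed

definition coeff_norm :: "nat \<Rightarrow> real" where
  "coeff_norm j = (\<Sum>m. norm (fps_nth (F (Suc j)) m) * 1 ^ m)"

text \<open>The 1 accounts for the rows that move components, the sum for the last row.\<close>

definition op_norm_bound :: real where
  "op_norm_bound = 1 + (\<Sum>j<n. coeff_norm j)"

lemma bop_companion: "bop Xn cop op_norm_bound"
proof
  have Fb: "bop X (fcalc (F (Suc j)) shift) (coeff_norm j)" if "j < n" for j
    unfolding coeff_norm_def by (rule B.bop_fcalc[OF F_radius[OF that]])
  have c0: "coeff_norm j \<ge> 0" if "j < n" for j by (rule bop.M_nonneg[OF Fb[OF that]])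
  show "op_norm_bound \<ge> 0" unfolding op_norm_bound_def using c0 by (intro add_nonneg_nonneg sum_nonneg) auto
  have last: "(\<Sum>j<n. fcalc (F (Suc j)) shift (curry x j)) \<in> vecs X" if "x \<in> vecs Xn" for x
    using that bop.op_mem[OF Fb] by (intro sum_mem) (auto simp: V_mem)
  show mem: "cop x \<in> vecs Xn" if x: "x \<in> vecs Xn" for x
    using x last[OF x] unfolding V_mem curry_companion[OF x] by auto
  show "cop (x + y) = cop x + cop y" if xy: "x \<in> vecs Xn" "y \<in> vecs Xn" for x y
  proof (rule V_eqI)
    fix i assume "i < n"
    have "(\<Sum>j<n. fcalc (F (Suc j)) shift (curry (x + y) j))
        = (\<Sum>j<n. fcalc (F (Suc j)) shift (curry x j)) + (\<Sum>j<n. fcalc (F (Suc j)) shift (curry y j))"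
      unfolding sum.distrib[symmetric] curry_simps using xy
      by (intro sum.cong refl bop.op_add[OF Fb]) (auto simp: V_mem)
    then show "curry (cop (x + y)) i = curry (cop x + cop y) i"
      using xy by (simp add: curry_simps curry_companion V.add_mem)
  qed (use xy mem in auto)
  show "cop (scl c x) = scl c (cop x)" if x: "x \<in> vecs Xn" for c x
  proof (rule V_eqI)
    fix i assume "i < n"
    have "(\<Sum>j<n. fcalc (F (Suc j)) shift (curry (scl c x) j))
        = scl c (\<Sum>j<n. fcalc (F (Suc j)) shift (curry x j))"
      unfolding cvec.scale_sum_right curry_simps using x
      by (intro sum.cong refl bop.op_scl[OF Fb]) (auto simp: V_mem)
    then show "curry (cop (scl c x)) i = curry (scl c (cop x)) i"
      using x by (simp add: curry_simps curry_companion V.scl_mem)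
  qed (use x mem in auto)
  show "vnorm Xn (cop x) \<le> op_norm_bound * vnorm Xn x" if x: "x \<in> vecs Xn" for x
  proof -
    obtain m where m: "n = Suc m" using n by (cases n) auto
    have nn: "vnorm X (curry x i) \<ge> 0" if "i < n" for i using x that by (intro norm_nonneg) (simp add: V_mem)
    have comp_le: "vnorm X (curry x j) \<le> vnorm Xn x" if "j < n" for j
      unfolding V_norm using that nn by (intro member_le_sum) auto
    have "vnorm Xn (cop x) = (\<Sum>i<m. vnorm X (curry x (Suc i))) + vnorm X (\<Sum>j<n. fcalc (F (Suc j)) shift (curry x j))"
      unfolding V_norm curry_companion[OF x] by (simp add: m)
    also have "(\<Sum>i<m. vnorm X (curry x (Suc i))) \<le> vnorm Xn x"
      unfolding V_norm unfolding m sum.lessThan_Suc_shift using nn[of 0] n by simp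
    also have "vnorm X (\<Sum>j<n. fcalc (F (Suc j)) shift (curry x j)) \<le> (\<Sum>j<n. vnorm X (fcalc (F (Suc j)) shift (curry x j)))"
      using x bop.op_mem[OF Fb] by (intro norm_sum_le) (auto simp: V_mem)
    also have "\<dots> \<le> (\<Sum>j<n. coeff_norm j * vnorm Xn x)"
    proof (rule sum_mono)
      fix j assume "j \<in> {..<n}"
      then have j: "j < n" by simp
      have "vnorm X (fcalc (F (Suc j)) shift (curry x j)) \<le> coeff_norm j * vnorm X (curry x j)"
        using x j by (intro bop.op_bound[OF Fb]) (auto simp: V_mem)
      also have "\<dots> \<le> coeff_norm j * vnorm Xn x" by (intro mult_left_mono comp_le j c0)
      finally show "vnorm X (fcalc (F (Suc j)) shift (curry x j)) \<le> coeff_norm j * vnorm Xn x" .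
    qed
    finally show ?thesis by (simp add: op_norm_bound_def distrib_right sum_distrib_right)
  qed
qed

sublocale A: bop "Xn" "cop" op_norm_bound
  by (rule bop_companion)

text \<open>As for a scalar companion matrix, the upper rows force
  \<open>curry v i = scl (\<mu> ^ i) (curry v 0)\<close>, and the last row becomes an equation for
  the first component alone.\<close>

lemma companion_eigenvector:
  assumes v: "v \<in> vecs Xn" "v \<noteq> 0" "cop v = scl \<mu> v"
  shows "curry v 0 \<in> vecs X" "curry v 0 \<noteq> 0" "fcalc (GF \<mu>) shift (curry v 0) = 0"
proof -
  have c: "scl \<mu> (curry v i) = (if Suc i < n then curry v (Suc i) else
    if Suc i = n then (\<Sum>j<n. fcalc (F (Suc j)) shift (curry v j)) else 0)" for i
    using curry_companion[OF v(1), of i] unfolding v(3) curry_simps .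
  have vi: "curry v i = scl (\<mu> ^ i) (curry v 0)" if "i < n" for i
    using that
  proof (induction i)
    case (Suc i)
    then have "curry v (Suc i) = scl \<mu> (curry v i)" using c[of i] by simp
    then show ?case using Suc by simp
  qed simp
  show v0: "curry v 0 \<in> vecs X" using v(1) n by (simp add: V_mem)
  show "curry v 0 \<noteq> 0"
  proof
    assume 0: "curry v 0 = 0"
    have "v = 0"
    proof (rule V_eqI[OF v(1) V.zero_mem])
      fix i assume "i < n"
      from vi[OF this] show "curry v i = curry 0 i" unfolding 0 curry_simps by simp
    qed
    then show False using v by simp
  qed
  have "(\<Sum>j<n. scl (\<mu> ^ j) (fcalc (F (Suc j)) shift (curry v 0))) = (\<Sum>j<n. fcalc (F (Suc j)) shift (curry v j))"
  proof (intro sum.cong refl)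
    fix j assume "j \<in> {..<n}"
    then have j: "j < n" by simp
    show "scl (\<mu> ^ j) (fcalc (F (Suc j)) shift (curry v 0)) = fcalc (F (Suc j)) shift (curry v j)"
      unfolding vi[OF j] by (rule bop.op_scl[OF B.bop_fcalc[OF F_radius[OF j]] v0, symmetric])
  qed
  also have "\<dots> = scl \<mu> (curry v (n - 1))" using c[of "n - 1"] n by simp
  also have "\<dots> = scl (\<mu> * \<mu> ^ (n - 1)) (curry v 0)" using n vi[of "n - 1"] by simp
  also have "\<mu> * \<mu> ^ (n - 1) = \<mu> ^ n" using n by (cases n) auto
  finally show "fcalc (GF \<mu>) shift (curry v 0) = 0" by (simp add: fcalc_GF[OF v0])
qed

text \<open>The resultant enters through \<open>GF \<mu> \<noteq> 0\<close>: if G(\<mu>, .) vanished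
  identically, so would its derivative, and \<open>\<mu>\<close> would be a common root at every
  point of the disc. The first component then leads to an eigenvector of the shift, a geometric
  sequence, whose ratio yields the point \<open>z\<close>.\<close>

lemma eigenvalue_imp_zero:
  assumes v: "v \<in> vecs Xn" "v \<noteq> 0" "cop v = scl \<mu> v"
    and res: "\<exists>z\<in>disc. G_res n f z \<noteq> 0"
  shows "\<exists>z\<in>disc. G n f \<mu> z = 0"
proof -
  have "GF \<mu> \<noteq> 0"
  proof
    assume 0: "GF \<mu> = 0"
    have zero: "G n f \<mu> z = 0" if "z \<in> disc" for z
    proof -
      have "norm (1 + of_real h * z) < 1" using that by (simp only: mem_disc_iff[OF h])
      from eval_GF[OF this, of \<mu>] show ?thesis using h by (simp add: 0)
    qed
    obtain z where z: "z \<in> disc" "G_res n f z \<noteq> 0" using res by blast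
    have "deriv (G n f \<mu>) z = deriv (\<lambda>_. 0) z"
    proof (rule deriv_cong_ev)
      have "eventually (\<lambda>z. z \<in> disc) (nhds z)"
        using z by (intro eventually_nhds_in_open) auto
      then show "eventually (\<lambda>z. G n f \<mu> z = 0) (nhds z)" by eventually_elim (rule zero)
    qed simp
    moreover have "poly (dG_poly n f z) \<mu> = deriv (G n f \<mu>) z"
    proof (rule poly_dG_poly)
      fix i assume "i \<in> {1..n}"
      then show "f i field_differentiable at z"
        using f[of i] z by (intro analytic_on_imp_differentiable_at[of "f i" "cdisc"]) auto
    qed
    ultimately show False using G_res_common_root[OF n zero[OF z(1)]] z by simp
  qed
  then obtain cs H R where cs: "GF \<mu> = root_prod cs * H"
    "\<And>c. c \<in> set cs \<Longrightarrow> norm c \<le> R \<and> eval_fps (GF \<mu>) c = 0" "fcalc (root_prod cs) shift (curry v 0) = 0"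
    using B.kernel_factor[OF _ GF_radius companion_eigenvector(1,3)[OF v]] by metis
  obtain c u where c: "c \<in> set cs" "u \<in> vecs X" "u \<noteq> 0" "shift u = scl c u"
    using B.root_prod_eigenvector[OF companion_eigenvector(1,2)[OF v] cs(3)] by blast
  have uk: "u k = c ^ k * u 0" for k
  proof (induction k)
    case (Suc k)
    have "u (Suc k) = c * u k" using fun_cong[OF c(4), of k] by (simp add: shift_apply scl_apply)
    then show ?case using Suc by simp
  qed simp
  have u0: "u 0 \<noteq> 0"
  proof
    assume "u 0 = 0"
    then have "u k = 0" for k using uk[of k] by simp
    then have "u = 0" by (auto simp: fun_eq_iff vec_apply)
    then show False using c by simp
  qed
  \<comment> \<open>The factorization does not place \<open>c\<close> in the open unit disc; this
    follows because the eigenvector tends to 0.\<close>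
  have "norm c < 1"
  proof (rule ccontr)
    assume "\<not> norm c < 1"
    then have ge: "norm (u k) \<ge> norm (u 0)" for k
      using mult_right_mono[OF one_le_power[of "norm c" k], of "norm (u 0)"] uk[of k] by (simp add: norm_mult norm_power)
    have "(\<lambda>k. norm (u k)) \<longlonglongrightarrow> 0" using tendsto_norm_zero[OF tendsto_zero[OF c(2)]] .
    then have "norm (u 0) \<le> 0" by (rule LIMSEQ_le_const) (use ge in auto)
    then show False using u0 by simp
  qed
  moreover have "G n f \<mu> ((c - 1) / of_real h) = 0" using eval_GF[OF \<open>norm c < 1\<close>, of \<mu>] cs(2)[OF c(1)] by simp
  moreover have "(c - 1) / of_real h \<in> disc"
    unfolding mem_disc_iff[OF h] using h \<open>norm c < 1\<close> by simp
  ultimately show ?thesis by blast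
qed

text \<open>The closed disc is compact inside a larger disc of holomorphy. If the resultant is
  constant there, the hypothesis excludes zeros altogether.\<close>

lemma finite_resultant_zeros:
  assumes res: "\<exists>z\<in>disc. G_res n f z \<noteq> 0"
  shows "finite {z \<in> cdisc. G_res n f z = 0}"
proof -
  obtain U where U: "\<And>i. i \<in> {1..n} \<Longrightarrow> open (U i) \<and> cdisc \<subseteq> U i \<and> f i holomorphic_on U i"
    using f unfolding analytic_on_holomorphic by metis
  have "open (\<Inter>i\<in>{1..n}. U i)" using U by (intro open_INT) blast+
  moreover have "cdisc \<subseteq> (\<Inter>i\<in>{1..n}. U i)" using U by blast
  ultimately obtain R where R: "R > 1 / h" "ball (- 1 / of_real h) R \<subseteq> (\<Inter>i\<in>{1..n}. U i)"
    using ball_subset_open[of "\<Inter>i\<in>{1..n}. U i" "- 1 / of_real h" "1 / h"] h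
    by (metis divide_nonneg_pos zero_le_one)
  have hol: "G_res n f holomorphic_on ball (- 1 / of_real h) R"
  proof (rule holomorphic_on_G_res)
    fix i assume i: "i \<in> {1..n}"
    then have "ball (- 1 / of_real h) R \<subseteq> U i" using R(2) by auto
    then show "f i holomorphic_on ball (- 1 / of_real h) R" using U[OF i] holomorphic_on_subset by blast
  qed simp
  show ?thesis
  proof (cases "G_res n f constant_on ball (- 1 / of_real h) R")
    case True
    then obtain a where a: "\<And>z. z \<in> ball (- 1 / of_real h) R \<Longrightarrow> G_res n f z = a" unfolding constant_on_def by blast
    have "cdisc \<subseteq> ball (- 1 / of_real h) R" using R by auto
    then have "\<And>z. z \<in> cdisc \<Longrightarrow> G_res n f z = a" using a by blast
    moreover obtain z where "z \<in> cdisc" "G_res n f z \<noteq> 0" using res ball_subset_cball by blast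
    ultimately have "{z \<in> cdisc. G_res n f z = 0} = {}" by auto
    then show ?thesis by (simp only: finite.emptyI)
  next
    case False
    then show ?thesis
      using R by (intro holomorphic_compact_finite_zeros[OF hol]) (auto simp: convex_connected)
  qed
qed

end


section \<open>The main theorem\<close>

context companion
begin

text \<open>Formulated with dense periodic points and a dense orbit of the semigroup, conditions
  that follow from chaos of the semigroup as well as from chaos of one of its operators; (i) and
  (iv) are thus handled together.\<close>

lemma imaginary_zero_of_chaotic:
  assumes res: "\<exists>z\<in>disc. G_res n f z \<noteq> 0"
    and Y: "closed_subspace Xn Y" "Y \<noteq> {0}"
    and per: "\<And>y e. y \<in> Y \<Longrightarrow> e > 0 \<Longrightarrow> \<exists>x\<in>Y. (\<exists>t>0. csg t x = x) \<and>
      vnorm Xn (y - x) < e"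
    and orb: "x \<in> Y" "\<And>y e. y \<in> Y \<Longrightarrow> e > 0 \<Longrightarrow>
      \<exists>t\<ge>0. vnorm Xn (y - csg t x) < e"
  shows "\<exists>l0 z0. Re l0 = 0 \<and> z0 \<in> disc \<and> G n f l0 z0 = 0 \<and> G_res n f z0 \<noteq> 0"
proof (rule ccontr)
  assume neg: "\<not> ?thesis"
  define L where "L = {l. Re l = 0 \<and> (\<exists>z\<in>disc. G_res n f z = 0 \<and> G n f l z = 0)}"
  have "L \<subseteq> (\<Union>z\<in>{z \<in> cdisc. G_res n f z = 0}. {l. G n f l z = 0})"
    unfolding L_def by force
  then have "finite L"
    by (rule finite_subset) (intro finite_UN_I finite_resultant_zeros[OF res] finite_G_zeros)
  then show False
  proof (rule A.finite_imaginary_spectrum_not_chaotic[OF _ _ _ Y per orb])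
    show "Re c = 0" if "c \<in> L" for c using that by (simp add: L_def)
    show "c \<in> L" if "Re c = 0" "v \<in> vecs Xn" "v \<noteq> 0" "cop v = scl c v" for c v
      using eigenvalue_imp_zero[OF that(2-4) res] that(1) neg unfolding L_def by blast
  qed
qed

lemma imaginary_zero_of_subchaotic_sg:
  assumes res: "\<exists>z\<in>disc. G_res n f z \<noteq> 0"
    and Y: "subchaotic_sg_wrt Xn (csg) Y"
  shows "\<exists>l0 z0. Re l0 = 0 \<and> z0 \<in> disc \<and> G n f l0 z0 = 0 \<and> G_res n f z0 \<noteq> 0"
proof -
  have cl: "closed_subspace Xn Y" and Y0: "Y \<noteq> {0}"
    and ch: "devaney_chaotic_sg (Xn\<lparr>vecs := Y\<rparr>) (csg)"
    using Y by (auto simp: subchaotic_sg_wrt_def)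
  interpret Y: bfspace "Xn\<lparr>vecs := Y\<rparr>" by (rule V.restrict_bfspace[OF cl])
  from ch obtain x where x: "x \<in> Y"
    and d: "dense_in (Xn\<lparr>vecs := Y\<rparr>) {csg t x |t. t \<ge> 0}"
    and p: "dense_in (Xn\<lparr>vecs := Y\<rparr>)
      {x \<in> Y. \<exists>t>0. csg t x = x}"
    unfolding devaney_chaotic_sg_def by auto
  have per: "\<exists>z\<in>{x \<in> Y. \<exists>t>0. csg t x = x}.
      z \<in> Y \<and> vnorm Xn (y - z) < e" if "y \<in> Y" "e > 0" for y and e :: real
    using p that unfolding Y.dense_in_iff by simp
  have orb: "\<exists>z\<in>{csg t x |t. t \<ge> 0}.
      z \<in> Y \<and> vnorm Xn (y - z) < e" if "y \<in> Y" "e > 0" for y and e :: real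
    using d that unfolding Y.dense_in_iff by simp
  show ?thesis
  proof (rule imaginary_zero_of_chaotic[OF res cl Y0 _ x])
    fix y and e :: real assume ye: "y \<in> Y" "e > 0"
    show "\<exists>x\<in>Y. (\<exists>t>0. csg t x = x) \<and> vnorm Xn (y - x) < e"
      using per[OF ye] by auto
    show "\<exists>t\<ge>0. vnorm Xn (y - csg t x) < e"
      using orb[OF ye] by auto
  qed
qed

lemma imaginary_zero_of_subchaotic_op:
  assumes res: "\<exists>z\<in>disc. G_res n f z \<noteq> 0" and t: "t > 0"
    and Y: "subchaotic_op_wrt Xn (csg t) Y"
  shows "\<exists>l0 z0. Re l0 = 0 \<and> z0 \<in> disc \<and> G n f l0 z0 = 0 \<and> G_res n f z0 \<noteq> 0"
proof -
  have cl: "closed_subspace Xn Y" and Y0: "Y \<noteq> {0}"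
    and ch: "devaney_chaotic_op (Xn\<lparr>vecs := Y\<rparr>) (csg t)"
    using Y by (auto simp: subchaotic_op_wrt_def)
  interpret Y: bfspace "Xn\<lparr>vecs := Y\<rparr>" by (rule V.restrict_bfspace[OF cl])
  from ch obtain x where x: "x \<in> Y"
    and d: "dense_in (Xn\<lparr>vecs := Y\<rparr>) {(csg t ^^ k) x |k. True}"
    and p: "dense_in (Xn\<lparr>vecs := Y\<rparr>) {x \<in> Y. \<exists>k\<ge>1. (csg t ^^ k) x = x}"
    unfolding devaney_chaotic_op_def by auto
  have per: "\<exists>z\<in>{x \<in> Y. \<exists>k\<ge>1. (csg t ^^ k) x = x}.
      z \<in> Y \<and> vnorm Xn (y - z) < e" if "y \<in> Y" "e > 0" for y and e :: real
    using p that unfolding Y.dense_in_iff by simp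
  have orb: "\<exists>z\<in>{(csg t ^^ k) x |k. True}.
      z \<in> Y \<and> vnorm Xn (y - z) < e" if "y \<in> Y" "e > 0" for y and e :: real
    using d that unfolding Y.dense_in_iff by simp
  have pw: "(csg t ^^ k) y = csg (of_nat k * t) y" if "y \<in> Y" for k y
    using A.op_exp_pow[OF subsetD[OF V.closed_subspaceD(1)[OF cl] that], where t = t and k = k] .
  show ?thesis
  proof (rule imaginary_zero_of_chaotic[OF res cl Y0 _ x])
    fix y and e :: real assume ye: "y \<in> Y" "e > 0"
    obtain z k where z: "z \<in> Y" "k \<ge> 1" "(csg t ^^ k) z = z" "vnorm Xn (y - z) < e"
      using per[OF ye] by auto
    have "csg (of_nat k * t) z = z" using pw[OF z(1), of k] z(3) by simp
    moreover have "of_nat k * t > 0" using z(2) t by simp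
    ultimately show "\<exists>x\<in>Y. (\<exists>t>0. csg t x = x) \<and> vnorm Xn (y - x) < e"
      using z by blast
    obtain k where "vnorm Xn (y - (csg t ^^ k) x) < e"
      using orb[OF ye] by auto
    then show "\<exists>t\<ge>0. vnorm Xn (y - csg t x) < e"
      using t unfolding pw[OF x] by (intro exI[of _ "of_nat k * t"]) auto
  qed
qed

text \<open>The equation is solved for \<open>w = 1 + h * z\<close>. Its derivative in
  \<open>w\<close> at the base point is that of \<open>G\<close> in \<open>z\<close> divided by
  \<open>h\<close>; it cannot vanish, since \<open>l0\<close> would then be a common root and the
  resultant at \<open>z0\<close> would be 0.\<close>

lemma eigenvalue_branch:
  assumes l0: "Re l0 = 0" and z0: "z0 \<in> disc"
    and G0: "G n f l0 z0 = 0" and res: "G_res n f z0 \<noteq> 0"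
  shows "\<exists>\<delta>>0. \<exists>u. u holomorphic_on ball l0 \<delta> \<and> u l0 = 1 + of_real h * z0 \<and>
    (\<forall>l\<in>ball l0 \<delta>. norm (u l) < 1 \<and> G n f l ((u l - 1) / of_real h) = 0)"
proof -
  define w0 where "w0 = 1 + of_real h * z0"
  have w0: "norm w0 < 1" using z0 unfolding mem_disc_iff[OF h] w0_def .
  have zw: "(w0 - 1) / of_real h = z0" using h by (simp add: w0_def)
  define \<phi> where "\<phi> j = (\<lambda>w. f (Suc j) ((w - 1) / of_real h))" for j
  have hol: "\<phi> j holomorphic_on ball 0 1" if "j < n" for j unfolding \<phi>_def by (rule hol_coordinate[OF that])
  have der: "(\<phi> j has_field_derivative deriv (\<phi> j) w) (at w)" if "j < n" "w \<in> ball 0 1" for j w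
    using holomorphic_derivI[OF hol[OF that(1)] open_ball that(2)] .
  define \<Gamma> where "\<Gamma> l w = (\<Sum>j<n. l ^ j * \<phi> j w) - l ^ n" for l w
  define \<Gamma>' where "\<Gamma>' l w = (\<Sum>j<n. l ^ j * deriv (\<phi> j) w)" for l w
  have \<Gamma>G: "\<Gamma> l w = G n f l ((w - 1) / of_real h)" for l w by (simp add: \<Gamma>_def \<phi>_def G_eq)
  have nz: "\<Gamma>' l0 w0 \<noteq> 0"
  proof
    assume 0: "\<Gamma>' l0 w0 = 0"
    have "deriv (\<phi> j) w0 = deriv (f (Suc j)) z0 / of_real h" if j: "j < n" for j
    proof -
      have "f (Suc j) field_differentiable at z0"
        using hol_f[OF j] z0 holomorphic_on_imp_differentiable_at by blast
      then have "(f (Suc j) has_field_derivative deriv (f (Suc j)) z0) (at ((w0 - 1) / of_real h))"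
        by (simp add: DERIV_deriv_iff_field_differentiable zw)
      moreover have "((\<lambda>w. (w - 1) / complex_of_real h) has_field_derivative 1 / of_real h) (at w0)"
        using h by (auto intro!: derivative_eq_intros)
      ultimately have "(\<phi> j has_field_derivative deriv (f (Suc j)) z0 * (1 / of_real h)) (at w0)"
        unfolding \<phi>_def by (rule DERIV_chain2)
      then show ?thesis by (simp add: DERIV_imp_deriv)
    qed
    then have "\<Gamma>' l0 w0 = (\<Sum>j<n. l0 ^ j * deriv (f (Suc j)) z0) / of_real h"
      by (simp add: \<Gamma>'_def sum_divide_distrib)
    then have "(\<Sum>j<n. l0 ^ j * deriv (f (Suc j)) z0) = 0" using 0 h by simp
    then have "poly (dG_poly n f z0) l0 = 0"
      by (simp add: dG_poly_def poly_sum poly_monom sum.atLeast1_atMost_eq mult.commute)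
    then show False using G_res_common_root[OF n G0] res by simp
  qed
  have "\<exists>\<delta>>0. \<exists>u. u holomorphic_on ball l0 \<delta> \<and> u l0 = w0 \<and>
    (\<forall>l\<in>ball l0 \<delta>. u l \<in> ball 0 1 \<and> \<Gamma> l (u l) = 0)"
  proof (rule implicit_branch[where \<Gamma> = \<Gamma> and \<Gamma>' = \<Gamma>'])
    show "open (ball (0::complex) 1)" "\<Gamma>' l0 w0 \<noteq> 0" by (rule open_ball, rule nz)
    show "w0 \<in> ball 0 1" using w0 by simp
    show "\<Gamma> l0 w0 = 0" using G0 by (simp add: \<Gamma>G zw)
    show "(\<Gamma> l has_field_derivative \<Gamma>' l w) (at w)" if w: "w \<in> ball 0 1" for l w
    proof -
      have "((\<lambda>w. (\<Sum>j<n. l ^ j * \<phi> j w) - l ^ n) has_field_derivative (\<Sum>j<n. l ^ j * deriv (\<phi> j) w) - 0) (at w)"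
        by (intro DERIV_diff DERIV_sum DERIV_cmult DERIV_const der) (use w in auto)
      then show ?thesis by (simp add: \<Gamma>_def[abs_def] \<Gamma>'_def)
    qed
    show "continuous_on (UNIV \<times> ball 0 1) (\<lambda>(l, w). \<Gamma>' l w)"
    proof -
      have "continuous_on (UNIV \<times> ball 0 1) (\<lambda>p :: complex \<times> complex. deriv (\<phi> j) (snd p))" if "j < n" for j
        by (rule continuous_on_compose2[OF holomorphic_on_imp_continuous_on[OF holomorphic_deriv[OF hol[OF that] open_ball]]])
          (auto intro!: continuous_intros)
      then have "continuous_on (UNIV \<times> ball 0 1) (\<lambda>p. \<Sum>j<n. fst p ^ j * deriv (\<phi> j) (snd p))"
        by (intro continuous_intros) auto
      then show ?thesis by (simp add: \<Gamma>'_def case_prod_beta)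
    qed
    show "continuous_on UNIV (\<lambda>l. \<Gamma> l w0)" unfolding \<Gamma>_def by (intro continuous_intros)
    show "(\<lambda>l. \<Gamma> l (u l)) holomorphic_on L" if u: "u holomorphic_on L" "u ` L \<subseteq> ball 0 1" for u L
    proof -
      have "(\<lambda>l. \<phi> j (u l)) holomorphic_on L" if "j < n" for j
        using holomorphic_on_compose_gen[OF u(1) hol[OF that] u(2)] by (simp add: o_def)
      then show ?thesis unfolding \<Gamma>_def by (intro holomorphic_intros) auto
    qed
  qed
  then show ?thesis by (simp add: \<Gamma>G w0_def)
qed

text \<open>The vector with components \<open>l ^ i\<close> times the geometric sequence with ratio
  \<open>u l\<close> is an eigenvector of the companion operator for \<open>l\<close>: the upper
  rows multiply by \<open>l\<close>, and the last row is the equation G = 0.\<close>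

theorem chaotic_of_imaginary_zero:
  assumes l0: "Re l0 = 0" and z0: "z0 \<in> disc"
    and G0: "G n f l0 z0 = 0" and res: "G_res n f z0 \<noteq> 0"
  defines "T \<equiv> csg"
  shows "\<exists>Y. subchaotic_sg_wrt Xn T Y \<and> dense_in X (proj0 ` Y) \<and>
    (\<forall>t>0. subchaotic_op_wrt Xn (T t) Y)"
proof -
  define w0 where "w0 = 1 + of_real h * z0"
  have w0: "norm w0 < 1" using z0 unfolding mem_disc_iff[OF h] w0_def .
  obtain \<delta> u where \<delta>: "\<delta> > 0" and u: "u holomorphic_on ball l0 \<delta>" "u l0 = w0"
    "\<And>l. l \<in> ball l0 \<delta> \<Longrightarrow> norm (u l) < 1 \<and> G n f l ((u l - 1) / of_real h) = 0"
    using eigenvalue_branch[OF l0 z0 G0 res] unfolding w0_def by blast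
  \<comment> \<open>As long as \<open>norm (u l)\<close> is at most this number, the sequences
    \<open>u l ^ k\<close> have a common geometric majorant with ratio less than 1.\<close>
  define \<rho> where "\<rho> = (1 + norm w0) / 2"
  have \<rho>: "norm w0 < \<rho>" "0 \<le> \<rho>" "\<rho> < 1" using w0 by (auto simp: \<rho>_def add_nonneg_nonneg)
  have "isCont u l0"
    using u(1) \<delta> by (intro continuous_on_interior[OF holomorphic_on_imp_continuous_on]) auto
  then have unear: "\<exists>d>0. \<forall>l. dist l l0 < d \<longrightarrow> dist (u l) w0 < e" if "e > 0" for e
    using that u(2) unfolding continuous_at_eps_delta by auto
  obtain d where d: "d > 0" "\<And>l. dist l l0 < d \<Longrightarrow> dist (u l) w0 < \<rho> - norm w0"
    using unear[of "\<rho> - norm w0"] \<rho> by auto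
  define r where "r = min \<delta> d"
  have r: "r > 0" "ball l0 r \<subseteq> ball l0 \<delta>" using \<delta> d by (auto simp: r_def)
  have u\<rho>: "norm (u l) \<le> \<rho>" if "l \<in> ball l0 r" for l
  proof -
    have "dist (u l) w0 < \<rho> - norm w0" using that by (intro d(2)) (simp add: r_def dist_commute)
    then show ?thesis using norm_triangle_ineq[of w0 "u l - w0"] by (simp add: dist_norm)
  qed
  \<comment> \<open>The summand 1 gives \<open>B \<ge> 1\<close>, so that \<open>norm l ^ i\<close>
    is at most \<open>B ^ n\<close> for all \<open>i < n\<close>.\<close>
  define B where "B = norm l0 + r + 1"
  have B: "B \<ge> 1" using r by (simp add: B_def)
  have lB: "norm l \<le> B" if "l \<in> ball l0 r" for l
    using norm_triangle_ineq[of l0 "l - l0"] that by (simp add: B_def dist_norm norm_minus_commute)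
  define \<Phi> where "\<Phi> l = (\<lambda>(i, k). if i < n then l ^ i * u l ^ k else 0)" for l :: complex
  define s where "s = (\<lambda>(i, k). if i < n then B ^ n * \<rho> ^ k else 0)"
  have c\<Phi>: "curry (\<Phi> l) i = (if i < n then scl (l ^ i) (\<lambda>k. u l ^ k) else 0)" for l i
    by (auto simp: \<Phi>_def fun_eq_iff vec_apply curry_def)
  have eX: "(\<lambda>k. u l ^ k) \<in> vecs X" if "l \<in> ball l0 \<delta>" for l
    using u(3)[OF that] by (intro geometric_vec) simp
  obtain K where K: "\<And>x C. C \<ge> 0 \<Longrightarrow> (\<And>k. norm (x k) \<le> C * \<rho> ^ k) \<Longrightarrow> x \<in> vecs X \<and> vnorm X x \<le> C * K"
    using geometric[OF \<rho>(2,3)] by blast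
  have \<Phi>V: "\<Phi> l \<in> vecs Xn" if "l \<in> ball l0 \<delta>" for l
    using eX[OF that] by (auto simp: V_mem c\<Phi>)
  have eig: "cop (\<Phi> l) = scl l (\<Phi> l)" if l: "l \<in> ball l0 \<delta>" for l
  proof (rule V_eqI)
    show "cop (\<Phi> l) \<in> vecs Xn" by (rule A.op_mem[OF \<Phi>V[OF l]])
    show "scl l (\<Phi> l) \<in> vecs Xn" by (rule V.scl_mem[OF \<Phi>V[OF l]])
    fix i assume i: "i < n"
    define e where "e = (\<lambda>k. u l ^ k)"
    have e: "e \<in> vecs X" "shift e = scl (u l) e"
      unfolding e_def using eX[OF l] by (auto simp: fun_eq_iff shift_apply vec_apply)
    have ul: "norm (u l) < 1" "ereal (norm (u l)) < ereal 1" using u(3)[OF l] by auto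
    have "(\<Sum>j<n. fcalc (F (Suc j)) shift (curry (\<Phi> l) j)) = scl (l ^ n) e"
    proof -
      have "fcalc (F (Suc j)) shift (curry (\<Phi> l) j) = scl (l ^ j * f (Suc j) ((u l - 1) / of_real h)) e" if j: "j < n" for j
      proof -
        have "fcalc (F (Suc j)) shift e = scl (eval_fps (F (Suc j)) (u l)) e"
          by (rule B.fcalc_eigen[OF e less_trans[OF ul(2) F_radius[OF j]]])
        then show ?thesis
          using j bop.op_scl[OF B.bop_fcalc[OF F_radius[OF j]] e(1)] ul
          by (simp add: c\<Phi> e_def[symmetric] eval_F)
      qed
      then have "(\<Sum>j<n. fcalc (F (Suc j)) shift (curry (\<Phi> l) j))
          = scl (\<Sum>j<n. l ^ j * f (Suc j) ((u l - 1) / of_real h)) e"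
        unfolding cvec.scale_sum_left by (intro sum.cong) auto
      also have "(\<Sum>j<n. l ^ j * f (Suc j) ((u l - 1) / of_real h)) = l ^ n"
        using u(3)[OF l] by (simp add: G_eq)
      finally show ?thesis .
    qed
    moreover have "curry (scl l (\<Phi> l)) i = scl (l ^ Suc i) e"
      using i by (simp add: curry_simps c\<Phi> e_def)
    moreover have "n = Suc i" if "\<not> Suc i < n" using that i by simp
    ultimately show "curry (cop (\<Phi> l)) i = curry (scl l (\<Phi> l)) i"
      unfolding curry_companion[OF \<Phi>V[OF l]] by (auto simp: c\<Phi> e_def)
  qed
  obtain Y where Y: "\<And>l. l \<in> ball l0 r \<Longrightarrow> \<Phi> l \<in> Y" "subchaotic_sg_wrt Xn T Y"
    "\<And>t. t > 0 \<Longrightarrow> subchaotic_op_wrt Xn (T t) Y"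
  proof -
    have "\<exists>Y. (\<forall>l\<in>ball l0 r. \<Phi> l \<in> Y) \<and> subchaotic_sg_wrt Xn T Y \<and> (\<forall>t>0. subchaotic_op_wrt Xn (T t) Y)"
      unfolding T_def
    proof (rule A.chaos_from_eigenvectors[OF r(1) l0])
      have "\<Phi> l0 (0, 0) = 1" using n by (simp add: \<Phi>_def)
      then show "\<Phi> l0 \<noteq> 0" by (auto simp: vec_apply)
      show "(\<lambda>l. \<Phi> l p) holomorphic_on ball l0 r" for p
        using holomorphic_on_subset[OF u(1) r(2)]
        by (cases p; cases "fst p < n") (auto simp: \<Phi>_def intro!: holomorphic_intros)
      show "norm (\<Phi> l p) \<le> s p" if l: "l \<in> ball l0 r" for l p
      proof -
        obtain i k where p: "p = (i, k)" by fastforce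
        have "norm l ^ i * norm (u l) ^ k \<le> B ^ n * \<rho> ^ k" if "i < n"
        proof (intro mult_mono power_mono u\<rho>[OF l])
          have "norm l ^ i \<le> B ^ i" by (intro power_mono lB[OF l]) simp
          also have "\<dots> \<le> B ^ n" using that B by (intro power_increasing) auto
          finally show "norm l ^ i \<le> B ^ n" .
        qed (use B in auto)
        then show ?thesis by (simp add: p \<Phi>_def s_def norm_mult norm_power)
      qed
      show "cop (\<Phi> l) = scl l (\<Phi> l)" if "l \<in> ball l0 r" for l
        using eig that r(2) by blast
      show "x \<in> vecs Xn \<and> vnorm Xn x \<le> C * (real n * (B ^ n * K))" if C: "C \<ge> 0" and x: "\<And>p. norm (x p) \<le> C * s p" for x C
      proof -
        have CB: "C * B ^ n \<ge> 0" using C B by simp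
        have comp: "curry x i \<in> vecs X \<and> vnorm X (curry x i) \<le> C * B ^ n * K" if "i < n" for i
          using x[of "(i, _)"] that by (intro K[OF CB]) (simp add: s_def curry_def mult.assoc)
        moreover have "curry x i = 0" if "i \<ge> n" for i
        proof
          fix k show "curry x i k = 0 k" using x[of "(i, k)"] that by (simp add: s_def curry_def vec_apply)
        qed
        moreover have "vnorm Xn x \<le> (\<Sum>i<n. C * B ^ n * K)"
          unfolding V_norm using comp by (intro sum_mono) auto
        ultimately show ?thesis by (simp add: V_mem mult_ac)
      qed
    qed
    then show ?thesis using that by blast
  qed

  \<comment> \<open>Density of the first components\<close>
  have clY: "closed_subspace Xn Y" using Y(2) by (simp add: subchaotic_sg_wrt_def)
  note YD = V.closed_subspaceD[OF clY]
  have PX: "proj0 ` Y \<subseteq> vecs X" using YD(1) n by (auto simp: proj0_def V_mem)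
  have Psub: "cvec.subspace (proj0 ` Y)"
  proof (rule cvec.subspaceI)
    have "proj0 0 = 0" by (simp add: proj0_def curry_simps)
    then show "0 \<in> proj0 ` Y" using YD(2) by force
    fix a b assume "a \<in> proj0 ` Y" "b \<in> proj0 ` Y"
    then obtain x y where xy: "x \<in> Y" "y \<in> Y" "a = proj0 x" "b = proj0 y" by blast
    then have "a + b = proj0 (x + y)" by (simp add: proj0_def curry_simps)
    then show "a + b \<in> proj0 ` Y" using YD(3)[OF xy(1,2)] by blast
  next
    fix c a assume "a \<in> proj0 ` Y"
    then obtain x where x: "x \<in> Y" "a = proj0 x" by blast
    then have "scl c a = proj0 (scl c x)" by (simp add: proj0_def curry_simps)
    then show "scl c a \<in> proj0 ` Y" using YD(4)[OF x(1)] by blast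
  qed
  \<comment> \<open>The projection of a closed subspace need not be closed, so totality is shown for
    its closure.\<close>
  define Z where "Z = {x \<in> vecs X. \<forall>e>0. \<exists>y\<in>proj0 ` Y. vnorm X (x - y) < e}"
  have Z: "closed_subspace X Z" "proj0 ` Y \<subseteq> Z"
    unfolding Z_def by (rule closed_subspace_closure[OF PX Psub])+
  have ZX: "Z = vecs X"
  proof (rule geometric_total[OF Z(1) w0])
    fix e :: real assume "e > 0"
    then obtain d' where d': "d' > 0" "\<And>l. dist l l0 < d' \<Longrightarrow> dist (u l) w0 < e" using unear by blast
    define q where "q = min d' r"
    have q: "q > 0" using d' r by (simp add: q_def)
    \<comment> \<open>This makes \<open>u\<close> nonconstant near \<open>l0\<close>: G(., z0) has
      finitely many roots, so a nearby \<open>l\<close> can be chosen that is not one of them, and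
      for this \<open>l\<close> the value \<open>u l\<close> differs from \<open>w0\<close>.\<close>
    have "infinite (ball l0 q)" using uncountable_infinite[OF uncountable_ball[OF q]] .
    moreover have "finite {l. G n f l z0 = 0}" by (rule finite_G_zeros)
    ultimately have "infinite (ball l0 q - {l. G n f l z0 = 0})" by (rule Diff_infinite_finite[rotated])
    then have "ball l0 q - {l. G n f l z0 = 0} \<noteq> {}" using finite.emptyI by metis
    then obtain l where l: "l \<in> ball l0 q" "G n f l z0 \<noteq> 0" by blast
    have lr: "l \<in> ball l0 r" using l(1) by (simp add: q_def)
    then have "G n f l ((u l - 1) / of_real h) = 0" using u(3) r(2) by blast
    moreover have "(w0 - 1) / of_real h = z0" using h by (simp add: w0_def)
    ultimately have ne: "u l \<noteq> w0" using l(2) by metis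
    have "norm (u l - w0) < e" using d'(2)[of l] l(1) by (simp add: q_def dist_norm norm_minus_commute)
    moreover have "(\<lambda>k. u l ^ k) \<in> Z"
    proof -
      have "proj0 (\<Phi> l) = (\<lambda>k. u l ^ k)" using n by (simp add: proj0_def c\<Phi>)
      then show ?thesis using subsetD[OF Z(2) imageI[OF Y(1)[OF lr], of proj0]] by simp
    qed
    ultimately show "\<exists>w. w \<noteq> w0 \<and> norm (w - w0) < e \<and> (\<lambda>k. w ^ k) \<in> Z" using ne by blast
  qed
  have "dense_in X (proj0 ` Y)"
    unfolding dense_in_iff
  proof (intro ballI allI impI)
    fix x and e :: real assume "x \<in> vecs X" "e > 0"
    then have "x \<in> Z" by (simp add: ZX)
    then have "\<exists>y\<in>proj0 ` Y. vnorm X (x - y) < e" using \<open>e > 0\<close> unfolding Z_def by blast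
    then show "\<exists>y\<in>proj0 ` Y. y \<in> vecs X \<and> vnorm X (x - y) < e" using PX by blast
  qed
  then show ?thesis using Y by blast
qed

end

theorem theorem5p2:
  fixes X :: "nat fspace" and h :: real and n :: nat and f :: "nat \<Rightarrow> complex \<Rightarrow> complex"
    and D D_closed :: "complex set"
    and A :: "(nat \<times> nat \<Rightarrow> complex) \<Rightarrow> (nat \<times> nat \<Rightarrow> complex)"
    and T :: "real \<Rightarrow> (nat \<times> nat \<Rightarrow> complex) \<Rightarrow> (nat \<times> nat \<Rightarrow> complex)"
  defines "D \<equiv> ball (- 1 / of_real h) (1 / h)"
    and "D_closed \<equiv> cball (- 1 / of_real h) (1 / h)"
    and "A \<equiv> companion_op X h n f"
    and "T \<equiv> op_exp (power_space X n) A"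
  assumes X: "(\<exists>p\<ge>1. X = lp_space p) \<or> X = c0_space"
    and h: "h > 0"
    and n: "n \<ge> 1"
    and f: "\<And>i. i \<in> {1..n} \<Longrightarrow> f i analytic_on D_closed"
    and res: "\<exists>z\<in>D. G_res n f z \<noteq> 0"
  defines "stmt_i \<equiv> generates (power_space X n) A T \<and>
      subchaotic_sg (power_space X n) T \<and> chaotic_projection X n T"
    and "stmt_ii \<equiv> \<exists>l0 z0. Re l0 = 0 \<and> z0 \<in> D \<and> G n f l0 z0 = 0 \<and> G_res n f z0 \<noteq> 0"
    and "stmt_iii \<equiv> \<forall>S\<in>autonomous_discretizations T. subchaotic_op (power_space X n) S"
    and "stmt_iv \<equiv> \<exists>S\<in>autonomous_discretizations T. subchaotic_op (power_space X n) S"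
  shows "(stmt_i \<longleftrightarrow> stmt_ii) \<and> (stmt_ii \<longleftrightarrow> stmt_iii) \<and> (stmt_iii \<longleftrightarrow> stmt_iv)"
proof -
  have "seqspace X" using X lp_seqspace c0_seqspace by auto
  then interpret companion X h n f
    using h n f unfolding companion_def companion_axioms_def D_closed_def by blast
  have i_ii: "stmt_ii" if i: "stmt_i"
  proof -
    obtain Y where "subchaotic_sg_wrt (power_space X n) T Y"
      using i unfolding stmt_i_def subchaotic_sg_def by blast
    then show ?thesis
      using imaginary_zero_of_subchaotic_sg res unfolding stmt_ii_def D_def T_def A_def by blast
  qed
  have iv_ii: "stmt_ii" if iv: "stmt_iv"
  proof -
    obtain t Y where "t > 0" "subchaotic_op_wrt (power_space X n) (T t) Y"
      using iv unfolding stmt_iv_def autonomous_discretizations_def subchaotic_op_def by blast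
    then show ?thesis
      using imaginary_zero_of_subchaotic_op res unfolding stmt_ii_def D_def T_def A_def by blast
  qed
  have ii_i_iii: "stmt_i \<and> stmt_iii" if ii: "stmt_ii"
  proof -
    obtain Y where Y: "subchaotic_sg_wrt (power_space X n) T Y" "dense_in X (proj0 ` Y)"
      "\<And>t. t > 0 \<Longrightarrow> subchaotic_op_wrt (power_space X n) (T t) Y"
      using ii chaotic_of_imaginary_zero unfolding stmt_ii_def D_def T_def A_def by blast
    have "generates (power_space X n) A T"
      unfolding T_def A_def by (rule A.generates_op_exp)
    then show ?thesis
      using Y unfolding stmt_i_def stmt_iii_def subchaotic_sg_def chaotic_projection_def
        autonomous_discretizations_def subchaotic_op_def by blast
  qed
  have iii_iv: "stmt_iv" if "stmt_iii"
  proof -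
    have "T 1 \<in> autonomous_discretizations T" unfolding autonomous_discretizations_def by force
    then show ?thesis using that unfolding stmt_iii_def stmt_iv_def by blast
  qed
  show ?thesis using i_ii iv_ii ii_i_iii iii_iv by blast
qed

end
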